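(* Let $n\ge 2$, $1\le d\le n-1$, $s\in\mathbb{R}$, and let $w:\mathbb{Z}^n\times\mathbf{Gr}(d,n)\to(0,\infty)$ be a weight. Let $\Omega_k:=\{A\in\mathbf{Gr}(d,n):k\perp A\}$ and $W_k:=\sum_{A\in\Omega_k}w(k,A)^2$. Suppose that there exist $C_w>0$ and $c_w>0$ such that $c_w^2\le W_k\le C_w^2$ for every $k\in\mathbb{Z}^n$. (i) Then $F_{W_k^{-1}}R_d^*: L_s^{2,2}(X_{d,n};w)\to H^s(\mathbb{T}^n)$ is $1/c_w$-Lipschitz. (ii) Let $f\in\mathcal{T}'$. Then $$\|f\|_{H^s(\mathbb{T}^n)}\le\frac{1}{c_w}\|R_df\|_{L_s^{2,2}(X_{d,n};w)}.$$ (iii) Let $\tilde w(k,A)=\dfrac{w(k,A)}{\sqrt{W_k}}$ and $p\in[1,\infty]$. Then $R_d^{*,\tilde w}R_df=f$ and $\|f\|_{L_s^p(\mathbb{T}^n)}=\|R_d^{*,\tilde w}R_df\|_{L_s^p(\mathbb{T}^n)}$ for every $f\in\mathcal{T}'$.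
   Context: Let $\mathbb{T}^n=\mathbb{R}^n/\mathbb{Z}^n$, $\mathcal{T}=C^\infty(\mathbb{T}^n)$, and let $\mathcal{T}'$ be its dual, the space of periodic distributions, with duality pairing $(\cdot,\cdot)$ (so $(f,g)=\int_{\mathbb{T}^n}fg$ for functions). Fourier coefficients are $\hat f(k)=(f,e^{-2\pi i k\cdot x})$, $k\in\mathbb{Z}^n$. $\mathbf{Gr}(d,n)$ is the set of all $d$-dimensional linear subspaces of $\mathbb{Q}^n$; $k\perp A$ means $k\cdot v=0$ for all $v\in A$. Radon transform: for $f\in\mathcal{T}$ and linearly independent $v_1,\dots,v_d\in\mathbb{Z}^n$, with $A=\{v_1,\dots,v_d\}$, $R_df(x,A)=\int_{[0,1]^d}f(x+t_1v_1+\cdots+t_dv_d)\,dt_1\cdots dt_d$. For $f\in\mathcal{T}'$, $R_df(\cdot,A)\in\mathcal{T}'$ is defined by $(R_df(\cdot,A),g)=(f,R_dg(\cdot,A))$ for all $g\in\mathcal{T}$. This depends only on the subspace of $\mathbb{Q}^n$ spanned by $A$, so $R_df(\cdot,A)$ is regarded as defined for $A\in\mathbf{Gr}(d,n)$. Fourier multipliers: for $\omega:\mathbb{Z}^n\to\mathbb{R}$, $F_\omega$ acts by $\widehat{F_\omega f}(k)=\omega(k)\hat f(k)$; $F_{W_k^{-1}}$ is the multiplier $k\mapsto W_k^{-1}$. Write $\langle k\rangle=(1+|k|^2)^{1/2}$; $(1-\Delta)^{s/2}$ denotes the Fourier multiplier $\langle k\rangle^s$. For $p\in[1,\infty]$,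 $L_s^p(\mathbb{T}^n)$ is the set of $f\in\mathcal{T}'$ with $\|f\|_{L_s^p}:=\|(1-\Delta)^{s/2}f\|_{L^p(\mathbb{T}^n)}<\infty$ (norms are $+\infty$ outside the space), and $H^s=L_s^2$, so $\|f\|_{H^s}^2=\sum_k\langle k\rangle^{2s}|\hat f(k)|^2$. Weights: a weight is a function $w:\mathbb{Z}^n\times\mathbf{Gr}(d,n)\to(0,\infty)$ such that for each fixed $A$ there exist $C,N>0$ (possibly depending on $A$) with $w(k,A)\ge C\langle k\rangle^{-N}$ for all $k\in\mathbb{Z}^n$ (at most of polynomial decay). Data space: $X_{d,n}=\mathbb{T}^n\times\mathbf{Gr}(d,n)$, and $L_s^{2,2}(X_{d,n};w)$ is the Hilbert space of families $g=\{g(\cdot,A)\}_{A\in\mathbf{Gr}(d,n)}$ with $g(\cdot,A)\in\mathcal{T}'$ and $\|g\|^2=\sum_{A}\|F_{w(\cdot,A)}g(\cdot,A)\|_{H^s(\mathbb{T}^n)}^2<\infty$ (the norm is $+\infty$ otherwise), with the inner product $(h,g)=\sum_A(F_{w(\cdot,A)}h(\cdot,A),F_{w(\cdot,A)}g(\cdot,A))_{H^s(\mathbb{T}^n)}$. Adjoint: $R_d^*=R_d^{*,w}$ is the adjoint of $R_d:H^s(\mathbb{T}^n)\to L_s^{2,2}(X_{d,n};w)$; it is given by $\widehat{R_d^{*,w}g}(k)=\sum_{A\in\Omega_k}w(k,A)^2\hat g(k,A)$, where $\hat g(k,A)$ is the $k$-th Fourier coefficient of $g(\cdot,A)$, and this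 formula is also used to apply $R_d^{*,w}$ to elements of $R_d(\mathcal{T}')$. $R_d^{*,\tilde w}$ is the same object with $w$ replaced by $\tilde w$. *)

theory Defs
  imports "HOL-Analysis.Analysis" "HOL-Probability.Essential_Supremum"
begin

section \<open>Test functions and periodic distributions\<close>

text \<open>Functions on the torus are functions on \<open>real ^ 'n\<close> with period lattice \<open>int ^ 'n\<close>.\<close>

definition partial_deriv :: "'n \<Rightarrow> (real ^ 'n \<Rightarrow> complex) \<Rightarrow> (real ^ 'n \<Rightarrow> complex)"
  where "partial_deriv i f = (\<lambda>x. frechet_derivative f (at x) (axis i 1))"

primrec iter_deriv :: "'n list \<Rightarrow> (real ^ 'n \<Rightarrow> complex) \<Rightarrow> (real ^ 'n \<Rightarrow> complex)"
  where
    "iter_deriv [] f = f"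
  | "iter_deriv (i # js) f = partial_deriv i (iter_deriv js f)"

definition smooth :: "(real ^ 'n \<Rightarrow> complex) \<Rightarrow> bool"
  where "smooth f \<longleftrightarrow> (\<forall>js x. iter_deriv js f differentiable (at x))"

definition real_vec :: "int ^ 'n \<Rightarrow> real ^ 'n"
  where "real_vec k = (\<chi> i. of_int (k $ i))"

definition rat_vec :: "int ^ 'n \<Rightarrow> rat ^ 'n"
  where "rat_vec k = (\<chi> i. of_int (k $ i))"

definition test_funs :: "(real ^ 'n \<Rightarrow> complex) set"
  where "test_funs = {f. smooth f \<and> (\<forall>x k. f (x + real_vec k) = f x)}"

text \<open>
  The dual of the Frechet space of test functions: linear functionals bounded by a finite sum of
  the seminorms \<open>sup |\<partial>^\<alpha> g|\<close>. Only the values on test functions matter; functionals are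
  set to 0 elsewhere, so that equality of distributions is equality in the logic.
\<close>

definition distributions :: "((real ^ 'n \<Rightarrow> complex) \<Rightarrow> complex) set"
  where "distributions = {u.
    (\<forall>g. g \<notin> test_funs \<longrightarrow> u g = 0) \<and>
    (\<forall>g\<in>test_funs. \<forall>h\<in>test_funs. u (\<lambda>x. g x + h x) = u g + u h) \<and>
    (\<forall>g\<in>test_funs. \<forall>c. u (\<lambda>x. c * g x) = c * u g) \<and>
    (\<exists>C m. \<forall>g\<in>test_funs.
      cmod (u g) \<le> C * (\<Sum>js | length js \<le> m. SUP x. cmod (iter_deriv js g x)))}"

definition fourier_coeff :: "((real ^ 'n \<Rightarrow> complex) \<Rightarrow> complex) \<Rightarrow> int ^ 'n \<Rightarrow> complex"
  where "fourier_coeff u k = u (\<lambda>x. exp (- 2 * of_real pi * \<i> * of_real (real_vec k \<bullet> x)))"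

section \<open>Fourier multipliers and Bessel potential spaces\<close>

text \<open>
  A multiplier of super-polynomial growth may lead out of the space of distributions;
  \<open>fourier_mult \<omega> u\<close> is meaningful only if \<open>in_mult_domain \<omega> u\<close>.
\<close>

definition in_mult_domain ::
    "(int ^ 'n \<Rightarrow> real) \<Rightarrow> ((real ^ 'n \<Rightarrow> complex) \<Rightarrow> complex) \<Rightarrow> bool"
  where "in_mult_domain \<omega> u \<longleftrightarrow>
    (\<exists>v\<in>distributions. \<forall>k. fourier_coeff v k = of_real (\<omega> k) * fourier_coeff u k)"

definition fourier_mult ::
    "(int ^ 'n \<Rightarrow> real) \<Rightarrow> ((real ^ 'n \<Rightarrow> complex) \<Rightarrow> complex)
      \<Rightarrow> ((real ^ 'n \<Rightarrow> complex) \<Rightarrow> complex)"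
  where "fourier_mult \<omega> u =
    (THE v. v \<in> distributions \<and> (\<forall>k. fourier_coeff v k = of_real (\<omega> k) * fourier_coeff u k))"

definition jap :: "int ^ 'n \<Rightarrow> real"
  where "jap k = sqrt (1 + (norm (real_vec k))\<^sup>2)"

definition bessel_pot ::
    "real \<Rightarrow> ((real ^ 'n \<Rightarrow> complex) \<Rightarrow> complex) \<Rightarrow> ((real ^ 'n \<Rightarrow> complex) \<Rightarrow> complex)"
  where "bessel_pot s = fourier_mult (\<lambda>k. jap k powr s)"

definition torus :: "(real ^ 'n) measure"
  where "torus = restrict_space lborel (cbox 0 1)"

definition represents ::
    "(real ^ 'n \<Rightarrow> complex) \<Rightarrow> ((real ^ 'n \<Rightarrow> complex) \<Rightarrow> complex) \<Rightarrow> bool"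
  where "represents h u \<longleftrightarrow> integrable torus h \<and>
    u = (\<lambda>g. if g \<in> test_funs then (LINT x|torus. h x * g x) else 0)"

definition representative :: "((real ^ 'n \<Rightarrow> complex) \<Rightarrow> complex) \<Rightarrow> (real ^ 'n \<Rightarrow> complex)"
  where "representative u = (SOME h. represents h u)"

definition ennreal_powr :: "ennreal \<Rightarrow> real \<Rightarrow> ennreal"
  where "ennreal_powr x a = (if x = \<infinity> then \<infinity> else ennreal (enn2real x powr a))"

definition Lp_norm_fun :: "ennreal \<Rightarrow> (real ^ 'n \<Rightarrow> complex) \<Rightarrow> ennreal"
  where "Lp_norm_fun p h =
    (if p = \<infinity> then esssup torus (\<lambda>x. ennreal (cmod (h x)))
     else ennreal_powr (\<integral>\<^sup>+x. ennreal (cmod (h x) powr enn2real p) \<partial>torus) (1 / enn2real p))"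

text \<open>Since the torus has finite measure, \<open>L^p\<close> functions are integrable, so that a distribution
  without an integrable representative is not in \<open>L^p\<close>.\<close>

definition Lp_norm :: "ennreal \<Rightarrow> ((real ^ 'n \<Rightarrow> complex) \<Rightarrow> complex) \<Rightarrow> ennreal"
  where "Lp_norm p u = (if \<exists>h. represents h u then Lp_norm_fun p (representative u) else \<infinity>)"

definition Lps_norm :: "real \<Rightarrow> ennreal \<Rightarrow> ((real ^ 'n \<Rightarrow> complex) \<Rightarrow> complex) \<Rightarrow> ennreal"
  where "Lps_norm s p u = Lp_norm p (bessel_pot s u)"

definition Hs_norm :: "real \<Rightarrow> ((real ^ 'n \<Rightarrow> complex) \<Rightarrow> complex) \<Rightarrow> ennreal"
  where "Hs_norm s u = Lps_norm s 2 u"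

definition Hs :: "real \<Rightarrow> ((real ^ 'n \<Rightarrow> complex) \<Rightarrow> complex) set"
  where "Hs s = {u \<in> distributions. Hs_norm s u < \<infinity>}"

definition Hs_inner ::
    "real \<Rightarrow> ((real ^ 'n \<Rightarrow> complex) \<Rightarrow> complex) \<Rightarrow> ((real ^ 'n \<Rightarrow> complex) \<Rightarrow> complex) \<Rightarrow> complex"
  where "Hs_inner s u v =
    (LINT x|torus. representative (bessel_pot s u) x * cnj (representative (bessel_pot s v) x))"

section \<open>The \<open>d\<close>-plane Radon transform\<close>

definition Gr :: "nat \<Rightarrow> (rat ^ 'n) set set"
  where "Gr d = {A. vec.subspace A \<and> vec.dim A = d}"

definition perp :: "int ^ 'n \<Rightarrow> (rat ^ 'n) set \<Rightarrow> bool"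
  where "perp k A \<longleftrightarrow> (\<forall>v\<in>A. (\<Sum>i\<in>UNIV. of_int (k $ i) * v $ i) = 0)"

definition Omega :: "nat \<Rightarrow> int ^ 'n \<Rightarrow> (rat ^ 'n) set set"
  where "Omega d k = {A \<in> Gr d. perp k A}"

definition radon_tuple ::
    "nat \<Rightarrow> (nat \<Rightarrow> int ^ 'n) \<Rightarrow> (real ^ 'n \<Rightarrow> complex) \<Rightarrow> (real ^ 'n \<Rightarrow> complex)"
  where "radon_tuple d v f = (\<lambda>x.
    LINT t:PiE {..<d} (\<lambda>_. {0..1})|PiM {..<d} (\<lambda>_. lborel).
      f (x + (\<Sum>i<d. t i *\<^sub>R real_vec (v i))))"

text \<open>The transform depends only on the rational span of the tuple \<open>v 0, \<dots>, v (d - 1)\<close>, so any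
  integer basis of \<open>A\<close> may be chosen.\<close>

definition int_basis :: "nat \<Rightarrow> (rat ^ 'n) set \<Rightarrow> (nat \<Rightarrow> int ^ 'n) \<Rightarrow> bool"
  where "int_basis d A v \<longleftrightarrow> inj_on v {..<d} \<and>
    vec.independent ((\<lambda>i. rat_vec (v i)) ` {..<d}) \<and>
    vec.span ((\<lambda>i. rat_vec (v i)) ` {..<d}) = A"

definition radon_fun ::
    "nat \<Rightarrow> (real ^ 'n \<Rightarrow> complex) \<Rightarrow> (rat ^ 'n) set \<Rightarrow> (real ^ 'n \<Rightarrow> complex)"
  where "radon_fun d f A = radon_tuple d (SOME v. int_basis d A v) f"

definition radon ::
    "nat \<Rightarrow> ((real ^ 'n \<Rightarrow> complex) \<Rightarrow> complex)
      \<Rightarrow> ((rat ^ 'n) set \<Rightarrow> (real ^ 'n \<Rightarrow> complex) \<Rightarrow> complex)"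
  where "radon d u A = (\<lambda>g. if g \<in> test_funs then u (radon_fun d g A) else 0)"

section \<open>Weights, data space and adjoint\<close>

definition weight :: "nat \<Rightarrow> (int ^ 'n \<Rightarrow> (rat ^ 'n) set \<Rightarrow> real) \<Rightarrow> bool"
  where "weight d w \<longleftrightarrow>
    (\<forall>k. \<forall>A\<in>Gr d. w k A > 0) \<and>
    (\<forall>A\<in>Gr d. \<exists>C>0. \<exists>N>0. \<forall>k. w k A \<ge> C * jap k powr (- N))"

text \<open>A divergent sum is 0 here; a positive lower bound on \<open>W_sum d w k\<close> therefore
  implies convergence.\<close>

definition W_sum :: "nat \<Rightarrow> (int ^ 'n \<Rightarrow> (rat ^ 'n) set \<Rightarrow> real) \<Rightarrow> int ^ 'n \<Rightarrow> real"
  where "W_sum d w k = (\<Sum>\<^sub>\<infinity>A\<in>Omega d k. (w k A)\<^sup>2)"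

text \<open>Families of distributions indexed by \<open>Gr d\<close>; values at other index sets are irrelevant.\<close>

definition data_norm ::
    "nat \<Rightarrow> real \<Rightarrow> (int ^ 'n \<Rightarrow> (rat ^ 'n) set \<Rightarrow> real)
      \<Rightarrow> ((rat ^ 'n) set \<Rightarrow> (real ^ 'n \<Rightarrow> complex) \<Rightarrow> complex) \<Rightarrow> ennreal"
  where "data_norm d s w g = ennreal_powr
    (\<Sum>\<^sub>\<infinity>A\<in>Gr d.
      if in_mult_domain (\<lambda>k. w k A) (g A)
      then (Hs_norm s (fourier_mult (\<lambda>k. w k A) (g A)))\<^sup>2 else \<infinity>)
    (1 / 2)"

definition data_space ::
    "nat \<Rightarrow> real \<Rightarrow> (int ^ 'n \<Rightarrow> (rat ^ 'n) set \<Rightarrow> real)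
      \<Rightarrow> ((rat ^ 'n) set \<Rightarrow> (real ^ 'n \<Rightarrow> complex) \<Rightarrow> complex) set"
  where "data_space d s w = {g. (\<forall>A\<in>Gr d. g A \<in> distributions) \<and> data_norm d s w g < \<infinity>}"

definition data_inner ::
    "nat \<Rightarrow> real \<Rightarrow> (int ^ 'n \<Rightarrow> (rat ^ 'n) set \<Rightarrow> real)
      \<Rightarrow> ((rat ^ 'n) set \<Rightarrow> (real ^ 'n \<Rightarrow> complex) \<Rightarrow> complex)
      \<Rightarrow> ((rat ^ 'n) set \<Rightarrow> (real ^ 'n \<Rightarrow> complex) \<Rightarrow> complex) \<Rightarrow> complex"
  where "data_inner d s w h g = (\<Sum>\<^sub>\<infinity>A\<in>Gr d.
    Hs_inner s (fourier_mult (\<lambda>k. w k A) (h A)) (fourier_mult (\<lambda>k. w k A) (g A)))"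

definition adjoint_value ::
    "nat \<Rightarrow> real \<Rightarrow> (int ^ 'n \<Rightarrow> (rat ^ 'n) set \<Rightarrow> real)
      \<Rightarrow> ((rat ^ 'n) set \<Rightarrow> (real ^ 'n \<Rightarrow> complex) \<Rightarrow> complex)
      \<Rightarrow> ((real ^ 'n \<Rightarrow> complex) \<Rightarrow> complex) \<Rightarrow> bool"
  where "adjoint_value d s w g h \<longleftrightarrow> h \<in> Hs s \<and>
    (\<forall>f\<in>Hs s. data_inner d s w (radon d f) g = Hs_inner s f h)"

definition backproj_value ::
    "nat \<Rightarrow> (int ^ 'n \<Rightarrow> (rat ^ 'n) set \<Rightarrow> real)
      \<Rightarrow> ((rat ^ 'n) set \<Rightarrow> (real ^ 'n \<Rightarrow> complex) \<Rightarrow> complex)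
      \<Rightarrow> ((real ^ 'n \<Rightarrow> complex) \<Rightarrow> complex) \<Rightarrow> bool"
  where "backproj_value d w g h \<longleftrightarrow> h \<in> distributions \<and>
    (\<forall>k. fourier_coeff h k =
      (\<Sum>\<^sub>\<infinity>A\<in>Omega d k. of_real ((w k A)\<^sup>2) * fourier_coeff (g A) k))"

text \<open>On \<open>L^{2,2}_s(X_{d,n}; w)\<close> this is the Hilbert space adjoint of the Radon transform on
  \<open>H^s\<close>; other families, such as Radon transforms of arbitrary distributions, are mapped by the
  Fourier side formula, which the adjoint also satisfies.\<close>

definition radon_adjoint ::
    "nat \<Rightarrow> real \<Rightarrow> (int ^ 'n \<Rightarrow> (rat ^ 'n) set \<Rightarrow> real)
      \<Rightarrow> ((rat ^ 'n) set \<Rightarrow> (real ^ 'n \<Rightarrow> complex) \<Rightarrow> complex)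
      \<Rightarrow> ((real ^ 'n \<Rightarrow> complex) \<Rightarrow> complex)"
  where "radon_adjoint d s w g =
    (if g \<in> data_space d s w then (THE h. adjoint_value d s w g h)
     else (THE h. backproj_value d w g h))"

end

theory Submission
  imports Defs "HOL-Probability.Probability_Measure"
begin

text \<open>
  A periodic distribution is determined by its Fourier coefficients, these grow at most
  polynomially, and every polynomially bounded family of coefficients occurs. Since the transform
  of a character \<open>e\<^sub>k\<close> along \<open>A\<close> is \<open>e\<^sub>k\<close> if \<open>k\<close> is perpendicular to \<open>A\<close> and \<open>0\<close> otherwise,
  the coefficients of \<open>R\<^sub>d f(\<cdot>, A)\<close> are those of \<open>f\<close>, restricted to \<open>k \<bottom> A\<close>. With Parseval's identity
  the data norm of \<open>R\<^sub>d f\<close> becomes \<open>\<Sum>\<^sub>k \<langle>k\<rangle>\<^sup>2\<^sup>s W\<^sub>k |f\<^sub>k|\<^sup>2\<close>, and the adjoint acts by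
  \<open>g \<mapsto> (\<Sum>\<^sub>A w(k,A)\<^sup>2 g\<^sub>k(A))\<^sub>k\<close>; everything then follows from Cauchy--Schwarz over \<open>\<Omega>\<^sub>k\<close>.
\<close>

section \<open>Characters and test functions\<close>

text \<open>The objects of the statement are given by descriptions: a norm through a chosen
  representative, a multiplier and the adjoint as the unique object with some property. So existence
  and uniqueness have to be settled before a coefficient formula can be used. Moreover
  \<open>radon_adjoint\<close> has two branches, the Hilbert space adjoint on the data space and the
  Fourier formula elsewhere, and in (iii) the data of an arbitrary distribution may fall into
  either.

  A second obstacle is that a weight carries no upper bound, so that multiplication by
  \<open>w(., A)\<close> may lead out of the distributions. For Radon data only frequencies
  perpendicular to A count, and there \<open>w(k,A)^2\<close> is a single term of
  \<open>W_k\<close>, hence at most \<open>C^2\<close>. The upper bound serves this purpose and the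
  boundedness of the transform and its adjoint. The constant comes from the lower bound: for the
  multiplier \<open>m = 1/W_k\<close> the Cauchy--Schwarz factor is \<open>m^2 W_k = 1/W_k\<close>,
  at most \<open>1/c^2\<close>.

  Norms are kept squared and in \<open>ennreal\<close> as long as possible, because there the sums
  over k and A commute without any convergence condition.\<close>

definition fchar :: "int ^ 'n \<Rightarrow> real ^ 'n \<Rightarrow> complex"
  where "fchar k x = exp (- 2 * of_real pi * \<i> * of_real (real_vec k \<bullet> x))"

lemma fourier_coeff_fchar: "fourier_coeff u k = u (fchar k)"
  unfolding fourier_coeff_def fchar_def[abs_def] ..

lemma fchar_cis: "fchar k x = cis (- (2 * pi * (real_vec k \<bullet> x)))"
  unfolding fchar_def cis_conv_exp by (simp add: algebra_simps)

lemma norm_fchar [simp]: "cmod (fchar k x) = 1"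
  by (simp add: fchar_cis)

lemma real_vec_nth [simp]: "real_vec k $ i = of_int (k $ i)"
  by (simp add: real_vec_def)

lemma real_vec_arith [simp]:
  "real_vec 0 = 0" "real_vec (a + b) = real_vec a + real_vec b" "real_vec (- a) = - real_vec a"
  by (simp_all add: vec_eq_iff)

lemma fchar_0 [simp]: "fchar 0 x = 1"
  by (simp add: fchar_cis)

lemma fchar_mult: "fchar k x * fchar j x = fchar (k + j) x"
  by (simp add: fchar_cis cis_mult inner_add_left algebra_simps)

lemma fchar_add: "fchar k (x + y) = fchar k x * fchar k y"
  by (simp add: fchar_cis cis_mult inner_add_right algebra_simps)

lemma cnj_fchar: "cnj (fchar k x) = fchar (- k) x"
  by (simp add: fchar_cis cis_cnj)

lemma inner_real_vec_Ints: "real_vec k \<bullet> real_vec j \<in> \<int>"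
  by (simp add: inner_vec_def real_vec_def Ints_sum)

lemma fchar_real_vec: "fchar k (real_vec j) = 1"
proof -
  obtain m where "real_vec k \<bullet> real_vec j = of_int m"
    using inner_real_vec_Ints Ints_cases by metis
  then show ?thesis
    using cis_multiple_2pi[of "- of_int m"] by (simp add: fchar_cis mult_ac)
qed

lemma fchar_periodic: "fchar k (x + real_vec j) = fchar k x"
  by (simp add: fchar_add fchar_real_vec)

lemma continuous_fchar [continuous_intros]: "continuous_on S (fchar k)"
  unfolding fchar_def[abs_def] by (intro continuous_intros)

lemma has_derivative_fchar:
  "(fchar k has_derivative (\<lambda>h. - 2 * of_real pi * \<i> * of_real (real_vec k \<bullet> h) * fchar k x)) (at x)"
proof -
  have "((\<lambda>x. - 2 * of_real pi * \<i> * of_real (real_vec k \<bullet> x)) has_derivative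
      (\<lambda>h. - 2 * of_real pi * \<i> * of_real (real_vec k \<bullet> h))) (at x)"
    by (intro bounded_linear_imp_has_derivative bounded_linear_const_mult
        bounded_linear_compose[OF bounded_linear_of_real] bounded_linear_inner_right)
  from has_derivative_compose[OF this DERIV_exp[unfolded has_field_derivative_def]] show ?thesis
    unfolding fchar_def[abs_def] by (simp add: mult_ac)
qed

text \<open>The symbol of the differential operator \<open>iter_deriv js\<close> at the character
  \<open>fchar k\<close>: derivatives act on characters by this scalar.\<close>

definition dsym :: "int ^ 'n \<Rightarrow> 'n list \<Rightarrow> complex"
  where "dsym k js = prod_list (map (\<lambda>i. - 2 * of_real pi * \<i> * of_int (k $ i)) js)"

lemma frechet_derivative_worksI:
  "f differentiable net \<Longrightarrow> (f has_derivative frechet_derivative f net) net"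
  using frechet_derivative_works by blast

lemma partial_derivI:
  assumes "\<And>x. (f has_derivative D x) (at x)"
  shows "partial_deriv i f = (\<lambda>x. D x (axis i 1))"
  unfolding partial_deriv_def using frechet_derivative_at[OF assms] by (auto simp: fun_eq_iff)

lemma has_derivative_fchar_scaled:
  "((\<lambda>x. c * fchar k x) has_derivative
    (\<lambda>h. c * (- 2 * of_real pi * \<i> * of_real (real_vec k \<bullet> h) * fchar k x))) (at x)"
  by (intro has_derivative_mult_right has_derivative_fchar)

lemma iter_deriv_fchar: "iter_deriv js (fchar k) = (\<lambda>x. dsym k js * fchar k x)"
proof (induction js)
  case (Cons i js)
  show ?case
    unfolding iter_deriv.simps Cons partial_derivI[OF has_derivative_fchar_scaled]
    by (simp add: dsym_def inner_axis mult_ac fun_eq_iff)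
qed (simp add: dsym_def)

lemma norm_dsym: "cmod (dsym k js) \<le> (2 * pi * jap k) ^ length js"
proof (induction js)
  case (Cons i js)
  have "\<bar>real_of_int (k $ i)\<bar> \<le> norm (real_vec k)"
    using component_le_norm_cart[of "real_vec k" i] by simp
  also have "\<dots> \<le> jap k"
    unfolding jap_def by (rule real_le_rsqrt) simp
  finally have "cmod (- 2 * of_real pi * \<i> * of_int (k $ i)) \<le> 2 * pi * jap k"
    by (simp add: norm_mult)
  then have "cmod (- 2 * of_real pi * \<i> * of_int (k $ i)) * cmod (dsym k js)
      \<le> (2 * pi * jap k) * (2 * pi * jap k) ^ length js"
    using Cons by (intro mult_mono) (auto simp: jap_def)
  then show ?case by (simp add: dsym_def norm_mult)
qed (simp add: dsym_def)

lemma jap_ge_1: "1 \<le> jap k" and jap_pos: "0 < jap k"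
  unfolding jap_def by (auto simp: add_pos_nonneg)

section \<open>Closure properties of the test functions\<close>

lemma test_fun_periodic: "f \<in> test_funs \<Longrightarrow> f (x + real_vec k) = f x"
  by (auto simp: test_funs_def)

lemma test_fun_differentiable: "f \<in> test_funs \<Longrightarrow> iter_deriv js f differentiable (at x)"
  by (auto simp: test_funs_def smooth_def)

lemma iter_deriv_append: "iter_deriv (is @ js) f = iter_deriv is (iter_deriv js f)"
  by (induction "is") auto

text \<open>The chain rule for the translation by \<open>v\<close> carries the derivative at
  \<open>x + v\<close> to a derivative at \<open>x\<close>, and Frechet derivatives are
  unique.\<close>

lemma partial_deriv_periodic:
  assumes "\<And>x. f differentiable (at x)" "\<And>x. f (x + v) = f x"
  shows "partial_deriv i f (x + v) = partial_deriv i f x"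
proof -
  have "(f has_derivative frechet_derivative f (at (x + v))) (at (x + v))"
    using assms(1) by (rule frechet_derivative_worksI)
  moreover have "((\<lambda>x. x + v) has_derivative (\<lambda>h. h)) (at x)"
    by (auto intro!: derivative_eq_intros)
  ultimately have "((\<lambda>x. f (x + v)) has_derivative frechet_derivative f (at (x + v))) (at x)"
    using has_derivative_compose by blast
  then have "(f has_derivative frechet_derivative f (at (x + v))) (at x)"
    using assms(2) by simp
  then show ?thesis
    unfolding partial_deriv_def by (metis frechet_derivative_at)
qed

lemma test_funs_partial_deriv: "f \<in> test_funs \<Longrightarrow> partial_deriv i f \<in> test_funs"
proof -
  assume f: "f \<in> test_funs"
  have "iter_deriv js (partial_deriv i f) differentiable (at x)" for js x
    using test_fun_differentiable[OF f, of "js @ [i]"] by (simp add: iter_deriv_append)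
  moreover have "partial_deriv i f (x + real_vec k) = partial_deriv i f x" for x k
    using test_fun_differentiable[OF f, of "[]"] test_fun_periodic[OF f]
    by (intro partial_deriv_periodic) auto
  ultimately show ?thesis by (auto simp: test_funs_def smooth_def)
qed

lemma test_funs_iter_deriv: "f \<in> test_funs \<Longrightarrow> iter_deriv js f \<in> test_funs"
  by (induction js) (auto intro: test_funs_partial_deriv)

lemma test_fun_continuous: "f \<in> test_funs \<Longrightarrow> continuous_on S f"
  using test_fun_differentiable[of f "[]"]
  by (auto intro!: continuous_at_imp_continuous_on differentiable_imp_continuous_within)

lemma fchar_test_fun: "fchar k \<in> test_funs"
proof -
  have "iter_deriv js (fchar k) differentiable (at x)" for js x
    unfolding iter_deriv_fchar
    using has_derivative_fchar_scaled differentiable_def by blast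
  then show ?thesis
    by (auto simp: test_funs_def smooth_def fchar_periodic)
qed

lemma iter_deriv_add:
  assumes "f \<in> test_funs" "g \<in> test_funs"
  shows "iter_deriv js (\<lambda>x. f x + g x) = (\<lambda>x. iter_deriv js f x + iter_deriv js g x)"
proof (induction js)
  case (Cons i js)
  have "((\<lambda>x. iter_deriv js f x + iter_deriv js g x) has_derivative
      (\<lambda>h. frechet_derivative (iter_deriv js f) (at x) h + frechet_derivative (iter_deriv js g) (at x) h)) (at x)" for x
    by (intro has_derivative_add frechet_derivative_worksI test_fun_differentiable assms)
  from partial_derivI[OF this] show ?case
    by (simp add: Cons partial_deriv_def)
qed simp

lemma iter_deriv_scale:
  assumes "f \<in> test_funs"
  shows "iter_deriv js (\<lambda>x. c * f x) = (\<lambda>x. c * iter_deriv js f x)"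
proof (induction js)
  case (Cons i js)
  have "((\<lambda>x. c * iter_deriv js f x) has_derivative
      (\<lambda>h. c * frechet_derivative (iter_deriv js f) (at x) h)) (at x)" for x
    by (intro has_derivative_mult_right frechet_derivative_worksI test_fun_differentiable assms)
  from partial_derivI[OF this] show ?case
    by (simp add: Cons partial_deriv_def)
qed simp

lemma test_funs_add:
  assumes "f \<in> test_funs" "g \<in> test_funs"
  shows "(\<lambda>x. f x + g x) \<in> test_funs"
  using assms test_fun_differentiable[OF assms(1)] test_fun_differentiable[OF assms(2)]
  by (auto simp: test_funs_def smooth_def iter_deriv_add[OF assms])

lemma test_funs_scale:
  assumes "f \<in> test_funs"
  shows "(\<lambda>x. c * f x) \<in> test_funs"
  using assms test_fun_differentiable[OF assms]
  by (auto simp: test_funs_def smooth_def iter_deriv_scale[OF assms])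

lemma test_funs_zero: "(\<lambda>x. 0) \<in> test_funs"
  using test_funs_scale[OF fchar_test_fun, of 0] by simp

lemma test_funs_sum:
  assumes "finite F" "\<And>j. j \<in> F \<Longrightarrow> f j \<in> test_funs"
  shows "(\<lambda>x. \<Sum>j\<in>F. f j x) \<in> test_funs"
  using assms by (induction F) (auto intro: test_funs_add test_funs_zero)

lemma iter_deriv_zero: "iter_deriv js (\<lambda>x. 0) = (\<lambda>x. 0)"
  using iter_deriv_scale[OF fchar_test_fun, of js 0] by simp

lemma iter_deriv_sum:
  assumes "finite F" "\<And>j. j \<in> F \<Longrightarrow> f j \<in> test_funs"
  shows "iter_deriv js (\<lambda>x. \<Sum>j\<in>F. f j x) = (\<lambda>x. \<Sum>j\<in>F. iter_deriv js (f j) x)"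
  using assms
  by (induction F) (auto simp: iter_deriv_zero iter_deriv_add test_funs_sum)

lemma periodic_reduce:
  fixes x :: "real ^ 'n"
  obtains y k where "y \<in> cbox 0 1" "x = y + real_vec k"
proof
  show "(\<chi> i. frac (x $ i)) \<in> cbox 0 1"
    by (auto simp: mem_box_cart frac_ge_0 less_imp_le[OF frac_lt_1])
  show "x = (\<chi> i. frac (x $ i)) + real_vec (\<chi> i. \<lfloor>x $ i\<rfloor>)"
    by (simp add: vec_eq_iff frac_def)
qed

lemma periodic_bounded:
  fixes f :: "real ^ 'n \<Rightarrow> complex"
  assumes "continuous_on UNIV f" "\<And>x k. f (x + real_vec k) = f x"
  obtains B where "\<And>x. cmod (f x) \<le> B"
proof -
  have "bounded (f ` cbox 0 1)"
    using assms(1) by (intro compact_imp_bounded compact_continuous_image)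
      (auto intro: continuous_on_subset)
  then obtain B where B: "\<And>x. x \<in> cbox 0 1 \<Longrightarrow> cmod (f x) \<le> B"
    by (auto simp: bounded_iff)
  have "cmod (f x) \<le> B" for x
    using periodic_reduce[of x] B assms(2) by metis
  then show ?thesis using that by blast
qed

section \<open>Seminorms of test functions and continuity of distributions\<close>

lemma test_fun_bdd:
  assumes "f \<in> test_funs"
  shows "bdd_above (range (\<lambda>x. cmod (iter_deriv js f x)))"
proof -
  have "iter_deriv js f \<in> test_funs" using assms by (rule test_funs_iter_deriv)
  then obtain B where "\<And>x. cmod (iter_deriv js f x) \<le> B"
    using periodic_bounded[of "iter_deriv js f"] test_fun_continuous test_fun_periodic by metis
  then show ?thesis by (intro bdd_aboveI2)
qed

text \<open>The quantity in the continuity clause of \<open>distributions\<close>. Lists of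
  directions stand for multi-indices, so a mixed partial derivative is counted once for each order
  of differentiation; this affects constants only.\<close>

definition seminorm :: "nat \<Rightarrow> (real ^ 'n \<Rightarrow> complex) \<Rightarrow> real"
  where "seminorm m g = (\<Sum>js | length js \<le> m. SUP x. cmod (iter_deriv js g x))"

lemma finite_multiindices: "finite {js :: 'n::finite list. length js \<le> m}"
  using finite_lists_length_le[of "UNIV :: 'n set" m] by simp

lemma sup_iter_deriv_nonneg: "f \<in> test_funs \<Longrightarrow> 0 \<le> (SUP x. cmod (iter_deriv js f x))"
  using cSUP_upper[OF UNIV_I test_fun_bdd[of f js], of 0] norm_ge_zero order_trans by blast

lemma iter_deriv_le_seminorm:
  fixes f :: "real ^ 'n \<Rightarrow> complex"
  assumes "f \<in> test_funs" "length js \<le> m"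
  shows "cmod (iter_deriv js f x) \<le> seminorm m f"
proof -
  have "cmod (iter_deriv js f x) \<le> (SUP x. cmod (iter_deriv js f x))"
    using cSUP_upper[OF UNIV_I test_fun_bdd[OF assms(1)]] .
  also have "\<dots> \<le> seminorm m f"
    unfolding seminorm_def using assms
    by (intro member_le_sum finite_multiindices) (auto intro: sup_iter_deriv_nonneg)
  finally show ?thesis .
qed

lemma seminorm_nonneg: "f \<in> test_funs \<Longrightarrow> 0 \<le> seminorm m f"
  unfolding seminorm_def by (intro sum_nonneg sup_iter_deriv_nonneg)

lemma seminorm_le:
  fixes f :: "real ^ 'n \<Rightarrow> complex"
  assumes "\<And>js x. length js \<le> m \<Longrightarrow> cmod (iter_deriv js f x) \<le> B"
  shows "seminorm m f \<le> real (card {js :: 'n list. length js \<le> m}) * B"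
  unfolding seminorm_def
  by (rule sum_bounded_above) (auto intro!: cSUP_least assms)

lemma distributionsD:
  assumes "u \<in> distributions"
  shows "g \<notin> test_funs \<Longrightarrow> u g = 0"
    and "g \<in> test_funs \<Longrightarrow> h \<in> test_funs \<Longrightarrow> u (\<lambda>x. g x + h x) = u g + u h"
    and "g \<in> test_funs \<Longrightarrow> u (\<lambda>x. c * g x) = c * u g"
  using assms by (auto simp: distributions_def)

lemma distributions_bound:
  assumes "u \<in> distributions"
  obtains C m where "0 \<le> C" "\<And>g. g \<in> test_funs \<Longrightarrow> cmod (u g) \<le> C * seminorm m g"
proof -
  obtain C m where C: "\<And>g. g \<in> test_funs \<Longrightarrow> cmod (u g) \<le> C * seminorm m g"
    using assms unfolding distributions_def mem_Collect_eq seminorm_def[symmetric] by blast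
  have "cmod (u g) \<le> \<bar>C\<bar> * seminorm m g" if "g \<in> test_funs" for g
    using C[OF that] seminorm_nonneg[OF that, of m]
    by (meson abs_ge_self mult_right_mono order_trans)
  then show ?thesis using that[of "\<bar>C\<bar>"] by auto
qed

lemma distributionsI:
  assumes "\<And>g. g \<notin> test_funs \<Longrightarrow> u g = 0"
    and "\<And>g h. g \<in> test_funs \<Longrightarrow> h \<in> test_funs \<Longrightarrow> u (\<lambda>x. g x + h x) = u g + u h"
    and "\<And>g c. g \<in> test_funs \<Longrightarrow> u (\<lambda>x. c * g x) = c * u g"
    and "\<And>g. g \<in> test_funs \<Longrightarrow> cmod (u g) \<le> C * seminorm m g"
  shows "u \<in> distributions"
  unfolding distributions_def mem_Collect_eq seminorm_def[symmetric] using assms by blast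

lemma distribution_sum:
  assumes "u \<in> distributions" "finite F" "\<And>j. j \<in> F \<Longrightarrow> f j \<in> test_funs"
  shows "u (\<lambda>x. \<Sum>j\<in>F. f j x) = (\<Sum>j\<in>F. u (f j))"
  using assms(2,3)
proof (induction F)
  case empty
  show ?case using distributionsD(3)[OF assms(1) test_funs_zero, of 0] by simp
next
  case (insert j F)
  then show ?case by (simp add: distributionsD(2)[OF assms(1)] test_funs_sum)
qed

lemma distributions_diff:
  assumes "u \<in> distributions" "v \<in> distributions"
  shows "(u - v) \<in> distributions"
proof -
  obtain C m where C: "0 \<le> C" "\<And>g. g \<in> test_funs \<Longrightarrow> cmod (u g) \<le> C * seminorm m g"
    using assms distributions_bound by metis
  obtain D l where D: "0 \<le> D" "\<And>g. g \<in> test_funs \<Longrightarrow> cmod (v g) \<le> D * seminorm l g"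
    using assms distributions_bound by metis
  \<comment> \<open>The two orders of continuity may differ; enlarging the order only adds
    nonnegative terms, so both bounds can be stated with the larger one.\<close>
  have mono: "seminorm m' g \<le> seminorm (max m l) g" if "g \<in> test_funs" "m' \<le> max m l"
    for m' and g :: "real ^ 'a \<Rightarrow> complex"
    unfolding seminorm_def using that
    by (intro sum_mono2 finite_multiindices) (auto intro: sup_iter_deriv_nonneg)
  show ?thesis
  proof (rule distributionsI[where C = "C + D" and m = "max m l"])
    fix g :: "real ^ 'a \<Rightarrow> complex" assume g: "g \<in> test_funs"
    have "cmod ((u - v) g) \<le> cmod (u g) + cmod (v g)" by (simp add: norm_triangle_ineq4)
    also have "\<dots> \<le> C * seminorm m g + D * seminorm l g" using C(2)[OF g] D(2)[OF g] by simp
    also have "\<dots> \<le> C * seminorm (max m l) g + D * seminorm (max m l) g"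
      using C(1) D(1) mono[OF g] by (intro add_mono mult_left_mono) auto
    finally show "cmod ((u - v) g) \<le> (C + D) * seminorm (max m l) g" by (simp add: algebra_simps)
  qed (auto simp: distributionsD[OF assms(1)] distributionsD[OF assms(2)] algebra_simps)
qed

text \<open>Continuity of order \<open>m\<close> is tested on characters, whose derivatives of order
  at most \<open>m\<close> are bounded by \<open>(2 * pi * jap k) ^ m\<close>.\<close>

lemma fourier_coeff_poly_bound:
  assumes "u \<in> distributions"
  obtains C m where "0 \<le> C" "\<And>k. cmod (fourier_coeff u k) \<le> C * jap k ^ m"
proof -
  obtain C m where C: "0 \<le> C" "\<And>g. g \<in> test_funs \<Longrightarrow> cmod (u g) \<le> C * seminorm m g"
    using assms distributions_bound by metis
  let ?N = "real (card {js :: 'a list. length js \<le> m})"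
  have "cmod (fourier_coeff u k) \<le> (C * ?N * (2 * pi) ^ m) * jap k ^ m" for k
  proof -
    \<comment> \<open>With a base of at least 1, the exponent \<open>m\<close> also covers the
      shorter derivative lists.\<close>
    have "1 \<le> 2 * pi * jap k"
      using mult_mono[of 1 "2 * pi" 1 "jap k"] jap_ge_1[of k] pi_ge_two by simp
    then have "cmod (iter_deriv js (fchar k) x) \<le> (2 * pi * jap k) ^ m"
      if "length js \<le> m" for js x
      using order_trans[OF norm_dsym[of k js] power_increasing[OF that]] unfolding iter_deriv_fchar
      by (simp add: norm_mult)
    then have "seminorm m (fchar k) \<le> ?N * (2 * pi * jap k) ^ m"
      by (rule seminorm_le)
    then have "C * seminorm m (fchar k) \<le> C * (?N * (2 * pi * jap k) ^ m)"
      using C(1) by (rule mult_left_mono)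
    then show ?thesis
      using C(2)[OF fchar_test_fun, of k] unfolding fourier_coeff_fchar
      by (simp add: power_mult_distrib mult_ac)
  qed
  then show ?thesis using that[of "C * ?N * (2 * pi) ^ m" m] C(1) by simp
qed

section \<open>Integration over the torus and decay of Fourier coefficients\<close>

lemma space_torus [simp]: "space torus = cbox 0 1"
  by (simp add: torus_def space_restrict_space)

lemma emeasure_torus_space: "emeasure (torus :: (real ^ 'n) measure) (cbox 0 1) = 1"
proof -
  have "emeasure (torus :: (real ^ 'n) measure) (cbox 0 1) = emeasure lborel (cbox 0 1 :: (real ^ 'n) set)"
    unfolding torus_def by (subst emeasure_restrict_space) auto
  also have "\<dots> = 1"
    by (subst emeasure_lborel_cbox) (auto simp: Basis_vec_def inner_axis prod.neutral)
  finally show ?thesis .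
qed

lemma prob_space_torus: "prob_space (torus :: (real ^ 'n) measure)"
  by (rule prob_spaceI) (simp add: emeasure_torus_space)

global_interpretation torus: prob_space "torus :: (real ^ 'n) measure"
  by (rule prob_space_torus)

lemma measure_torus_space [simp]: "measure (torus :: (real ^ 'n) measure) (cbox 0 1) = 1"
  using torus.prob_space by simp

lemma integrable_torus_iff:
  fixes f :: "real ^ 'n \<Rightarrow> 'b::{banach, second_countable_topology}"
  shows "integrable torus f \<longleftrightarrow> integrable lborel (\<lambda>x. indicator (cbox 0 1) x *\<^sub>R f x)"
  unfolding torus_def by (subst integrable_restrict_space) auto

lemma integral_torus:
  fixes f :: "real ^ 'n \<Rightarrow> 'b::{banach, second_countable_topology}"
  shows "integral\<^sup>L torus f = integral\<^sup>L lborel (\<lambda>x. indicator (cbox 0 1) x *\<^sub>R f x)"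
  unfolding torus_def by (subst integral_restrict_space) auto

lemma integrable_torus_continuous:
  fixes f :: "real ^ 'n \<Rightarrow> 'b::{banach, second_countable_topology}"
  shows "continuous_on UNIV f \<Longrightarrow> integrable torus f"
  unfolding integrable_torus_iff
  by (rule borel_integrable_compact) (auto intro: continuous_on_subset)

lemma measurable_torus_continuous:
  fixes f :: "real ^ 'n \<Rightarrow> 'b::topological_space"
  shows "continuous_on UNIV f \<Longrightarrow> f \<in> borel_measurable torus"
  unfolding torus_def by (intro measurable_restrict_space1) (auto intro: borel_measurable_continuous_onI)

text \<open>The measure lives on the closed cube, in which opposite faces represent the same points
  of the torus. A face is a degenerate box, hence null, so the cube may be taken half open in
  direction \<open>i\<close>.\<close>

lemma AE_torus_coord: "AE x in (torus :: (real ^ 'n) measure). x $ i < 1"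
proof (rule AE_I)
  let ?N = "cbox (axis i 1) 1 :: (real ^ 'n) set"
  have mem: "x \<in> ?N \<longleftrightarrow> x \<in> cbox 0 1 \<and> 1 \<le> x $ i" for x
  proof -
    have "x \<in> ?N \<longleftrightarrow> (\<forall>j. (if j = i then 1 else 0) \<le> x $ j \<and> x $ j \<le> 1)"
      by (simp add: mem_box_cart axis_def)
    also have "\<dots> \<longleftrightarrow> (\<forall>j. 0 \<le> x $ j \<and> x $ j \<le> 1) \<and> 1 \<le> x $ i"
    proof safe
      fix j assume *: "\<forall>j. (if j = i then 1 else 0) \<le> x $ j \<and> x $ j \<le> 1"
      show "0 \<le> x $ j" "x $ j \<le> 1"
        using *[rule_format, of j] by (auto split: if_splits)
      show "1 \<le> x $ i"
        using *[rule_format, of i] by simp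
    qed auto
    finally show ?thesis by (simp add: mem_box_cart)
  qed
  then have sub: "?N \<subseteq> cbox 0 1" by blast
  then show "?N \<in> sets torus"
    unfolding torus_def by (subst sets_restrict_space_iff) simp_all
  have "(1 - axis i 1 :: real ^ 'n) \<bullet> axis i 1 = 0"
    by (simp add: inner_axis)
  moreover have "(axis i 1 :: real ^ 'n) \<in> Basis"
    by (simp add: axis_in_Basis_iff)
  ultimately have "(\<Prod>b\<in>Basis. (1 - axis i 1 :: real ^ 'n) \<bullet> b) = 0"
    using prod_zero[OF finite_Basis] by blast
  then have "emeasure lborel ?N = 0"
    unfolding emeasure_lborel_cbox_eq by (simp only: ennreal_0 if_cancel)
  then show "emeasure torus ?N = 0"
    unfolding torus_def using sub by (subst emeasure_restrict_space) simp_all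
  show "{x \<in> space torus. \<not> x $ i < 1} \<subseteq> ?N"
    using mem by (simp add: subset_eq not_less)
qed

lemma integral_lborel_shift:
  fixes f :: "'a::euclidean_space \<Rightarrow> complex"
  assumes "f \<in> borel_measurable borel"
  shows "(LINT x|lborel. f (x + v)) = (LINT x|lborel. f x)"
proof -
  have "(LINT x|lborel. f x) = (LINT x|distr lborel borel ((+) v). f x)"
    by (simp add: lborel_distr_plus)
  also have "\<dots> = (LINT x|lborel. f (x + v))"
    using assms by (subst integral_distr) (auto simp: add.commute)
  finally show ?thesis ..
qed

text \<open>
  Shifting the cube along a coordinate axis and moving the protruding slab back by a period.
\<close>

lemma integral_torus_shift:
  fixes f :: "real ^ 'n \<Rightarrow> complex"
  assumes cont: "continuous_on UNIV f" and per: "\<And>x k. f (x + real_vec k) = f x"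
    and t: "0 \<le> t" "t \<le> 1"
  shows "(LINT x|torus. f (x + t *\<^sub>R axis i 1)) = (LINT x|torus. f x)"
proof -
  define B where "B = {x \<in> cbox 0 1 :: (real ^ 'n) set. x $ i < 1}"
  define J where "J S g = (LINT x|lborel. indicator S x *\<^sub>R g x)"
    for S and g :: "real ^ 'n \<Rightarrow> complex"
  define e where "e = (axis i 1 :: real ^ 'n)"
  define B1 where "B1 = {x \<in> B. t \<le> x $ i}"
  define B2 where "B2 = {x \<in> B. x $ i < t}"
  have [measurable]: "f \<in> borel_measurable borel"
    using cont by (rule borel_measurable_continuous_onI)
  have Bm [measurable]: "B \<in> sets borel" "B1 \<in> sets borel" "B2 \<in> sets borel"
    unfolding B_def B1_def B2_def by measurable
  have e: "e = real_vec (axis i 1)"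
    by (simp add: e_def vec_eq_iff axis_def)
  have J: "(LINT x|torus. g x) = J B g" if "continuous_on UNIV g" for g
  proof -
    have [measurable]: "g \<in> borel_measurable borel"
      using that by (rule borel_measurable_continuous_onI)
    have "(LINT x|torus. g x) = (LINT x|torus. indicator B x *\<^sub>R g x)"
    proof (rule integral_cong_AE)
      show "AE x in torus. g x = indicator B x *\<^sub>R g x"
        using AE_torus_coord[of i] AE_space by eventually_elim (simp add: B_def)
    qed (auto simp: torus_def intro!: measurable_restrict_space1)
    also have "\<dots> = J B g"
      unfolding integral_torus J_def by (rule Bochner_Integration.integral_cong) (auto simp: B_def indicator_def)
    finally show ?thesis .
  qed
  have int: "integrable lborel (\<lambda>x. indicator S x *\<^sub>R f x)" if "S \<subseteq> cbox 0 1" "S \<in> sets borel" for S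
  proof -
    have "integrable lborel (\<lambda>x. indicator S x *\<^sub>R (indicator (cbox 0 1) x *\<^sub>R f x))"
    proof (rule integrable_mult_indicator)
      show "integrable lborel (\<lambda>x. indicator (cbox 0 1) x *\<^sub>R f x)"
        using integrable_torus_continuous[OF cont] unfolding integrable_torus_iff .
    qed (use that in simp)
    moreover have "(\<lambda>x. indicator S x *\<^sub>R (indicator (cbox 0 1) x *\<^sub>R f x)) = (\<lambda>x. indicator S x *\<^sub>R f x)"
      using that by (auto simp: indicator_def fun_eq_iff)
    ultimately show ?thesis by simp
  qed
  have int2: "integrable lborel (\<lambda>x. indicator B2 (x - e) *\<^sub>R f x)"
  proof -
    have "integrable (distr lborel borel ((+) (- e))) (\<lambda>x. indicator B2 x *\<^sub>R f x)"
      using int[of B2] by (auto simp: lborel_distr_plus B2_def B_def)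
    then have "integrable lborel (\<lambda>x. indicator B2 (- e + x) *\<^sub>R f (- e + x))"
      by (subst (asm) integrable_distr_eq) auto
    moreover have "f (- e + x) = f x" for x
      using per[of "- e + x" "axis i 1"] by (simp add: e)
    ultimately show ?thesis by simp
  qed
  \<comment> \<open>After the shift, coordinate \<open>i\<close> runs over [t, 1 + t). The part
    below 1 is \<open>B1\<close>, the part from 1 on is \<open>B2\<close> moved by one period;
    half-openness in direction \<open>i\<close> keeps them disjoint.\<close>
  have split: "indicator B (x - t *\<^sub>R e) = (indicator B1 x + indicator B2 (x - e) :: real)" for x
  proof -
    have c: "(x - t *\<^sub>R e) $ j = (if j = i then x $ i - t else x $ j)"
      "(x - e) $ j = (if j = i then x $ i - 1 else x $ j)" for j
      by (auto simp: e_def axis_def)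
    let ?Q = "\<forall>j. j \<noteq> i \<longrightarrow> 0 \<le> x $ j \<and> x $ j \<le> 1"
    have mB: "y \<in> B \<longleftrightarrow> (\<forall>j. j \<noteq> i \<longrightarrow> 0 \<le> y $ j \<and> y $ j \<le> 1) \<and> 0 \<le> y $ i \<and> y $ i < 1" for y
      unfolding B_def by (auto simp: mem_box_cart) (metis less_imp_le)
    have "x - t *\<^sub>R e \<in> B \<longleftrightarrow> ?Q \<and> t \<le> x $ i \<and> x $ i < 1 + t"
      unfolding mB c by auto
    moreover have "x \<in> B1 \<longleftrightarrow> ?Q \<and> t \<le> x $ i \<and> x $ i < 1"
      unfolding B1_def mem_Collect_eq mB using t by auto
    moreover have "x - e \<in> B2 \<longleftrightarrow> ?Q \<and> 1 \<le> x $ i \<and> x $ i < 1 + t"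
      unfolding B2_def mem_Collect_eq mB c using t by auto
    ultimately show ?thesis using t by (auto simp: indicator_def)
  qed
  have "(LINT x|torus. f (x + t *\<^sub>R e)) = J B (\<lambda>x. f (x + t *\<^sub>R e))"
    by (rule J) (intro continuous_on_compose2[OF cont] continuous_intros, auto)
  also have "\<dots> = (LINT x|lborel. (\<lambda>y. indicator B (y - t *\<^sub>R e) *\<^sub>R f y) (x + t *\<^sub>R e))"
    by (simp add: J_def)
  also have "\<dots> = (LINT x|lborel. indicator B (x - t *\<^sub>R e) *\<^sub>R f x)"
    by (rule integral_lborel_shift) measurable
  also have "\<dots> = (LINT x|lborel. indicator B1 x *\<^sub>R f x + indicator B2 (x - e) *\<^sub>R f x)"
    by (simp add: split scaleR_add_left)
  also have "\<dots> = J B1 f + (LINT x|lborel. indicator B2 (x - e) *\<^sub>R f x)"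
    unfolding J_def
    by (intro Bochner_Integration.integral_add int int2) (auto simp: B1_def B_def)
  also have "(LINT x|lborel. indicator B2 (x - e) *\<^sub>R f x)
      = (LINT x|lborel. (\<lambda>y. indicator B2 (y - e) *\<^sub>R f y) (x + e))"
    by (rule integral_lborel_shift[symmetric]) measurable
  also have "\<dots> = J B2 f"
    by (simp add: J_def e per)
  also have "J B1 f + J B2 f = J B f"
  proof -
    have "J B1 f + J B2 f = (LINT x|lborel. indicator B1 x *\<^sub>R f x + indicator B2 x *\<^sub>R f x)"
      unfolding J_def
      by (intro Bochner_Integration.integral_add[symmetric] int Bm) (auto simp: B1_def B2_def B_def)
    also have "\<dots> = J B f"
      unfolding J_def
    proof (rule Bochner_Integration.integral_cong[OF refl])
      fix x
      show "indicator B1 x *\<^sub>R f x + indicator B2 x *\<^sub>R f x = indicator B x *\<^sub>R f x"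
        by (cases "t \<le> x $ i") (simp_all add: B1_def B2_def indicator_def)
    qed
    finally show ?thesis .
  qed
  also have "\<dots> = (LINT x|torus. f x)"
    by (rule J[OF cont, symmetric])
  finally show ?thesis by (simp add: e_def)
qed

text \<open>
  Difference quotients have integral zero by translation invariance; pass to the limit by
  dominated convergence. This replaces integration by parts.
\<close>

lemma integral_partial_deriv:
  fixes f :: "real ^ 'n \<Rightarrow> complex"
  assumes diff: "\<And>x. f differentiable (at x)" and per: "\<And>x k. f (x + real_vec k) = f x"
    and cont': "continuous_on UNIV (partial_deriv i f)"
  shows "(LINT x|torus. partial_deriv i f x) = 0"
proof -
  let ?e = "axis i 1 :: real ^ 'n"
  have cont: "continuous_on UNIV f"
    using diff by (auto intro!: continuous_at_imp_continuous_on differentiable_imp_continuous_within)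
  obtain B where B: "\<And>x. cmod (partial_deriv i f x) \<le> B"
    using periodic_bounded[OF cont'] partial_deriv_periodic[of f, OF diff per] by metis
  have vd: "((\<lambda>t. f (x + t *\<^sub>R ?e)) has_vector_derivative partial_deriv i f (x + t *\<^sub>R ?e)) (at t)" for x t
  proof -
    have D: "(f has_derivative frechet_derivative f (at (x + t *\<^sub>R ?e))) (at (x + t *\<^sub>R ?e))"
      by (rule frechet_derivative_worksI[OF diff])
    have "((\<lambda>t. x + t *\<^sub>R ?e) has_derivative (\<lambda>h. h *\<^sub>R ?e)) (at t)"
      by (auto intro!: derivative_eq_intros)
    from has_derivative_compose[OF this D] linear_scale[OF has_derivative_linear[OF D]]
    show ?thesis
      by (simp add: has_vector_derivative_def partial_deriv_def)
  qed
  \<comment> \<open>These step sizes lie in (0, 1], the range of shifts covered by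
    \<open>integral_torus_shift\<close>.\<close>
  define a where "a n = 1 / real (Suc n)" for n
  have a: "0 < a n" "a n \<le> 1" for n by (auto simp: a_def)
  have a0: "a \<longlonglongrightarrow> 0"
    unfolding a_def by (rule LIMSEQ_Suc[OF lim_inverse_n', unfolded of_nat_Suc[symmetric]])
  define s where "s n x = (f (x + a n *\<^sub>R ?e) - f x) /\<^sub>R a n" for n x
  \<comment> \<open>The mean value inequality in direction \<open>i\<close> yields a constant that
    dominates all quotients, and constants are integrable over the torus.\<close>
  have bound: "cmod (s n x) \<le> B" for n x
  proof -
    have "cmod (f (x + a n *\<^sub>R ?e) - f (x + 0 *\<^sub>R ?e)) \<le> B * norm (a n - 0)"
    proof (rule differentiable_bound[where S = UNIV and f' = "\<lambda>t h. h *\<^sub>R partial_deriv i f (x + t *\<^sub>R ?e)"])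
      show "onorm (\<lambda>h. h *\<^sub>R partial_deriv i f (x + t *\<^sub>R ?e)) \<le> B" for t
        using B by (intro onorm_le) (simp add: mult.commute[of B] mult_left_mono)
    qed (use vd in \<open>auto simp: has_vector_derivative_def\<close>)
    then show ?thesis
      using a[of n] by (simp add: s_def divide_simps mult.commute)
  qed
  have lim: "(\<lambda>n. s n x) \<longlonglongrightarrow> partial_deriv i f x" for x
  proof -
    have "((\<lambda>t. (f (x + t *\<^sub>R ?e) - f x) /\<^sub>R t) \<longlongrightarrow> partial_deriv i f x) (at 0)"
      (is "(?q \<longlongrightarrow> ?p) _")
    proof -
      have "((\<lambda>t. cmod (f (x + t *\<^sub>R ?e) - f x - t *\<^sub>R ?p) / norm t) \<longlongrightarrow> 0) (at 0)"
        using vd[of x 0] by (simp add: has_vector_derivative_def has_derivative_at)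
      moreover have "cmod (f (x + t *\<^sub>R ?e) - f x - t *\<^sub>R ?p) / norm t = cmod (?q t - ?p)"
        if "t \<noteq> 0" for t
      proof -
        have "?q t - ?p = (f (x + t *\<^sub>R ?e) - f x - t *\<^sub>R ?p) /\<^sub>R t"
          using that by (simp add: scaleR_diff_right)
        then show ?thesis by (simp add: divide_inverse mult.commute)
      qed
      then have "\<forall>\<^sub>F t in at 0. cmod (f (x + t *\<^sub>R ?e) - f x - t *\<^sub>R ?p) / norm t = cmod (?q t - ?p)"
        unfolding eventually_at_filter by (intro always_eventually) blast
      ultimately have "((\<lambda>t. cmod (?q t - ?p)) \<longlongrightarrow> 0) (at 0)"
        by (rule Lim_transform_eventually)
      from LIM_zero_cancel[OF tendsto_norm_zero_cancel[OF this]] show ?thesis .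
    qed
    moreover have "filterlim a (at 0) sequentially"
      using a a0 by (auto simp: filterlim_at less_le)
    ultimately show ?thesis
      unfolding s_def by (rule filterlim_compose)
  qed
  have conts: "continuous_on UNIV (s n)" for n
    unfolding s_def[abs_def]
    by (intro continuous_intros continuous_on_compose2[OF cont]) auto
  have zero: "(LINT x|torus. s n x) = 0" for n
  proof -
    have 1: "integrable torus (\<lambda>x. f (x + a n *\<^sub>R ?e))"
      by (intro integrable_torus_continuous continuous_on_compose2[OF cont] continuous_intros) auto
    have 2: "integrable torus f" by (rule integrable_torus_continuous[OF cont])
    have "(LINT x|torus. s n x) = ((LINT x|torus. f (x + a n *\<^sub>R ?e)) - (LINT x|torus. f x)) /\<^sub>R a n"
      unfolding s_def using 1 2 by simp
    then show ?thesis
      using integral_torus_shift[OF cont per, of "a n" i] a[of n] by simp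
  qed
  have "(\<lambda>n. LINT x|torus. s n x) \<longlonglongrightarrow> (LINT x|torus. partial_deriv i f x)"
    by (rule integral_dominated_convergence[where w = "\<lambda>_. B"])
       (auto intro!: measurable_torus_continuous cont' conts AE_I2 lim bound)
  then show ?thesis
    unfolding zero by (simp add: LIMSEQ_const_iff)
qed

section \<open>Fourier coefficients of functions\<close>

definition fcoef :: "(real ^ 'n \<Rightarrow> complex) \<Rightarrow> int ^ 'n \<Rightarrow> complex"
  where "fcoef g k = (LINT x|torus. g x * fchar k x)"

text \<open>Integration by parts: \<open>g x * fchar k x\<close> is periodic, so its partial
  derivative has integral zero, and the product rule moves the derivative onto the character. The
  factor is written with \<open>(- k) $ i\<close> to match \<open>dsym (- k)\<close>.\<close>

lemma fcoef_partial_deriv: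
  assumes g: "g \<in> test_funs"
  shows "fcoef (partial_deriv i g) k = (- 2 * of_real pi * \<i> * of_int ((- k) $ i)) * fcoef g k"
proof -
  define f where "f = (\<lambda>x. g x * fchar k x)"
  let ?c = "- 2 * of_real pi * \<i> * of_int (k $ i) :: complex"
  have D: "(f has_derivative (\<lambda>h. g x * (- 2 * of_real pi * \<i> * of_real (real_vec k \<bullet> h) * fchar k x)
      + frechet_derivative g (at x) h * fchar k x)) (at x)" for x
    unfolding f_def
    using test_fun_differentiable[OF g, of "[]"]
    by (intro has_derivative_mult has_derivative_fchar frechet_derivative_worksI) auto
  have eq: "partial_deriv i f = (\<lambda>x. partial_deriv i g x * fchar k x + ?c * (g x * fchar k x))"
    unfolding partial_derivI[OF D] by (simp add: partial_deriv_def inner_axis fun_eq_iff algebra_simps)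
  have c1: "continuous_on UNIV (\<lambda>x. partial_deriv i g x * fchar k x)"
    using test_fun_continuous[OF test_funs_partial_deriv[OF g]] by (intro continuous_intros) auto
  have c2: "continuous_on UNIV (\<lambda>x. g x * fchar k x)"
    using test_fun_continuous[OF g] by (intro continuous_intros) auto
  have "(LINT x|torus. partial_deriv i f x) = 0"
  proof (rule integral_partial_deriv)
    show "f differentiable at x" for x using D differentiable_def by blast
    show "f (x + real_vec j) = f x" for x j
      using test_fun_periodic[OF g] by (simp add: f_def fchar_periodic)
    show "continuous_on UNIV (partial_deriv i f)"
      unfolding eq by (intro continuous_on_add c1 continuous_on_mult_left c2)
  qed
  then have "fcoef (partial_deriv i g) k + ?c * fcoef g k = 0"
    unfolding eq fcoef_def
    by (subst (asm) Bochner_Integration.integral_add)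
       (auto intro!: integrable_torus_continuous c1 c2 continuous_on_mult_left)
  then show ?thesis by (simp add: algebra_simps eq_neg_iff_add_eq_0)
qed

lemma fcoef_iter_deriv:
  assumes "g \<in> test_funs"
  shows "fcoef (iter_deriv js g) k = dsym (- k) js * fcoef g k"
proof (induction js)
  case (Cons i js)
  show ?case
    unfolding iter_deriv.simps fcoef_partial_deriv[OF test_funs_iter_deriv[OF assms]] Cons
    by (simp add: dsym_def)
qed (simp add: dsym_def)

text \<open>For \<open>k \<noteq> 0\<close> some partial derivative of \<open>fchar k\<close> is a
  nonzero multiple of \<open>fchar k\<close>, and partial derivatives of periodic functions have
  integral zero.\<close>

lemma integral_fchar: "(LINT x|torus. fchar k x) = (if k = 0 then 1 else 0)"
proof (cases "k = 0")
  case True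
  then show ?thesis by simp
next
  case False
  then obtain i where i: "k $ i \<noteq> 0" by (auto simp: vec_eq_iff)
  have "partial_deriv i (fchar k) = (\<lambda>x. dsym k [i] * fchar k x)"
    using iter_deriv_fchar[of "[i]" k] by simp
  moreover have "(LINT x|torus. partial_deriv i (fchar k) x) = 0"
    using test_fun_differentiable[OF fchar_test_fun, of "[]"]
    by (intro integral_partial_deriv fchar_periodic test_fun_continuous[OF test_funs_partial_deriv]
        fchar_test_fun) auto
  ultimately show ?thesis using i False by (simp add: dsym_def)
qed

text \<open>There is no conjugation in \<open>fcoef\<close>, and \<open>fchar j\<close> has
  frequency \<open>- j\<close>; hence the condition \<open>j + k = 0\<close>. For the same reason a
  function is recovered from its coefficients with \<open>fchar (- k)\<close>.\<close>

lemma fcoef_fchar: "fcoef (fchar j) k = (if j + k = 0 then 1 else 0)"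
  by (simp add: fcoef_def fchar_mult integral_fchar)

lemma norm_fcoef_le:
  assumes "continuous_on UNIV g" "\<And>x. cmod (g x) \<le> B"
  shows "cmod (fcoef g k) \<le> B"
proof -
  have "cmod (fcoef g k) \<le> (LINT x|torus. cmod (g x * fchar k x))"
    unfolding fcoef_def by (rule integral_norm_bound)
  also have "\<dots> \<le> (LINT x|(torus :: (real ^ 'a) measure). B)"
    using assms by (intro integral_mono integrable_torus_continuous)
      (auto simp: norm_mult intro!: continuous_intros)
  finally show ?thesis by simp
qed

text \<open>Differentiating \<open>2 * r\<close> times in the direction of a largest coordinate of
  \<open>k\<close> multiplies the coefficient by at least \<open>M ^ r\<close>. That coordinate
  controls the others: with n the dimension, the square of \<open>jap k\<close> is at most
  \<open>1 + n * M\<close>, hence at most \<open>(n + 1) * max 1 M\<close>, which explains the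
  constant.\<close>

lemma fcoef_decay:
  fixes g :: "real ^ 'n \<Rightarrow> complex"
  assumes g: "g \<in> test_funs"
  shows "jap k ^ (2 * r) * cmod (fcoef g k) \<le> (real CARD('n) + 1) ^ r * seminorm (2 * r) g"
proof -
  define M where "M = Max (range (\<lambda>i. (real_of_int (k $ i))\<^sup>2))"
  have M: "(real_of_int (k $ i))\<^sup>2 \<le> M" for i
    unfolding M_def by (rule Max_ge) auto
  have "M \<in> range (\<lambda>i. (real_of_int (k $ i))\<^sup>2)"
    unfolding M_def by (rule Max_in) auto
  then obtain i where i: "M = (real_of_int (k $ i))\<^sup>2" by auto
  have "(norm (real_vec k))\<^sup>2 = (\<Sum>i\<in>UNIV. (real_of_int (k $ i))\<^sup>2)"
    by (simp add: norm_vec_def L2_set_def sum_nonneg)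
  also have "\<dots> \<le> real CARD('n) * M"
    using M by (intro sum_bounded_above) auto
  finally have "(jap k)\<^sup>2 \<le> 1 + real CARD('n) * M"
    by (simp add: jap_def)
  also have "\<dots> \<le> (real CARD('n) + 1) * max 1 M"
    by (simp add: distrib_right add_mono mult_left_mono add.commute)
  finally have "jap k ^ (2 * r) \<le> ((real CARD('n) + 1) * max 1 M) ^ r"
    by (simp add: power_mult power_mono)
  then have 1: "jap k ^ (2 * r) \<le> (real CARD('n) + 1) ^ r * max 1 M ^ r"
    by (simp add: power_mult_distrib)
  have 2: "max 1 M ^ r * cmod (fcoef g k) \<le> seminorm (2 * r) g"
  proof (cases "M \<le> 1")
    \<comment> \<open>Here the maximum is 1, no derivative is taken, and the supremum of
      \<open>g\<close> bounds the coefficient.\<close>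
    case True
    then show ?thesis
      using iter_deriv_le_seminorm[OF g, of "[]" "2 * r"] norm_fcoef_le[OF test_fun_continuous[OF g]]
      by (simp add: max_absorb1)
  next
    case False
    let ?js = "replicate (2 * r) i"
    have "M ^ r \<le> cmod (dsym (- k) ?js)"
    proof -
      have "M ^ r = \<bar>real_of_int (k $ i)\<bar> ^ (2 * r)" by (simp add: i power_mult)
      also have "\<dots> \<le> (2 * pi * \<bar>real_of_int (k $ i)\<bar>) ^ (2 * r)"
        using pi_ge_two by (intro power_mono) (auto simp: mult_le_cancel_right1)
      also have "\<dots> = cmod (dsym (- k) ?js)"
        by (simp add: dsym_def norm_power norm_mult)
      finally show ?thesis .
    qed
    then have "M ^ r * cmod (fcoef g k) \<le> cmod (dsym (- k) ?js) * cmod (fcoef g k)"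
      by (intro mult_right_mono) auto
    also have "\<dots> = cmod (fcoef (iter_deriv ?js g) k)"
      by (simp add: fcoef_iter_deriv[OF g] norm_mult)
    also have "\<dots> \<le> seminorm (2 * r) g"
      by (intro norm_fcoef_le test_fun_continuous test_funs_iter_deriv g iter_deriv_le_seminorm) simp
    finally show ?thesis using False by (simp add: max_absorb2)
  qed
  have "jap k ^ (2 * r) * cmod (fcoef g k)
      \<le> (real CARD('n) + 1) ^ r * max 1 M ^ r * cmod (fcoef g k)"
    using 1 by (intro mult_right_mono) auto
  also have "\<dots> \<le> (real CARD('n) + 1) ^ r * seminorm (2 * r) g"
    unfolding mult.assoc using 2 by (intro mult_left_mono) auto
  finally show ?thesis .
qed

section \<open>Convergence of lattice sums\<close>

lemma summable_on_Un:
  fixes f :: "'a \<Rightarrow> real"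
  assumes "f summable_on A" "f summable_on B"
  shows "f summable_on (A \<union> B)"
proof -
  have "f summable_on (B - A)"
    using assms(2) by (rule summable_on_subset_banach) auto
  then have "f summable_on (A \<union> (B - A))"
    by (intro summable_on_Un_disjoint assms(1)) auto
  then show ?thesis by (simp add: Un_Diff_cancel)
qed

lemma summable_on_inverse_squares: "(\<lambda>j::int. 1 / (1 + (real_of_int j)\<^sup>2)) summable_on UNIV"
proof -
  have 0: "summable (\<lambda>n. 1 / (1 + (real n)\<^sup>2))"
  proof (rule summable_comparison_test')
    show "summable (\<lambda>n. 1 / (real n)\<^sup>2)"
      using inverse_power_summable[of 2, where 'a = real] by (simp add: field_simps)
    show "norm (1 / (1 + (real n)\<^sup>2)) \<le> 1 / (real n)\<^sup>2" if "n \<ge> 1" for n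
      using that by (simp add: divide_simps add_pos_nonneg)
  qed
  then have N: "(\<lambda>n. 1 / (1 + (real n)\<^sup>2)) summable_on UNIV"
    by (subst summable_on_UNIV_nonneg_real_iff) auto
  have "(\<lambda>j::int. 1 / (1 + (real_of_int j)\<^sup>2)) summable_on range int"
    using N by (subst summable_on_reindex) (auto simp: o_def)
  moreover have "(\<lambda>j::int. 1 / (1 + (real_of_int j)\<^sup>2)) summable_on range (\<lambda>n. - int n)"
    using N by (subst summable_on_reindex) (auto simp: o_def inj_on_def)
  ultimately have "(\<lambda>j::int. 1 / (1 + (real_of_int j)\<^sup>2)) summable_on range int \<union> range (\<lambda>n. - int n)"
    using summable_on_Un by blast
  moreover have "range int \<union> range (\<lambda>n. - int n) = UNIV"
    by (auto simp: image_iff) (metis int_cases2)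
  ultimately show ?thesis by simp
qed

text \<open>The square of \<open>jap k\<close> dominates \<open>1 + (k $ i)^2\<close> for every
  coordinate. Multiplying over all coordinates compares the series with a product of convergent
  one-dimensional ones.\<close>

lemma summable_on_jap: "(\<lambda>k :: int ^ 'n. 1 / jap k ^ (2 * CARD('n))) summable_on UNIV"
proof (rule nonneg_bounded_partial_sums_imp_summable_on)
  let ?f = "\<lambda>j::int. 1 / (1 + (real_of_int j)\<^sup>2)"
  let ?S = "infsum ?f UNIV"
  show "\<forall>\<^sub>F X in finite_subsets_at_top UNIV. (\<Sum>k\<in>X. 1 / jap (k :: int ^ 'n) ^ (2 * CARD('n))) \<le> ?S ^ CARD('n)"
  proof (rule eventually_finite_subsets_at_top_weakI)
    fix F :: "(int ^ 'n) set" assume F: "finite F"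
    \<comment> \<open>\<open>T\<close> gathers all coordinates that occur in \<open>F\<close>. Then
      \<open>F\<close> lies in the set of vectors with entries in \<open>T\<close>, and over this
      set the sum of products factors.\<close>
    define T where "T = (\<lambda>(k, i). k $ i) ` (F \<times> (UNIV :: 'n set))"
    have T: "finite T" unfolding T_def using F by auto
    have le: "1 / jap k ^ (2 * CARD('n)) \<le> (\<Prod>i\<in>UNIV. ?f (k $ i))" for k :: "int ^ 'n"
    proof -
      have "(\<Prod>i\<in>UNIV. 1 + (real_of_int (k $ i))\<^sup>2) \<le> (\<Prod>i\<in>(UNIV::'n set). (jap k)\<^sup>2)"
      proof (rule prod_mono)
        fix i
        show "0 \<le> 1 + (real_of_int (k $ i))\<^sup>2 \<and> 1 + (real_of_int (k $ i))\<^sup>2 \<le> (jap k)\<^sup>2"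
          using power_mono[OF component_le_norm_cart[of "real_vec k" i], of 2] by (simp add: jap_def)
      qed
      then have "(\<Prod>i\<in>UNIV. 1 + (real_of_int (k $ i))\<^sup>2) \<le> jap k ^ (2 * CARD('n))"
        by (simp add: power_mult)
      moreover have "0 < (\<Prod>i\<in>UNIV. 1 + (real_of_int (k $ i))\<^sup>2)"
        by (intro prod_pos) (auto simp: add_pos_nonneg)
      ultimately show ?thesis
        by (simp add: prod_dividef frac_le)
    qed
    have "(\<Sum>k\<in>F. 1 / jap k ^ (2 * CARD('n))) \<le> (\<Sum>k\<in>F. \<Prod>i\<in>UNIV. ?f (k $ i))"
      by (intro sum_mono le)
    also have "\<dots> = (\<Sum>h\<in>vec_nth ` F. \<Prod>i\<in>UNIV. ?f (h i))"
      by (subst sum.reindex) (auto simp: inj_on_def vec_nth_inject)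
    also have "\<dots> \<le> (\<Sum>h\<in>PiE UNIV (\<lambda>_::'n. T). \<Prod>i\<in>UNIV. ?f (h i))"
      using T by (intro sum_mono2 finite_PiE) (auto simp: T_def intro!: prod_nonneg)
    also have "\<dots> = (\<Prod>i\<in>(UNIV :: 'n set). \<Sum>j\<in>T. ?f j)"
      using T by (subst prod_sum_PiE) auto
    also have "\<dots> \<le> (\<Prod>i\<in>(UNIV :: 'n set). ?S)"
      using T by (intro prod_mono) (auto intro!: sum_nonneg finite_sum_le_infsum summable_on_inverse_squares)
    finally show "(\<Sum>k\<in>F. 1 / jap k ^ (2 * CARD('n))) \<le> ?S ^ CARD('n)" by simp
  qed
qed (auto intro: less_imp_le[OF jap_pos])

section \<open>Uniqueness of Fourier coefficients\<close>

text \<open>Products are not among the rules. Closure under multiplication is derived from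
  \<open>fchar_mult\<close>, so that an induction over this set has linear cases only, as the
  vanishing of integrals requires.\<close>

inductive_set trig_polys :: "(real ^ 'n \<Rightarrow> complex) set" where
  char: "fchar k \<in> trig_polys"
| scale: "f \<in> trig_polys \<Longrightarrow> (\<lambda>x. c * f x) \<in> trig_polys"
| add: "f \<in> trig_polys \<Longrightarrow> g \<in> trig_polys \<Longrightarrow> (\<lambda>x. f x + g x) \<in> trig_polys"

lemma trig_polys_const: "(\<lambda>x. c) \<in> trig_polys"
  using trig_polys.scale[OF trig_polys.char[of 0], of c] by simp

lemma trig_polys_sum:
  assumes "finite F" "\<And>j. j \<in> F \<Longrightarrow> f j \<in> trig_polys"
  shows "(\<lambda>x. \<Sum>j\<in>F. f j x) \<in> trig_polys"
  using assms by (induction F) (auto intro: trig_polys.add trig_polys_const)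

lemma trig_polys_mult_fchar: "f \<in> trig_polys \<Longrightarrow> (\<lambda>x. f x * fchar k x) \<in> trig_polys"
proof (induction rule: trig_polys.induct)
  case (char j)
  show ?case using trig_polys.char[of "j + k"] by (simp add: fchar_mult)
next
  case (scale f c)
  show ?case using trig_polys.scale[OF scale(2), of c] by (simp add: mult.assoc)
next
  case (add f g)
  show ?case using trig_polys.add[OF add(3,4)] by (simp add: distrib_right)
qed

lemma trig_polys_mult:
  assumes f: "f \<in> trig_polys" and "g \<in> trig_polys"
  shows "(\<lambda>x. f x * g x) \<in> trig_polys"
  using assms(2)
proof (induction rule: trig_polys.induct)
  case (char k)
  show ?case by (rule trig_polys_mult_fchar[OF f])
next
  case (scale g c)
  show ?case using trig_polys.scale[OF scale(2), of c] by (simp add: mult.left_commute)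
next
  case (add g h)
  show ?case using trig_polys.add[OF add(3,4)] by (simp add: distrib_left)
qed

text \<open>
  The torus as a compact subset of \<open>complex ^ 'n\<close>: real polynomials pull back to trigonometric
  polynomials, so that the polynomial form of the Stone--Weierstrass theorem applies.
\<close>

definition circle_emb :: "real ^ 'n \<Rightarrow> complex ^ 'n"
  where "circle_emb x = (\<chi> j. cis (2 * pi * x $ j))"

lemma continuous_circle_emb: "continuous_on S circle_emb"
  unfolding circle_emb_def by (intro continuous_intros)

lemma circle_emb_nth: "circle_emb x $ j = fchar (- axis j 1) x"
proof -
  have "real_vec (- axis j 1) = - axis j 1" by (simp add: vec_eq_iff axis_def)
  then show ?thesis by (simp add: circle_emb_def fchar_cis inner_commute[of _ x] inner_axis)
qed

text \<open>A real linear functional on \<open>complex ^ 'n\<close> combines real and imaginary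
  parts of coordinates; on the image of \<open>circle_emb\<close> these are combinations of a
  character and its inverse. Sums and products then stay within \<open>trig_polys\<close>.\<close>

lemma trig_polys_of_real_polynomial:
  "real_polynomial_function p \<Longrightarrow> (\<lambda>x. of_real (p (circle_emb x))) \<in> trig_polys"
proof (induction rule: real_polynomial_function.induct)
  case (linear f)
  interpret f: bounded_linear f by fact
  have z: "z = (\<Sum>j\<in>UNIV. Re (z $ j) *\<^sub>R axis j 1 + Im (z $ j) *\<^sub>R axis j \<i>)" for z :: "complex ^ 'a"
    by (simp add: vec_eq_iff axis_def if_distrib sum.distrib complex_eq_iff cong: if_cong)
  have fz: "f z = (\<Sum>j\<in>UNIV. f (axis j 1) * Re (z $ j) + f (axis j \<i>) * Im (z $ j))" for z
    by (subst z) (simp add: f.sum f.add f.scale mult.commute)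
  have "of_real (Re (fchar k x)) = (1 / 2) * (fchar k x + fchar (- k) x)" for k and x :: "real ^ 'a"
    by (simp add: complex_eq_iff cnj_fchar[symmetric])
  moreover have "of_real (Im (fchar k x)) = (- \<i> / 2) * (fchar k x + (- 1) * fchar (- k) x)" for k and x :: "real ^ 'a"
    by (simp add: complex_eq_iff flip: cnj_fchar)
  ultimately have eq: "of_real (f (circle_emb x)) =
     (\<Sum>j\<in>UNIV. of_real (f (axis j 1)) * ((1 / 2) * (fchar (- axis j 1) x + fchar (- (- axis j 1)) x))
      + of_real (f (axis j \<i>)) * ((- \<i> / 2) * (fchar (- axis j 1) x + (- 1) * fchar (- (- axis j 1)) x)))" for x
    by (simp only: fz[of "circle_emb x"] circle_emb_nth of_real_sum of_real_add of_real_mult)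
  show ?case
    unfolding eq
    by (intro trig_polys_sum trig_polys.add trig_polys.scale trig_polys.char finite)
next
  case (const c)
  show ?case by (rule trig_polys_const)
next
  case (add f g)
  show ?case using trig_polys.add[OF add(3,4)] by simp
next
  case (mult f g)
  show ?case using trig_polys_mult[OF mult(3,4)] by simp
qed

lemma trig_polys_continuous: "f \<in> trig_polys \<Longrightarrow> continuous_on S f"
  by (induction rule: trig_polys.induct) (auto intro!: continuous_intros)

text \<open>Opposite faces of the cube are glued together, but an interior point is glued to
  nothing. Hence only one of the two points has to be interior: coordinates differ by an integer of
  absolute value less than 1.\<close>

lemma circle_emb_inj:
  assumes "x \<in> cbox 0 1" "y \<in> box 0 1" "circle_emb x = circle_emb y"
  shows "x = y"
proof (subst vec_eq_iff, rule allI)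
  fix j
  have "cis (2 * pi * x $ j) = cis (2 * pi * y $ j)"
    using assms(3) by (simp add: circle_emb_def vec_eq_iff)
  then have "sin (2 * pi * x $ j) = sin (2 * pi * y $ j) \<and> cos (2 * pi * x $ j) = cos (2 * pi * y $ j)"
    by (simp add: cis.ctr)
  then obtain n :: int where "2 * pi * x $ j = 2 * pi * y $ j + 2 * pi * of_int n"
    unfolding sin_cos_eq_iff by (auto simp: mult_ac)
  then have "2 * pi * x $ j = 2 * pi * (y $ j + of_int n)"
    by (simp add: distrib_left)
  then have n: "x $ j = y $ j + of_int n"
    by simp
  have "0 \<le> x $ j" "x $ j \<le> 1" "0 < y $ j" "y $ j < 1"
    using assms(1,2) by (auto simp: mem_box_cart)
  then have "- 1 < real_of_int n" "real_of_int n < 1" using n by linarith+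
  then have "n = 0" by linarith
  then show "x $ j = y $ j" using n by simp
qed

lemma integrable_torus_mult:
  assumes h: "integrable torus h" and g: "continuous_on UNIV g"
  shows "integrable torus (\<lambda>x. h x * g x :: complex)"
proof -
  have "bounded (g ` cbox 0 1)"
    using g by (intro compact_imp_bounded compact_continuous_image) (auto intro: continuous_on_subset)
  then obtain B where B: "\<And>x. x \<in> cbox 0 1 \<Longrightarrow> cmod (g x) \<le> B"
    by (auto simp: bounded_iff)
  have [measurable]: "h \<in> borel_measurable torus" "g \<in> borel_measurable torus"
    using h measurable_torus_continuous[OF g] by auto
  show ?thesis
  proof (rule Bochner_Integration.integrable_bound)
    show "integrable torus (\<lambda>x. B * cmod (h x))" using h by simp
    show "AE x in torus. norm (h x * g x) \<le> norm (B * cmod (h x))"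
    proof (rule AE_I2)
      fix x :: "real ^ 'a" assume "x \<in> space torus"
      then have "cmod (h x) * cmod (g x) \<le> cmod (h x) * B"
        using B by (intro mult_left_mono) auto
      then show "norm (h x * g x) \<le> norm (B * cmod (h x))"
        by (simp add: norm_mult mult.commute abs_mult) (meson abs_ge_self mult_right_mono norm_ge_zero order_trans)
    qed
  qed measurable
qed

lemma AE_torus_box: "AE x in (torus :: (real ^ 'n) measure). x \<in> box 0 1"
proof (rule AE_I)
  let ?N = "cbox 0 1 - box 0 1 :: (real ^ 'n) set"
  show "?N \<in> sets torus"
    unfolding torus_def by (subst sets_restrict_space_iff) auto
  have "emeasure lborel ?N = emeasure lborel (cbox 0 1 :: (real ^ 'n) set) - emeasure lborel (box 0 1 :: (real ^ 'n) set)"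
    by (rule emeasure_Diff) (auto simp: emeasure_lborel_box_eq box_subset_cbox)
  then have "emeasure lborel ?N = 0"
    by (simp add: emeasure_lborel_box_eq emeasure_lborel_cbox_eq inner_Basis_mono)
  then show "emeasure torus ?N = 0"
    unfolding torus_def by (subst emeasure_restrict_space) auto
qed auto

text \<open>By linearity \<open>h\<close> annihilates trigonometric polynomials. On the compact
  image of the cube polynomials approximate \<open>G\<close> uniformly, and uniform approximation
  suffices against a function that is merely integrable.\<close>

lemma integral_circle_emb_eq_0:
  fixes h :: "real ^ 'n \<Rightarrow> complex" and G :: "complex ^ 'n \<Rightarrow> real"
  assumes h: "integrable torus h" and 0: "\<And>k. fcoef h k = 0" and G: "continuous_on UNIV G"
  shows "(LINT x|torus. h x * of_real (G (circle_emb x))) = 0"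
proof -
  have trig0: "(LINT x|torus. h x * P x) = 0" if "P \<in> trig_polys" for P
    using that
  proof (induction rule: trig_polys.induct)
    case (char k)
    then show ?case using 0 by (simp add: fcoef_def)
  next
    case (scale f c)
    then show ?case by (simp add: mult.left_commute[of _ c])
  next
    case (add f g)
    then show ?case
      by (simp add: distrib_left integrable_torus_mult[OF h] trig_polys_continuous)
  qed
  define I where "I = (LINT x|torus. cmod (h x))"
  have cG: "continuous_on UNIV (\<lambda>x. complex_of_real (G (circle_emb x)))"
    by (intro continuous_intros continuous_on_compose2[OF G] continuous_circle_emb) auto
  have le: "cmod (LINT x|torus. h x * of_real (G (circle_emb x))) \<le> e * I" if e: "0 < e" for e
  proof -
    have "compact (circle_emb ` cbox 0 1 :: (complex ^ 'n) set)"
      by (intro compact_continuous_image continuous_circle_emb compact_cbox)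
    then obtain p where p: "real_polynomial_function p"
      and pe: "\<And>z. z \<in> circle_emb ` cbox 0 1 \<Longrightarrow> \<bar>G z - p z\<bar> < e"
      using Stone_Weierstrass_real_polynomial_function e continuous_on_subset[OF G] by (metis subset_UNIV)
    define P where "P = (\<lambda>x. complex_of_real (p (circle_emb x)))"
    have P: "P \<in> trig_polys" unfolding P_def using p by (rule trig_polys_of_real_polynomial)
    have "(LINT x|torus. h x * of_real (G (circle_emb x)))
        = (LINT x|torus. h x * of_real (G (circle_emb x))) - (LINT x|torus. h x * P x)"
      using trig0[OF P] by simp
    also have "\<dots> = (LINT x|torus. h x * of_real (G (circle_emb x)) - h x * P x)"
      by (intro Bochner_Integration.integral_diff[symmetric] integrable_torus_mult h cG trig_polys_continuous P)
    also have "cmod \<dots> \<le> (LINT x|torus. cmod (h x * of_real (G (circle_emb x)) - h x * P x))"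
      by (rule integral_norm_bound)
    also have "\<dots> \<le> (LINT x|torus. e * cmod (h x))"
    proof (rule integral_mono)
      fix x :: "real ^ 'n" assume "x \<in> space torus"
      then have "\<bar>G (circle_emb x) - p (circle_emb x)\<bar> \<le> e"
        using pe[of "circle_emb x"] by (simp add: less_imp_le)
      then have "cmod (h x) * \<bar>G (circle_emb x) - p (circle_emb x)\<bar> \<le> cmod (h x) * e"
        by (intro mult_left_mono) auto
      then show "cmod (h x * of_real (G (circle_emb x)) - h x * P x) \<le> e * cmod (h x)"
        unfolding P_def right_diff_distrib[symmetric] of_real_diff[symmetric] norm_mult norm_of_real
        by (simp add: mult.commute)
    qed (use h in \<open>auto intro!: Bochner_Integration.integrable_diff integrable_norm integrable_torus_mult cG
          trig_polys_continuous P\<close>)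
    also have "\<dots> = e * I" using h by (simp add: I_def)
    finally show ?thesis .
  qed
  have I: "0 \<le> I" unfolding I_def by (rule Bochner_Integration.integral_nonneg) simp
  have "cmod (LINT x|torus. h x * of_real (G (circle_emb x))) \<le> 0"
  proof (rule field_le_epsilon)
    fix e :: real assume e: "0 < e"
    \<comment> \<open>The \<open>+ 1\<close> in the denominator is there because \<open>I\<close>
      may be 0.\<close>
    have "cmod (LINT x|torus. h x * of_real (G (circle_emb x))) \<le> e / (I + 1) * I"
      using e I by (intro le) (auto simp: add_nonneg_pos)
    also have "\<dots> \<le> e"
      using e I by (simp add: divide_simps mult_left_mono)
    finally show "cmod (LINT x|torus. h x * of_real (G (circle_emb x))) \<le> 0 + e" by simp
  qed
  then show ?thesis by simp
qed

text \<open>The indicator of \<open>E\<close> is a pointwise limit on the cube of continuous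
  functions of \<open>circle_emb x\<close>. The set has to stay off the boundary, for otherwise
  points outside \<open>E\<close> could be mapped into its image.\<close>

lemma integral_compact_eq_0:
  fixes h :: "real ^ 'n \<Rightarrow> complex"
  assumes h: "integrable torus h" and 0: "\<And>k. fcoef h k = 0" and E: "compact E" "E \<subseteq> box 0 1"
  shows "(LINT x|torus. h x * of_real (indicator E x)) = 0"
proof (cases "E = {}")
  case False
  define K where "K = circle_emb ` E"
  have K: "compact K" "K \<noteq> {}"
    unfolding K_def using E False by (auto intro!: compact_continuous_image continuous_circle_emb)
  \<comment> \<open>Tent functions around \<open>K\<close>: they equal 1 on \<open>K\<close> and
    vanish at distance at least \<open>1 / m\<close> from it, for positive \<open>m\<close>.\<close>
  define G where "G m z = max 0 (1 - real m * infdist z K)" for m z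
  have contG: "continuous_on UNIV (G m)" for m
    unfolding G_def[abs_def] by (intro continuous_intros)
  have [measurable]: "E \<in> sets borel" using E by (simp add: compact_imp_closed)
  have [measurable]: "h \<in> borel_measurable torus" using h by auto
  have [measurable]: "(\<lambda>x. of_real (G m (circle_emb x)) :: complex) \<in> borel_measurable torus" for m
    by (intro measurable_torus_continuous continuous_intros continuous_on_compose2[OF contG]
        continuous_circle_emb) auto
  have lim: "(\<lambda>m. G m (circle_emb x)) \<longlonglongrightarrow> indicator E x" if x: "x \<in> cbox 0 1" for x
  proof (cases "x \<in> E")
    case True
    then have "infdist (circle_emb x) K = 0" by (simp add: K_def)
    then show ?thesis using True by (simp add: G_def)
  next
    case False
    then have "circle_emb x \<notin> K"
      unfolding K_def using circle_emb_inj[OF x] E(2) by blast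
    then have pos: "0 < infdist (circle_emb x) K"
      using K by (simp add: infdist_pos_not_in_closed compact_imp_closed)
    obtain N :: nat where N: "1 / infdist (circle_emb x) K < real N"
      using reals_Archimedean2 by blast
    have "G m (circle_emb x) = 0" if "m \<ge> N" for m
    proof -
      have "1 / infdist (circle_emb x) K < real m" using N that by linarith
      then have "1 < real m * infdist (circle_emb x) K" using pos by (simp add: divide_simps)
      then show ?thesis by (simp add: G_def)
    qed
    then have "\<forall>\<^sub>F m in sequentially. G m (circle_emb x) = indicator E x"
      using False by (auto simp: eventually_sequentially)
    then show ?thesis by (rule tendsto_eventually)
  qed
  have "(\<lambda>m. LINT x|torus. h x * of_real (G m (circle_emb x)))
      \<longlonglongrightarrow> (LINT x|torus. h x * of_real (indicator E x))"
  proof (rule integral_dominated_convergence[where w = "\<lambda>x. cmod (h x)"])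
    show "(\<lambda>x. h x * of_real (indicator E x)) \<in> borel_measurable torus"
    proof -
      have "indicator E \<in> borel_measurable (torus :: (real ^ 'n) measure)"
        unfolding torus_def by (intro measurable_restrict_space1) simp
      then show ?thesis by measurable
    qed
    show "AE x in torus. (\<lambda>m. h x * of_real (G m (circle_emb x))) \<longlonglongrightarrow> h x * of_real (indicator E x)"
      by (intro AE_I2 tendsto_intros lim) simp
    show "AE x in torus. norm (h x * of_real (G m (circle_emb x))) \<le> cmod (h x)" for m
      by (intro AE_I2) (auto simp: norm_mult G_def infdist_nonneg intro!: mult_left_le)
  qed (use h in auto)
  then show ?thesis
    unfolding integral_circle_emb_eq_0[OF h 0 contG] by (simp add: LIMSEQ_const_iff)
qed simp

text \<open>Inner regularity: if \<open>u\<close> were positive on a set of positive measure, it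
  would be so on a compact subset of positive measure, where an integral equal to zero is
  impossible. The boundary of the cube is null and can be discarded.\<close>

lemma AE_nonpos_of_compact_integrals:
  fixes u :: "real ^ 'n \<Rightarrow> real"
  assumes u: "integrable torus u"
    and 0: "\<And>E. compact E \<Longrightarrow> E \<subseteq> box 0 1 \<Longrightarrow> (LINT x|torus. indicator E x * u x) = 0"
  shows "AE x in torus. u x \<le> 0"
proof -
  define P where "P = {x \<in> space torus. 0 < u x \<and> x \<in> box 0 1}"
  have [measurable]: "u \<in> borel_measurable torus" using u by auto
  have "box 0 1 = space (torus :: (real ^ 'n) measure) \<inter> box 0 1" by (auto simp: box_subset_cbox[THEN subsetD])
  have [measurable]: "Measurable.pred torus (\<lambda>x :: real ^ 'n. x \<in> box 0 1)"
    unfolding torus_def by (intro measurable_restrict_space1) simp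
  have P: "P \<in> sets torus" unfolding P_def by measurable
  then have Pb: "P \<in> sets lborel"
    unfolding torus_def by (subst (asm) sets_restrict_space_iff) auto
  have "emeasure lborel P = 0"
  proof (rule ccontr)
    assume ne: "emeasure lborel P \<noteq> 0"
    have "P \<subseteq> cbox 0 1" by (auto simp: P_def)
    then have "emeasure lborel P \<le> emeasure lborel (cbox 0 1 :: (real ^ 'n) set)"
      by (intro emeasure_mono) auto
    also have "\<dots> < \<infinity>" by (simp add: emeasure_lborel_cbox_eq)
    finally have fin: "emeasure lborel P < \<infinity>" .
    define r where "r = measure lborel P"
    have r: "emeasure lborel P = ennreal r" "0 < r"
      using fin ne by (auto simp: r_def emeasure_eq_ennreal_measure zero_less_measure_iff)
    have "P \<in> sets lebesgue" using Pb by (simp add: sets_completionI_sets)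
    then obtain T where T: "closed T" "T \<subseteq> P" "emeasure lebesgue (P - T) < ennreal r"
      using sets_lebesgue_inner_closed[OF _ r(2)] by metis
    have Tb: "T \<in> sets borel" using T(1) by auto
    have "bounded T"
      using T(2) \<open>P \<subseteq> cbox 0 1\<close> bounded_cbox bounded_subset by (metis subset_trans)
    then have Tc: "compact T" using T(1) by (simp add: compact_eq_bounded_closed)
    have Tbox: "T \<subseteq> box 0 1" using T(2) by (auto simp: P_def)
    have T0: "emeasure lborel T = 0"
    proof -
      have "integrable torus (\<lambda>x. indicator T x * u x)"
        using u Tb unfolding torus_def
        by (subst real_scaleR_def[symmetric], intro integrable_mult_indicator)
           (auto simp: sets_restrict_space_iff Tbox box_subset_cbox subset_trans[OF Tbox box_subset_cbox])
      moreover have "AE x in torus. 0 \<le> indicator T x * u x"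
        using T(2) by (intro AE_I2) (auto simp: indicator_def P_def)
      ultimately have "AE x in torus. indicator T x * u x = 0"
        using 0[OF Tc Tbox] integral_nonneg_eq_0_iff_AE by blast
      moreover have "indicator T x * u x = 0 \<longleftrightarrow> x \<notin> T" for x
        using T(2) by (auto simp: indicator_def P_def)
      ultimately have "AE x in torus. x \<notin> T" by simp
      then have "AE x in lborel. x \<in> cbox 0 1 \<longrightarrow> x \<notin> T"
        unfolding torus_def by (subst (asm) AE_restrict_space_iff) auto
      then have "AE x in lborel. x \<notin> T"
        by eventually_elim (use Tbox box_subset_cbox in blast)
      then show ?thesis
        using AE_iff_null_sets[of T lborel] Tb by auto
    qed
    have "emeasure lborel P \<le> emeasure lborel (P - T) + emeasure lborel T"
      using emeasure_subadditive[of "P - T" lborel T] Pb Tb T(2) by (simp add: Un_absorb2)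
    also have "\<dots> < ennreal r"
      using T(3) T0 Pb Tb by simp
    finally show False using r by simp
  qed
  then have "AE x in lborel. x \<notin> P"
    using AE_iff_null_sets[of P lborel] Pb by auto
  then have "AE x in torus. x \<notin> P"
    unfolding torus_def by (subst AE_restrict_space_iff) auto
  with AE_torus_box AE_space show ?thesis
    by eventually_elim (auto simp: P_def)
qed

text \<open>The one-sided lemma is applied to the real and imaginary parts and to their
  negatives.\<close>

theorem AE_eq_0_of_fcoef:
  assumes h: "integrable torus h" and 0: "\<And>k. fcoef h k = 0"
  shows "AE x in torus. h x = 0"
proof -
  have E: "(LINT x|torus. indicator E x * Re (h x)) = 0" "(LINT x|torus. indicator E x * Im (h x)) = 0"
    if E: "compact E" "E \<subseteq> box 0 1" for E
  proof -
    have [measurable]: "h \<in> borel_measurable torus" using h by auto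
    have "indicator E \<in> borel_measurable (torus :: (real ^ 'a) measure)"
      using E unfolding torus_def
      by (intro measurable_restrict_space1) (auto simp: compact_imp_closed)
    then have "(\<lambda>x. h x * of_real (indicator E x)) \<in> borel_measurable torus" by measurable
    then have "integrable torus (\<lambda>x. h x * of_real (indicator E x))"
      by (rule Bochner_Integration.integrable_bound[OF h]) (auto simp: indicator_def)
    then show "(LINT x|torus. indicator E x * Re (h x)) = 0" "(LINT x|torus. indicator E x * Im (h x)) = 0"
      using integral_compact_eq_0[OF h 0 E] integral_Re[of torus "\<lambda>x. h x * of_real (indicator E x)"]
        integral_Im[of torus "\<lambda>x. h x * of_real (indicator E x)"]
      by (auto simp: mult.commute)
  qed
  have "AE x in torus. Re (h x) \<le> 0" "AE x in torus. - Re (h x) \<le> 0"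
       "AE x in torus. Im (h x) \<le> 0" "AE x in torus. - Im (h x) \<le> 0"
    using h by (intro AE_nonpos_of_compact_integrals; simp add: E)+
  then show ?thesis
    by eventually_elim (simp add: complex_eq_iff)
qed

text \<open>The zero set of \<open>g\<close> is closed and contains almost every point of the open
  cube, hence all of it; closure reaches the boundary and periodicity the remaining points.\<close>

theorem eq_0_of_fcoef:
  assumes g: "continuous_on UNIV g" and per: "\<And>x k. g (x + real_vec k) = g x"
    and 0: "\<And>k. fcoef g k = 0"
  shows "g x = 0"
proof -
  have "AE x in torus. g x = 0"
    using integrable_torus_continuous[OF g] 0 by (rule AE_eq_0_of_fcoef)
  then have "AE x in lborel. x \<in> cbox 0 1 \<longrightarrow> g x = 0"
    unfolding torus_def by (subst (asm) AE_restrict_space_iff) auto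
  then have "AE x in lebesgue. x \<in> cbox 0 1 \<longrightarrow> g x = 0"
    by (rule AE_completion)
  then have "AE x in lebesgue. x \<in> box 0 1 \<longrightarrow> x \<in> g -` {0}"
    by eventually_elim (use box_subset_cbox in auto)
  moreover have cl: "closed (g -` {0})"
    using g by (intro closed_vimage) auto
  ultimately have "box 0 1 \<subseteq> g -` {0}"
    using mem_closed_if_AE_lebesgue_open[OF open_box, of "g -` {0}" 0 1] by blast
  then have "closure (box 0 1) \<subseteq> g -` {0}"
    using cl by (rule closure_minimal)
  moreover have "box (0 :: real ^ 'a) 1 \<noteq> {}"
  proof -
    have "(\<chi> i. 1 / 2) \<in> box (0 :: real ^ 'a) 1" by (simp add: mem_box_cart)
    then show ?thesis by blast
  qed
  ultimately have "cbox 0 1 \<subseteq> g -` {0}" by (simp add: closure_box)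
  then show ?thesis
    using periodic_reduce[of x] per by (metis vimage_singleton_eq subsetD)
qed

section \<open>Distributions and their Fourier coefficients\<close>

lemma norm_summable_on_comparison:
  fixes f :: "'a \<Rightarrow> 'b::banach"
  assumes "g summable_on A" "\<And>x. x \<in> A \<Longrightarrow> norm (f x) \<le> g x"
  shows "(\<lambda>x. norm (f x)) summable_on A" and "f summable_on A"
proof -
  show "(\<lambda>x. norm (f x)) summable_on A"
    using assms(1) by (rule summable_on_comparison_test) (use assms(2) in auto)
  then show "f summable_on A" by (rule Infinite_Sum.abs_summable_summable)
qed

text \<open>Let n be the dimension. The decay order \<open>2 * (m + n)\<close> leaves
  \<open>m\<close> powers of \<open>jap k\<close> for the weight and \<open>2 * n\<close> for the
  summable factor, because it is at least \<open>m + 2 * n\<close>.\<close>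

lemma fcoef_weighted_bound:
  fixes g :: "real ^ 'n \<Rightarrow> complex"
  assumes "g \<in> test_funs"
  shows "jap k ^ m * cmod (fcoef g k) \<le>
    (real CARD('n) + 1) ^ (m + CARD('n)) * seminorm (2 * (m + CARD('n))) g * (1 / jap k ^ (2 * CARD('n)))"
proof -
  have "jap k ^ m * jap k ^ (2 * CARD('n)) \<le> jap k ^ (2 * (m + CARD('n)))"
    unfolding power_add[symmetric] using jap_ge_1 by (intro power_increasing) auto
  then have "jap k ^ m * jap k ^ (2 * CARD('n)) * cmod (fcoef g k)
      \<le> jap k ^ (2 * (m + CARD('n))) * cmod (fcoef g k)"
    by (rule mult_right_mono) simp
  also have "\<dots> \<le> (real CARD('n) + 1) ^ (m + CARD('n)) * seminorm (2 * (m + CARD('n))) g"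
    by (rule fcoef_decay[OF assms])
  finally have "(jap k ^ m * cmod (fcoef g k)) * jap k ^ (2 * CARD('n))
      \<le> (real CARD('n) + 1) ^ (m + CARD('n)) * seminorm (2 * (m + CARD('n))) g"
    by (simp add: mult_ac)
  moreover have "0 < jap k ^ (2 * CARD('n))" using jap_pos by (rule zero_less_power)
  ultimately show ?thesis by (simp add: pos_le_divide_eq)
qed

lemma fcoef_weighted_summable:
  assumes "g \<in> test_funs"
  shows "(\<lambda>k. jap k ^ m * cmod (fcoef g k)) summable_on UNIV"
proof (rule summable_on_comparison_test)
  show "(\<lambda>k :: int ^ 'a. (real CARD('a) + 1) ^ (m + CARD('a)) * seminorm (2 * (m + CARD('a))) g *
      (1 / jap k ^ (2 * CARD('a)))) summable_on UNIV"
    by (intro summable_on_cmult_right summable_on_jap)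
  show "0 \<le> jap k ^ m * cmod (fcoef g k)" for k
    using jap_pos[of k] by simp
qed (rule fcoef_weighted_bound[OF assms])

text \<open>Absolutely summable coefficients make the series converge uniformly to a continuous
  periodic \<open>S\<close>. It has the coefficients of \<open>g\<close>, so the uniqueness theorem
  for continuous functions identifies the two.\<close>

lemma has_sum_fourier_series:
  assumes g: "g \<in> test_funs"
  shows "((\<lambda>k. fcoef g k * fchar (- k) x) has_sum g x) UNIV"
proof -
  have sm: "(\<lambda>k. cmod (fcoef g k)) summable_on UNIV"
    using fcoef_weighted_summable[OF g, of 0] by simp
  define S where "S x = (\<Sum>\<^sub>\<infinity>k. fcoef g k * fchar (- k) x)" for x
  have ul: "uniform_limit UNIV (\<lambda>F x. \<Sum>k\<in>F. fcoef g k * fchar (- k) x) S (finite_subsets_at_top UNIV)"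
    unfolding S_def[abs_def] by (rule Weierstrass_m_test_general[OF _ sm]) (simp add: norm_mult)
  have contF: "continuous_on UNIV (\<lambda>x. \<Sum>k\<in>F. fcoef g k * fchar (- k) x)" for F
    by (intro continuous_intros)
  have contS: "continuous_on UNIV S"
    by (rule uniform_limit_theorem[OF _ ul]) (auto intro!: always_eventually contF)
  have contg: "continuous_on UNIV g" by (rule test_fun_continuous[OF g])
  have sms: "(\<lambda>k. fcoef g k * fchar (- k) x) summable_on UNIV" for x
    by (rule norm_summable_on_comparison(2)[OF sm]) (simp add: norm_mult)
  have S_coef: "fcoef S j = fcoef g j" for j
  proof -
    have "cmod (fcoef S j - fcoef g j) \<le> 0 + e" if e: "0 < e" for e
    proof -
      have "\<forall>\<^sub>F F in finite_subsets_at_top UNIV.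
          (\<forall>x\<in>UNIV. dist (\<Sum>k\<in>F. fcoef g k * fchar (- k) x) (S x) < e)"
        using uniform_limitD[OF ul e] .
      then obtain X where X: "finite X" and
          *: "\<forall>F. finite F \<and> X \<subseteq> F \<and> F \<subseteq> UNIV \<longrightarrow>
            (\<forall>x\<in>UNIV. dist (\<Sum>k\<in>F. fcoef g k * fchar (- k) x) (S x) < e)"
        unfolding eventually_finite_subsets_at_top by auto
      \<comment> \<open>With \<open>j\<close> put into the index set, the partial sum has exactly
        the \<open>j\<close>-th coefficient of \<open>g\<close>, and only its uniform distance from
        \<open>S\<close> remains to be estimated.\<close>
      define P where "P x = (\<Sum>k\<in>insert j X. fcoef g k * fchar (- k) x)" for x
      have contP: "continuous_on UNIV P" unfolding P_def[abs_def] by (rule contF)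
      have "fcoef P j = (\<Sum>k\<in>insert j X. fcoef g k * fcoef (fchar (- k)) j)"
      proof -
        have "fcoef P j = (LINT x|torus. (\<Sum>k\<in>insert j X. fcoef g k * (fchar (- k) x * fchar j x)))"
          unfolding fcoef_def[of P] P_def sum_distrib_right mult.assoc ..
        also have "\<dots> = (\<Sum>k\<in>insert j X. LINT x|torus. fcoef g k * (fchar (- k) x * fchar j x))"
          by (intro Bochner_Integration.integral_sum integrable_torus_continuous continuous_intros)
        finally show ?thesis by (simp only: integral_mult_right_zero fcoef_def[symmetric])
      qed
      also have "\<dots> = (\<Sum>k\<in>insert j X. if k = j then fcoef g k else 0)"
        by (intro sum.cong refl) (auto simp: fcoef_fchar)
      also have "\<dots> = fcoef g j" using X by (simp add: sum.delta)
      finally have P: "fcoef P j = fcoef g j" .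
      have "fcoef S j - fcoef P j = fcoef (\<lambda>x. S x - P x) j"
        unfolding fcoef_def left_diff_distrib
        by (subst Bochner_Integration.integral_diff)
           (auto intro!: integrable_torus_continuous continuous_intros contS contP)
      also have "cmod \<dots> \<le> e"
      proof (rule norm_fcoef_le)
        show "continuous_on UNIV (\<lambda>x. S x - P x)" by (intro continuous_intros contS contP)
        show "cmod (S x - P x) \<le> e" for x
          using *[rule_format, of "insert j X" x] X by (simp add: P_def dist_norm norm_minus_commute subset_insertI)
      qed
      finally show ?thesis using P by simp
    qed
    then have "cmod (fcoef S j - fcoef g j) \<le> 0" by (rule field_le_epsilon)
    then show ?thesis by simp
  qed
  have "g x - S x = 0"
  proof (rule eq_0_of_fcoef)
    show "continuous_on UNIV (\<lambda>x. g x - S x)" by (intro continuous_intros contS contg)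
    show "g (x + real_vec k) - S (x + real_vec k) = g x - S x" for x k
      by (simp add: test_fun_periodic[OF g] S_def fchar_periodic)
    show "fcoef (\<lambda>x. g x - S x) k = 0" for k
    proof -
      have "fcoef (\<lambda>x. g x - S x) k = fcoef g k - fcoef S k"
        unfolding fcoef_def left_diff_distrib
        by (subst Bochner_Integration.integral_diff)
           (auto intro!: integrable_torus_continuous continuous_intros contS contg)
      then show ?thesis by (simp add: S_coef)
    qed
  qed
  then show ?thesis
    using has_sum_infsum[OF sms[of x]] by (simp add: S_def)
qed

lemma eventually_finite_subsets_at_top_finite:
  "\<forall>\<^sub>F F in finite_subsets_at_top A. finite F"
  by (rule eventually_finite_subsets_at_top_weakI)

text \<open>The Fourier series of \<open>g\<close> converges to \<open>g\<close> in every seminorm,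
  since each derivative of \<open>g\<close> has the differentiated series as its own Fourier series.
  \<open>u\<close> annihilates the partial sums and is continuous.\<close>

lemma distribution_eq_0:
  fixes u :: "(real ^ 'n \<Rightarrow> complex) \<Rightarrow> complex"
  assumes u: "u \<in> distributions" and 0: "\<And>k. fourier_coeff u k = 0"
  shows "u g = 0"
proof (cases "g \<in> test_funs")
  case False
  then show ?thesis by (rule distributionsD(1)[OF u])
next
  case g: True
  obtain C m where C: "0 \<le> C" "\<And>g. g \<in> test_funs \<Longrightarrow> cmod (u g) \<le> C * seminorm m g"
    using u distributions_bound by metis
  define N where "N = real (card {js :: 'n list. length js \<le> m})"
  \<comment> \<open>The sign is built into the coefficients, so that the remainder of the series is
    the sum \<open>g + T F\<close> and the additivity clause of \<open>distributions\<close> applies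
    as it stands.\<close>
  define b where "b k = - fcoef g k" for k
  define T where "T F x = (\<Sum>k\<in>F. b k * fchar (- k) x)" for F and x :: "real ^ 'n"
  have T_test: "T F \<in> test_funs" if "finite F" for F
    unfolding T_def[abs_def] by (intro test_funs_sum that test_funs_scale fchar_test_fun)
  have uT: "u (T F) = 0" if "finite F" for F
    unfolding T_def[abs_def] using 0
    by (subst distribution_sum[OF u that])
       (auto intro!: test_funs_scale fchar_test_fun sum.neutral
         simp: distributionsD(3)[OF u fchar_test_fun] fourier_coeff_fchar)
  have derivT: "iter_deriv js (T F) x = - (\<Sum>k\<in>F. fcoef (iter_deriv js g) k * fchar (- k) x)"
    if "finite F" for F js x
  proof -
    have "iter_deriv js (T F) x = (\<Sum>k\<in>F. iter_deriv js (\<lambda>x. b k * fchar (- k) x) x)"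
      unfolding T_def[abs_def]
      by (subst iter_deriv_sum[OF that]) (auto intro!: test_funs_scale fchar_test_fun)
    also have "\<dots> = (\<Sum>k\<in>F. - (fcoef (iter_deriv js g) k * fchar (- k) x))"
      by (intro sum.cong refl)
         (simp only: iter_deriv_scale[OF fchar_test_fun] iter_deriv_fchar fcoef_iter_deriv[OF g], simp add: b_def mult_ac)
    finally show ?thesis by (simp add: sum_negf)
  qed
  have "cmod (u g) \<le> 0 + e" if e: "0 < e" for e
  proof -
    \<comment> \<open>\<open>N\<close> counts the derivative lists in the seminorm, so uniform
      errors below \<open>d\<close> give a total of at most
      \<open>C * N * d \<le> e\<close>.\<close>
    define d where "d = e / (C * N + 1)"
    have CN: "0 \<le> C * N" using C(1) by (simp add: N_def)
    have d: "0 < d" using e CN by (simp add: d_def)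
    \<comment> \<open>Only finitely many lists are involved, hence one finite set of frequencies
      serves all of them.\<close>
    have "\<forall>\<^sub>F F in finite_subsets_at_top UNIV. \<forall>js\<in>{js :: 'n list. length js \<le> m}.
       \<forall>x\<in>UNIV. dist (\<Sum>k\<in>F. fcoef (iter_deriv js g) k * fchar (- k) x) (iter_deriv js g x) < d"
    proof (rule eventually_ball_finite[OF finite_multiindices], rule ballI)
      fix js :: "'n list"
      have jg: "iter_deriv js g \<in> test_funs" by (rule test_funs_iter_deriv[OF g])
      have "uniform_limit UNIV (\<lambda>F x. \<Sum>k\<in>F. fcoef (iter_deriv js g) k * fchar (- k) x)
          (iter_deriv js g) (finite_subsets_at_top UNIV)"
        by (rule Weierstrass_m_test_general'[OF _ has_sum_fourier_series[OF jg]
              fcoef_weighted_summable[OF jg, of 0]]) (simp add: norm_mult)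
      from uniform_limitD[OF this d]
      show "\<forall>\<^sub>F F in finite_subsets_at_top UNIV.
         \<forall>x\<in>UNIV. dist (\<Sum>k\<in>F. fcoef (iter_deriv js g) k * fchar (- k) x) (iter_deriv js g x) < d" .
    qed
    from eventually_happens[OF eventually_conj[OF this eventually_finite_subsets_at_top_finite]]
    obtain F where F: "finite F" "\<And>js x. length js \<le> m \<Longrightarrow>
        dist (\<Sum>k\<in>F. fcoef (iter_deriv js g) k * fchar (- k) x) (iter_deriv js g x) < d"
      by auto
    have gT: "(\<lambda>x. g x + T F x) \<in> test_funs" by (intro test_funs_add g T_test F)
    have "seminorm m (\<lambda>x. g x + T F x) \<le> N * d"
      unfolding N_def
    proof (rule seminorm_le)
      fix js x assume "length (js :: 'n list) \<le> m"
      then show "cmod (iter_deriv js (\<lambda>x. g x + T F x) x) \<le> d"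
        using F(2)[of js x]
        by (simp add: iter_deriv_add[OF g T_test[OF F(1)]] derivT[OF F(1)] dist_norm norm_minus_commute)
    qed
    then have "C * seminorm m (\<lambda>x. g x + T F x) \<le> C * (N * d)"
      using C(1) by (rule mult_left_mono)
    moreover have "u (\<lambda>x. g x + T F x) = u g"
      by (simp add: distributionsD(2)[OF u g T_test[OF F(1)]] uT F)
    ultimately have "cmod (u g) \<le> C * N * d" using C(2)[OF gT] by simp
    also have "\<dots> \<le> e"
      unfolding d_def using CN e by (simp add: divide_simps mult_left_mono)
    finally show ?thesis by simp
  qed
  then have "cmod (u g) \<le> 0" by (rule field_le_epsilon)
  then show ?thesis by simp
qed

lemma fourier_coeff_diff: "fourier_coeff (u - v) k = fourier_coeff u k - fourier_coeff v k"
  by (simp add: fourier_coeff_def)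

theorem distribution_eqI:
  assumes "u \<in> distributions" "v \<in> distributions" "\<And>k. fourier_coeff u k = fourier_coeff v k"
  shows "u = v"
proof
  fix g
  have "(u - v) g = 0"
    by (rule distribution_eq_0[OF distributions_diff[OF assms(1,2)]])
       (simp add: fourier_coeff_diff assms(3))
  then show "u g = v g" by simp
qed

text \<open>The formula for \<open>v\<close> is forced by applying a distribution termwise to the
  series of \<open>fcoef g k * fchar (- k)\<close>, which accounts for \<open>a (- k)\<close>. Rapid
  decay of the coefficients of a test function gives convergence, and the same estimate gives
  continuity.\<close>

theorem distribution_of_coeffs:
  fixes a :: "int ^ 'n \<Rightarrow> complex"
  assumes a: "\<And>k. cmod (a k) \<le> C * jap k ^ m"
  obtains v where "v \<in> distributions" "\<And>k. fourier_coeff v k = a k"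
proof
  define v where "v g = (if g \<in> test_funs then \<Sum>\<^sub>\<infinity>k. a (- k) * fcoef g k else 0)" for g
  define K where "K = (real CARD('n) + 1) ^ (m + CARD('n))"
  have jm: "jap (- k) = jap k" for k :: "int ^ 'n" by (simp add: jap_def)
  have bnd: "cmod (a (- k) * fcoef g k) \<le> C * (jap k ^ m * cmod (fcoef g k))" for k g
    using mult_right_mono[OF a[of "- k"], of "cmod (fcoef g k)"] by (simp add: norm_mult jm mult.assoc)
  have sm: "(\<lambda>k. a (- k) * fcoef g k) summable_on UNIV" if "g \<in> test_funs" for g
    by (rule norm_summable_on_comparison(2)[OF summable_on_cmult_right[OF fcoef_weighted_summable[OF that]] bnd])
  \<comment> \<open>Read off at the zero frequency, where \<open>jap\<close> is 1.\<close>
  have C: "0 \<le> C"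
    using order_trans[OF norm_ge_zero a[of 0]] by (simp add: jap_def)
  have lin: "fcoef (\<lambda>x. g x + h x) k = fcoef g k + fcoef h k"
    if "g \<in> test_funs" "h \<in> test_funs" for g h and k :: "int ^ 'n"
    unfolding fcoef_def distrib_right
    by (intro Bochner_Integration.integral_add integrable_torus_continuous continuous_intros
        test_fun_continuous that)
  have scale: "fcoef (\<lambda>x. c * g x) k = c * fcoef g k" for g c and k :: "int ^ 'n"
    by (simp add: fcoef_def mult.assoc)
  show "v \<in> distributions"
  proof (rule distributionsI)
    fix g h :: "real ^ 'n \<Rightarrow> complex" assume g: "g \<in> test_funs" and h: "h \<in> test_funs"
    then show "v (\<lambda>x. g x + h x) = v g + v h"
      by (simp add: v_def test_funs_add lin distrib_left infsum_add sm)
  next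
    fix g :: "real ^ 'n \<Rightarrow> complex" and c assume g: "g \<in> test_funs"
    then show "v (\<lambda>x. c * g x) = c * v g"
      by (simp add: v_def test_funs_scale scale infsum_cmult_right[OF sm[OF g], symmetric] mult.left_commute)
  next
    fix g :: "real ^ 'n \<Rightarrow> complex" assume g: "g \<in> test_funs"
    let ?b = "\<lambda>k :: int ^ 'n. 1 / jap k ^ (2 * CARD('n))"
    let ?s = "seminorm (2 * (m + CARD('n))) g"
    have "cmod (infsum (\<lambda>k. a (- k) * fcoef g k) UNIV) \<le> C * K * ?s * infsum ?b UNIV"
    proof (rule norm_infsum_le[OF has_sum_infsum[OF sm[OF g]]])
      show "((\<lambda>k. C * K * ?s * ?b k) has_sum (C * K * ?s * infsum ?b UNIV)) UNIV"
        by (intro has_sum_cmult_right has_sum_infsum summable_on_jap)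
      fix k
      have "C * (jap k ^ m * cmod (fcoef g k)) \<le> C * (K * ?s * ?b k)"
        unfolding K_def by (rule mult_left_mono[OF fcoef_weighted_bound[OF g] C])
      then show "cmod (a (- k) * fcoef g k) \<le> C * K * ?s * ?b k"
        using bnd[of k g] by (simp only: mult.assoc)
    qed
    also have "infsum (\<lambda>k. a (- k) * fcoef g k) UNIV = v g" by (simp only: v_def if_P[OF g])
    finally show "cmod (v g) \<le> (C * K * infsum ?b UNIV) * ?s" by (simp only: mult_ac)
  qed (simp add: v_def)
  show "fourier_coeff v j = a j" for j
  proof -
    have "fourier_coeff v j = (\<Sum>\<^sub>\<infinity>k. if k = - j then a j else 0)"
      unfolding fourier_coeff_fchar v_def if_P[OF fchar_test_fun]
      by (intro infsum_cong) (auto simp: fcoef_fchar eq_neg_iff_add_eq_0 add.commute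
          dest: minus_unique)
    also have "\<dots> = (\<Sum>\<^sub>\<infinity>k\<in>{- j}. a j)"
      by (rule infsum_cong_neutral) auto
    finally show ?thesis by simp
  qed
qed

section \<open>Fourier multipliers and distributions given by functions\<close>

lemma fourier_mult_eqI:
  assumes "v \<in> distributions" "\<And>k. fourier_coeff v k = of_real (\<omega> k) * fourier_coeff u k"
  shows "fourier_mult \<omega> u = v"
  unfolding fourier_mult_def
  by (rule the_equality) (use assms in \<open>auto intro: distribution_eqI\<close>)

lemma fourier_mult:
  assumes "in_mult_domain \<omega> u"
  shows "fourier_mult \<omega> u \<in> distributions"
    and "fourier_coeff (fourier_mult \<omega> u) k = of_real (\<omega> k) * fourier_coeff u k"
proof -
  obtain v where v: "v \<in> distributions" "\<And>k. fourier_coeff v k = of_real (\<omega> k) * fourier_coeff u k"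
    using assms by (auto simp: in_mult_domain_def)
  with fourier_mult_eqI[OF v]
  show "fourier_mult \<omega> u \<in> distributions"
    "fourier_coeff (fourier_mult \<omega> u) k = of_real (\<omega> k) * fourier_coeff u k" by auto
qed

text \<open>The bound concerns the product of multiplier and coefficient, not the multiplier alone:
  a weight may grow arbitrarily at frequencies not perpendicular to \<open>A\<close>, where the
  coefficients of Radon data vanish.\<close>

lemma in_mult_domain_poly_bound:
  assumes "\<And>k. \<bar>\<omega> k\<bar> * cmod (fourier_coeff u k) \<le> C * jap k ^ m"
  shows "in_mult_domain \<omega> u"
proof -
  obtain v where "v \<in> distributions" "\<And>k. fourier_coeff v k = of_real (\<omega> k) * fourier_coeff u k"
    using distribution_of_coeffs[of "\<lambda>k. of_real (\<omega> k) * fourier_coeff u k" C m] assms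
    by (auto simp: norm_mult)
  then show ?thesis by (auto simp: in_mult_domain_def)
qed

lemma in_mult_domain_poly_mult:
  assumes "u \<in> distributions" "\<And>k. \<bar>\<omega> k\<bar> \<le> B * jap k ^ l"
  shows "in_mult_domain \<omega> u"
proof -
  obtain C m where C: "0 \<le> C" "\<And>k. cmod (fourier_coeff u k) \<le> C * jap k ^ m"
    using fourier_coeff_poly_bound[OF assms(1)] by metis
  show ?thesis
  proof (rule in_mult_domain_poly_bound)
    fix k
    have "\<bar>\<omega> k\<bar> * cmod (fourier_coeff u k) \<le> (B * jap k ^ l) * (C * jap k ^ m)"
      using assms(2)[of k] C by (intro mult_mono) auto
    then show "\<bar>\<omega> k\<bar> * cmod (fourier_coeff u k) \<le> (B * C) * jap k ^ (l + m)"
      by (simp add: power_add mult_ac)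
  qed
qed

text \<open>For negative \<open>s\<close> the exponent on the right is truncated to 0, which is
  still sufficient because \<open>jap k\<close> is at least 1.\<close>

lemma jap_powr_le_power: "jap k powr s \<le> jap k ^ nat \<lceil>s\<rceil>"
proof -
  have "jap k powr s \<le> jap k powr real (nat \<lceil>s\<rceil>)"
    using jap_ge_1[of k] by (intro powr_mono) linarith+
  then show ?thesis using jap_pos[of k] by (simp add: powr_realpow)
qed

lemma bessel_pot:
  assumes "u \<in> distributions"
  shows "bessel_pot s u \<in> distributions"
    and "fourier_coeff (bessel_pot s u) k = of_real (jap k powr s) * fourier_coeff u k"
proof -
  have "in_mult_domain (\<lambda>k. jap k powr s) u"
  proof (rule in_mult_domain_poly_mult[OF assms])
    fix k :: "int ^ 'a"
    show "\<bar>jap k powr s\<bar> \<le> 1 * jap k ^ nat \<lceil>s\<rceil>"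
      using jap_powr_le_power[of k s] by simp
  qed
  then show "bessel_pot s u \<in> distributions"
    "fourier_coeff (bessel_pot s u) k = of_real (jap k powr s) * fourier_coeff u k"
    unfolding bessel_pot_def by (auto intro: fourier_mult)
qed

lemma represents_distribution:
  assumes "represents h u"
  shows "u \<in> distributions"
proof -
  have h: "integrable torus h" and u: "u = (\<lambda>g. if g \<in> test_funs then (LINT x|torus. h x * g x) else 0)"
    using assms by (auto simp: represents_def)
  note int = integrable_torus_mult[OF h test_fun_continuous]
  show ?thesis
  proof (rule distributionsI[where C = "LINT x|torus. cmod (h x)" and m = 0])
    fix g :: "real ^ 'a \<Rightarrow> complex" assume g: "g \<in> test_funs"
    have "cmod (LINT x|torus. h x * g x) \<le> (LINT x|torus. cmod (h x * g x))"
      by (rule integral_norm_bound)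
    also have "\<dots> \<le> (LINT x|torus. cmod (h x) * seminorm 0 g)"
    proof (rule integral_mono)
      show "integrable torus (\<lambda>x. cmod (h x * g x))" using int[OF g] by (rule integrable_norm)
    qed (use iter_deriv_le_seminorm[OF g, of "[]" 0] h in \<open>auto simp: norm_mult intro!: mult_left_mono\<close>)
    also have "\<dots> = (LINT x|torus. cmod (h x)) * seminorm 0 g" using h by simp
    finally show "cmod (u g) \<le> (LINT x|torus. cmod (h x)) * seminorm 0 g" by (simp add: u g)
  qed (auto simp: u test_funs_add test_funs_scale distrib_left int mult.left_commute)
qed

lemma represents_fourier_coeff: "represents h u \<Longrightarrow> fourier_coeff u k = fcoef h k"
  by (simp add: represents_def fourier_coeff_fchar fcoef_def fchar_test_fun)

text \<open>Integration against \<open>h\<close> defines a distribution with the same coefficients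
  as \<open>u\<close>, and distributions are determined by their coefficients.\<close>

lemma representsI:
  assumes h: "integrable torus h" and u: "u \<in> distributions" and eq: "\<And>k. fcoef h k = fourier_coeff u k"
  shows "represents h u"
proof -
  have "represents h (\<lambda>g. if g \<in> test_funs then (LINT x|torus. h x * g x) else 0)" (is "represents h ?v")
    using h by (simp add: represents_def)
  moreover from this have "?v = u"
    by (intro distribution_eqI represents_distribution u) (auto simp: represents_fourier_coeff eq)
  ultimately show ?thesis by simp
qed

lemma fcoef_diff:
  assumes "integrable torus f" "integrable torus g"
  shows "fcoef (\<lambda>x. f x - g x) k = fcoef f k - fcoef g k"
  unfolding fcoef_def left_diff_distrib
  by (intro Bochner_Integration.integral_diff integrable_torus_mult assms continuous_fchar)

lemma fcoef_unique:
  assumes "integrable torus f" "integrable torus g" "\<And>k. fcoef f k = fcoef g k"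
  shows "AE x in torus. f x = g x"
proof -
  have "AE x in torus. f x - g x = 0"
    using assms by (intro AE_eq_0_of_fcoef) (auto simp: fcoef_diff)
  then show ?thesis by eventually_elim simp
qed

section \<open>Parseval's identity and Sobolev norms\<close>

definition square_integrable :: "(real ^ 'n \<Rightarrow> complex) \<Rightarrow> bool"
  where "square_integrable h \<longleftrightarrow> h \<in> borel_measurable torus \<and> integrable torus (\<lambda>x. (cmod (h x))\<^sup>2)"

lemma square_integrable_integrable: "square_integrable h \<Longrightarrow> integrable torus h"
proof -
  assume h: "square_integrable h"
  then have [measurable]: "h \<in> borel_measurable torus" by (simp add: square_integrable_def)
  have "integrable torus (\<lambda>x. 1 + (cmod (h x))\<^sup>2)"
    using h by (auto simp: square_integrable_def intro!: Bochner_Integration.integrable_add)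
  then show "integrable torus h"
  proof (rule Bochner_Integration.integrable_bound)
    have "t \<le> 1 + t\<^sup>2" for t :: real
      using zero_le_power2[of "t - 1"] sum_power2_ge_zero[of t 1] by (simp add: power2_diff) (smt (verit) zero_le_power2)
    then show "AE x in torus. cmod (h x) \<le> norm (1 + (cmod (h x))\<^sup>2)"
      by (intro AE_I2) (simp add: abs_of_nonneg)
  qed simp
qed

lemma square_integrable_continuous: "continuous_on UNIV h \<Longrightarrow> square_integrable h"
  unfolding square_integrable_def
  by (intro conjI measurable_torus_continuous integrable_torus_continuous continuous_intros)

lemma square_integrable_prod:
  assumes "square_integrable f" "square_integrable g"
  shows "integrable torus (\<lambda>x. f x * cnj (g x))"
proof -
  have [measurable]: "f \<in> borel_measurable torus" "g \<in> borel_measurable torus"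
    using assms by (auto simp: square_integrable_def)
  have "integrable torus (\<lambda>x. (cmod (f x))\<^sup>2 + (cmod (g x))\<^sup>2)"
    using assms by (auto simp: square_integrable_def)
  then show ?thesis
  proof (rule Bochner_Integration.integrable_bound)
    have "s * t \<le> s\<^sup>2 + t\<^sup>2" if "0 \<le> s" "0 \<le> t" for s t :: real
      using zero_le_power2[of "s - t"] mult_nonneg_nonneg[OF that] by (simp add: power2_diff)
    then show "AE x in torus. norm (f x * cnj (g x)) \<le> norm ((cmod (f x))\<^sup>2 + (cmod (g x))\<^sup>2)"
      by (intro AE_I2) (simp add: norm_mult)
    have "(\<lambda>x. cnj (g x)) \<in> borel_measurable torus"
      by (rule measurable_compose[OF _ borel_measurable_continuous_onI[OF continuous_on_cnj[OF continuous_on_id]]])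
         measurable
    then show "(\<lambda>x. f x * cnj (g x)) \<in> borel_measurable torus" by measurable
  qed
qed

lemma square_integrable_add:
  assumes "square_integrable f" "square_integrable g"
  shows "square_integrable (\<lambda>x. f x + c * g x)"
proof -
  have [measurable]: "f \<in> borel_measurable torus" "g \<in> borel_measurable torus"
    using assms by (auto simp: square_integrable_def)
  have "integrable torus (\<lambda>x. 2 * (cmod (f x))\<^sup>2 + 2 * (cmod c)\<^sup>2 * (cmod (g x))\<^sup>2)"
    using assms by (auto simp: square_integrable_def)
  then have "integrable torus (\<lambda>x. (cmod (f x + c * g x))\<^sup>2)"
  proof (rule Bochner_Integration.integrable_bound)
    have "(cmod (z + c * y))\<^sup>2 \<le> 2 * (cmod z)\<^sup>2 + 2 * (cmod c)\<^sup>2 * (cmod y)\<^sup>2" for z y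
    proof -
      have "(cmod (z + c * y))\<^sup>2 \<le> (cmod z + cmod c * cmod y)\<^sup>2"
        using norm_triangle_ineq[of z "c * y"] by (intro power_mono) (auto simp: norm_mult)
      also have "\<dots> \<le> 2 * (cmod z)\<^sup>2 + 2 * (cmod c * cmod y)\<^sup>2"
        using zero_le_power2[of "cmod z - cmod c * cmod y"] unfolding power2_sum power2_diff by simp
      finally show ?thesis by (simp add: power_mult_distrib)
    qed
    then show "AE x in torus. norm ((cmod (f x + c * g x))\<^sup>2)
        \<le> norm (2 * (cmod (f x))\<^sup>2 + 2 * (cmod c)\<^sup>2 * (cmod (g x))\<^sup>2)"
      by (intro AE_I2) simp
  qed measurable
  then show ?thesis by (simp add: square_integrable_def)
qed

text \<open>The sign in \<open>fchar (- k)\<close> makes \<open>a k\<close> the \<open>k\<close>-th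
  coefficient in the sense of \<open>fcoef\<close>.\<close>

definition tpoly :: "(int ^ 'n \<Rightarrow> complex) \<Rightarrow> (int ^ 'n) set \<Rightarrow> real ^ 'n \<Rightarrow> complex"
  where "tpoly a F x = (\<Sum>k\<in>F. a k * fchar (- k) x)"

lemma continuous_tpoly: "continuous_on S (tpoly a F)"
  unfolding tpoly_def[abs_def] by (intro continuous_intros)

lemma cnj_tpoly: "cnj (tpoly a F x) = (\<Sum>k\<in>F. cnj (a k) * fchar k x)"
  by (simp add: tpoly_def cnj_fchar)

lemma integral_mult_cnj_tpoly:
  assumes h: "integrable torus h"
  shows "(LINT x|torus. h x * cnj (tpoly a F x)) = (\<Sum>k\<in>F. cnj (a k) * fcoef h k)"
proof -
  have "(LINT x|torus. h x * cnj (tpoly a F x)) = (LINT x|torus. (\<Sum>k\<in>F. cnj (a k) * (h x * fchar k x)))"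
    by (simp add: cnj_tpoly sum_distrib_left mult.left_commute)
  also have "\<dots> = (\<Sum>k\<in>F. LINT x|torus. cnj (a k) * (h x * fchar k x))"
    by (intro Bochner_Integration.integral_sum integrable_mult_right integrable_torus_mult[OF h] continuous_fchar)
  finally show ?thesis by (simp add: fcoef_def)
qed

lemma fcoef_tpoly:
  assumes "finite F"
  shows "fcoef (tpoly a F) k = (if k \<in> F then a k else 0)"
proof -
  have "fcoef (tpoly a F) k = (LINT x|torus. (\<Sum>j\<in>F. a j * (fchar (- j) x * fchar k x)))"
    by (simp add: fcoef_def tpoly_def sum_distrib_right mult.assoc)
  also have "\<dots> = (\<Sum>j\<in>F. LINT x|torus. a j * (fchar (- j) x * fchar k x))"
    by (intro Bochner_Integration.integral_sum integrable_torus_continuous continuous_intros)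
  also have "\<dots> = (\<Sum>j\<in>F. if j = k then a j else 0)"
    by (intro sum.cong refl) (auto simp: fchar_mult integral_fchar)
  also have "\<dots> = (if k \<in> F then a k else 0)" using assms by simp
  finally show ?thesis .
qed

lemma integral_norm2_tpoly:
  assumes "finite F"
  shows "(LINT x|torus. (cmod (tpoly a F x))\<^sup>2) = (\<Sum>k\<in>F. (cmod (a k))\<^sup>2)"
proof -
  have "complex_of_real (LINT x|torus. (cmod (tpoly a F x))\<^sup>2)
      = (LINT x|torus. tpoly a F x * cnj (tpoly a F x))"
    unfolding integral_complex_of_real[symmetric] complex_norm_square ..
  also have "\<dots> = (\<Sum>k\<in>F. cnj (a k) * fcoef (tpoly a F) k)"
    by (intro integral_mult_cnj_tpoly integrable_torus_continuous continuous_tpoly)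
  also have "\<dots> = complex_of_real (\<Sum>k\<in>F. (cmod (a k))\<^sup>2)"
    unfolding of_real_sum
    unfolding complex_norm_square
    by (intro sum.cong refl) (simp add: fcoef_tpoly[OF assms] mult.commute)
  finally show ?thesis by (simp only: of_real_eq_iff)
qed

text \<open>Expand the nonnegative integral of the squared modulus of \<open>h - ?P\<close>. The
  cross term and the square of \<open>?P\<close> both integrate to \<open>?s\<close>.\<close>

lemma bessel_inequality:
  assumes h: "square_integrable h" and F: "finite F"
  shows "(\<Sum>k\<in>F. (cmod (fcoef h k))\<^sup>2) \<le> (LINT x|torus. (cmod (h x))\<^sup>2)"
proof -
  let ?P = "tpoly (fcoef h) F" and ?s = "\<Sum>k\<in>F. (cmod (fcoef h k))\<^sup>2"
  note hi = square_integrable_integrable[OF h]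
  have P: "square_integrable ?P" by (intro square_integrable_continuous continuous_tpoly)
  have i1: "integrable torus (\<lambda>x. (cmod (h x))\<^sup>2)" using h by (simp add: square_integrable_def)
  have i2: "integrable torus (\<lambda>x. Re (h x * cnj (?P x)))"
    using square_integrable_prod[OF h P] by (rule integrable_Re)
  have i3: "integrable torus (\<lambda>x. (cmod (?P x))\<^sup>2)" using P by (simp add: square_integrable_def)
  have "(LINT x|torus. h x * cnj (?P x)) = complex_of_real ?s"
    unfolding integral_mult_cnj_tpoly[OF hi] of_real_sum complex_norm_square
    by (intro sum.cong refl) (simp add: mult.commute)
  then have "(LINT x|torus. Re (h x * cnj (?P x))) = ?s"
    using integral_Re[OF square_integrable_prod[OF h P]] by simp
  moreover have "0 \<le> (LINT x|torus. (cmod (h x - ?P x))\<^sup>2)"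
    by (intro Bochner_Integration.integral_nonneg) simp
  moreover have "(LINT x|torus. (cmod (h x - ?P x))\<^sup>2)
      = (LINT x|torus. (cmod (h x))\<^sup>2 - 2 * Re (h x * cnj (?P x)) + (cmod (?P x))\<^sup>2)"
    by (intro Bochner_Integration.integral_cong refl) (simp add: cmod_power2 power2_diff)
  moreover have "\<dots> = (LINT x|torus. (cmod (h x))\<^sup>2) - 2 * (LINT x|torus. Re (h x * cnj (?P x)))
      + (LINT x|torus. (cmod (?P x))\<^sup>2)"
    by (simp only: Bochner_Integration.integral_add Bochner_Integration.integral_diff i1 i2 i3
        Bochner_Integration.integrable_diff integrable_mult_right integral_mult_right_zero)
  ultimately show ?thesis using integral_norm2_tpoly[OF F, of "fcoef h"] by simp
qed

text \<open>
  The partial sums over a sequence of finite sets whose tails decrease geometrically converge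
  absolutely almost everywhere; Fatou's lemma bounds the norm of the limit.
\<close>

lemma riesz_fischer:
  fixes a :: "int ^ 'n \<Rightarrow> complex"
  assumes a: "(\<lambda>k. (cmod (a k))\<^sup>2) summable_on UNIV"
  obtains h where "integrable torus h" "\<And>k. fcoef h k = a k"
    "(\<integral>\<^sup>+x. ennreal ((cmod (h x))\<^sup>2) \<partial>torus) \<le> ennreal (\<Sum>\<^sub>\<infinity>k. (cmod (a k))\<^sup>2)"
proof -
  define s where "s k = (cmod (a k))\<^sup>2" for k
  define T where "T = infsum s UNIV"
  have s: "(s has_sum T) UNIV" unfolding T_def s_def[abs_def] using a by simp
  have sum_le: "sum s F \<le> T" if "finite F" for F
    using finite_sum_le_has_sum[OF s that] by (auto simp: s_def)
  have "\<exists>X. finite X \<and> T - sum s X \<le> (1 / 4) ^ n" for n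
    using has_sum_finite_approximation[OF s, of "(1 / 4) ^ n"] by (auto simp: dist_real_def)
  then obtain X where X: "\<And>n. finite (X n)" "\<And>n. T - sum s (X n) \<le> (1 / 4) ^ n" by metis
  \<comment> \<open>Unions make the sets increase. The index is shifted by one, so that
    \<open>X n\<close> enters with \<open>G (Suc n)\<close> and \<open>G 0\<close> is empty.\<close>
  define G where "G n = (\<Union>i<n. X i)" for n
  have G: "finite (G n)" "G n \<subseteq> G (Suc n)" for n
    unfolding G_def lessThan_Suc using X(1) by auto
  have tail: "T - sum s (G (Suc n)) \<le> (1 / 4) ^ n" for n
  proof -
    have "sum s (X n) \<le> sum s (G (Suc n))"
      using G(1) by (intro sum_mono2) (auto simp: G_def s_def)
    then show ?thesis using X(2)[of n] by simp
  qed
  define D where "D n = tpoly a (G (Suc n) - G n)" for n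
  have contD: "continuous_on UNIV (D n)" for n unfolding D_def by (rule continuous_tpoly)
  have intD: "integrable torus (D n)" for n by (rule integrable_torus_continuous[OF contD])
  have [measurable]: "D n \<in> borel_measurable torus" for n by (rule measurable_torus_continuous[OF contD])
  have sumD: "(\<Sum>i<n. D i x) = tpoly a (G n) x" for n x
  proof (induction n)
    case (Suc n)
    have "tpoly a (G (Suc n)) x = tpoly a (G (Suc n) - G n) x + tpoly a (G n) x"
      unfolding tpoly_def by (rule sum.subset_diff[OF G(2) G(1)])
    then show ?case using Suc by (simp add: D_def)
  qed (simp add: G_def tpoly_def)
  have L1: "(LINT x|torus. cmod (D (Suc n) x)) \<le> (1 / 2) ^ n" for n
  proof -
    have "(LINT x|torus. (cmod (D (Suc n) x))\<^sup>2) = sum s (G (Suc (Suc n)) - G (Suc n))"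
      unfolding D_def s_def by (rule integral_norm2_tpoly) (use G in auto)
    also have "\<dots> = sum s (G (Suc (Suc n))) - sum s (G (Suc n))"
      by (rule sum_diff[OF G(1) G(2)])
    also have "\<dots> \<le> (1 / 4) ^ n" using tail[of n] sum_le[OF G(1), of "Suc (Suc n)"] by simp
    finally have *: "(LINT x|torus. (cmod (D (Suc n) x))\<^sup>2) \<le> (1 / 4) ^ n" .
    \<comment> \<open>The weight \<open>2 ^ n\<close> balances the squared norm, of size
      \<open>(1 / 4) ^ n\<close>, against the unit mass of the torus; both terms become
      \<open>(1 / 2) ^ n\<close>.\<close>
    have am_gm: "t \<le> (2 ^ n * t\<^sup>2 + (1 / 2) ^ n) / 2" for t :: real
    proof -
      have "0 \<le> (2 ^ n * t - 1)\<^sup>2" by simp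
      then have "2 * (2 ^ n * t) \<le> 2 ^ n * (2 ^ n * t\<^sup>2) + 1"
        by (simp add: power2_eq_square algebra_simps)
      then have "2 ^ n * (2 * t) \<le> 2 ^ n * (2 ^ n * t\<^sup>2 + (1 / 2) ^ n)"
        by (simp add: distrib_left power_divide mult_ac)
      then show ?thesis by (simp add: mult_le_cancel_left_pos)
    qed
    have i2: "integrable torus (\<lambda>x. (cmod (D (Suc n) x))\<^sup>2)"
      by (intro integrable_torus_continuous continuous_intros contD)
    have "(LINT x|torus. cmod (D (Suc n) x))
        \<le> (LINT x|torus. (2 ^ n * (cmod (D (Suc n) x))\<^sup>2 + (1 / 2) ^ n) / 2)"
      using i2 by (intro integral_mono integrable_norm intD am_gm)
        (auto intro!: Bochner_Integration.integrable_add)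
    also have "\<dots> = (2 ^ n * (LINT x|torus. (cmod (D (Suc n) x))\<^sup>2) + (1 / 2) ^ n) / 2"
      using i2 by simp
    also have "\<dots> \<le> (2 ^ n * (1 / 4) ^ n + (1 / 2) ^ n) / 2"
      using * by (intro divide_right_mono add_right_mono mult_left_mono) auto
    also have "(2 :: real) ^ n * (1 / 4) ^ n = (1 / 2) ^ n"
      by (simp flip: power_mult_distrib)
    finally show ?thesis by simp
  qed
  have "summable (\<lambda>n. LINT x|torus. cmod (D (Suc n) x))"
  proof (rule summable_comparison_test')
    show "summable (\<lambda>n. (1 / 2 :: real) ^ n)" by (simp add: summable_geometric)
    show "norm (LINT x|torus. cmod (D (Suc n) x)) \<le> (1 / 2) ^ n" for n
      using L1[of n] Bochner_Integration.integral_nonneg[of torus "\<lambda>x. cmod (D (Suc n) x)"] by simp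
  qed
  then have sm: "summable (\<lambda>n. LINT x|torus. cmod (D n x))" by (subst (asm) summable_Suc_iff)
  have "(\<integral>\<^sup>+x. (\<Sum>n. ennreal (cmod (D n x))) \<partial>torus) = (\<Sum>n. \<integral>\<^sup>+x. ennreal (cmod (D n x)) \<partial>torus)"
    by (rule nn_integral_suminf) measurable
  also have "\<dots> = (\<Sum>n. ennreal (LINT x|torus. cmod (D n x)))"
    by (intro suminf_cong nn_integral_eq_integral integrable_norm intD AE_I2) simp
  also have "\<dots> = ennreal (\<Sum>n. LINT x|torus. cmod (D n x))"
    by (intro suminf_ennreal2 sm Bochner_Integration.integral_nonneg) simp
  finally have "(\<integral>\<^sup>+x. (\<Sum>n. ennreal (cmod (D n x))) \<partial>torus) \<noteq> \<infinity>" by simp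
  then have "AE x in torus. (\<Sum>n. ennreal (cmod (D n x))) \<noteq> \<infinity>"
    by (intro nn_integral_noteq_infinite) measurable
  then have AEs: "AE x in torus. summable (\<lambda>n. cmod (D n x))"
    by eventually_elim (auto intro: summable_suminf_not_top)
  define h where "h x = (\<Sum>n. D n x)" for x
  have hi: "integrable torus h"
    unfolding h_def[abs_def] by (rule integrable_suminf[OF intD AEs sm])
  have [measurable]: "h \<in> borel_measurable torus" using hi by auto
  have fc: "fcoef h k = a k" for k
  proof -
    have "(\<lambda>n. LINT x|torus. D n x * fchar k x) sums (LINT x|torus. (\<Sum>n. D n x * fchar k x))"
      by (rule sums_integral) (use AEs sm in \<open>simp_all add: norm_mult integrable_torus_mult[OF intD] continuous_fchar\<close>)
    also have "(LINT x|torus. (\<Sum>n. D n x * fchar k x)) = fcoef h k"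
      unfolding fcoef_def
    proof (rule integral_cong_AE)
      have [measurable]: "fchar k \<in> borel_measurable torus"
        by (intro measurable_torus_continuous continuous_fchar)
      show "(\<lambda>x. \<Sum>n. D n x * fchar k x) \<in> borel_measurable torus" by measurable
      show "(\<lambda>x. h x * fchar k x) \<in> borel_measurable torus" by measurable
      show "AE x in torus. (\<Sum>n. D n x * fchar k x) = h x * fchar k x"
        using AEs
        by eventually_elim (simp add: h_def suminf_mult2[symmetric] summable_norm_cancel)
    qed
    finally have "(\<lambda>n. \<Sum>i<n. LINT x|torus. D i x * fchar k x) \<longlonglongrightarrow> fcoef h k"
      by (simp add: sums_def)
    moreover have "(\<Sum>i<n. LINT x|torus. D i x * fchar k x) = (if k \<in> G n then a k else 0)" for n
    proof -
      have "(\<Sum>i<n. LINT x|torus. D i x * fchar k x) = (LINT x|torus. (\<Sum>i<n. D i x * fchar k x))"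
        by (intro Bochner_Integration.integral_sum[symmetric] integrable_torus_mult[OF intD] continuous_fchar)
      also have "\<dots> = fcoef (tpoly a (G n)) k"
        by (simp add: fcoef_def sumD sum_distrib_right[symmetric])
      finally show ?thesis by (simp add: fcoef_tpoly[OF G(1)])
    qed
    ultimately have 1: "(\<lambda>n. if k \<in> G n then a k else 0) \<longlonglongrightarrow> fcoef h k" by simp
    have 2: "(\<lambda>n. if k \<in> G n then a k else 0) \<longlonglongrightarrow> a k"
    proof (cases "\<exists>m. k \<in> G m")
      case True
      then obtain m where m: "k \<in> G m" by blast
      have "G m \<subseteq> G n" if "m \<le> n" for n using that unfolding G_def by (intro UN_mono) auto
      then have "\<forall>\<^sub>F n in sequentially. (if k \<in> G n then a k else 0) = a k"
        using m unfolding eventually_sequentially by (intro exI[of _ m]) auto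
      then show ?thesis by (rule tendsto_eventually)
    next
      \<comment> \<open>A frequency missed by every \<open>G n\<close> must have coefficient zero,
        since its square can be added to each partial sum without exceeding \<open>T\<close> and is
        therefore bounded by every tail.\<close>
      case False
      have "s k \<le> (1 / 4) ^ n" for n
      proof -
        have "sum s (insert k (G (Suc n))) \<le> T" using G(1) by (intro sum_le) auto
        then show ?thesis using False G(1) tail[of n] by simp
      qed
      moreover have "(\<lambda>n. (1 / 4 :: real) ^ n) \<longlonglongrightarrow> 0" by (simp add: LIMSEQ_realpow_zero)
      ultimately have "s k \<le> 0" by (intro LIMSEQ_le_const) auto
      then have "a k = 0" by (simp add: s_def)
      then show ?thesis using False by simp
    qed
    show ?thesis using LIMSEQ_unique[OF 1 2] .
  qed
  have "(\<integral>\<^sup>+x. ennreal ((cmod (h x))\<^sup>2) \<partial>torus)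
      = (\<integral>\<^sup>+x. liminf (\<lambda>n. ennreal ((cmod (tpoly a (G n) x))\<^sup>2)) \<partial>torus)"
  proof (rule nn_integral_cong_AE)
    show "AE x in torus. ennreal ((cmod (h x))\<^sup>2) = liminf (\<lambda>n. ennreal ((cmod (tpoly a (G n) x))\<^sup>2))"
      using AEs
    proof eventually_elim
      case (elim x)
      then have "(\<lambda>n. D n x) sums h x"
        unfolding h_def by (rule summable_sums[OF summable_norm_cancel])
      then have "(\<lambda>n. tpoly a (G n) x) \<longlonglongrightarrow> h x" by (simp add: sums_def sumD)
      then have "(\<lambda>n. ennreal ((cmod (tpoly a (G n) x))\<^sup>2)) \<longlonglongrightarrow> ennreal ((cmod (h x))\<^sup>2)"
        by (intro tendsto_ennrealI tendsto_intros)
      then show ?case by (rule lim_imp_Liminf[OF sequentially_bot, symmetric])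
    qed
  qed
  also have "\<dots> \<le> liminf (\<lambda>n. \<integral>\<^sup>+x. ennreal ((cmod (tpoly a (G n) x))\<^sup>2) \<partial>torus)"
  proof (rule nn_integral_liminf)
    have [measurable]: "tpoly a (G n) \<in> borel_measurable torus" for n
      by (intro measurable_torus_continuous continuous_tpoly)
    show "(\<lambda>x. ennreal ((cmod (tpoly a (G n) x))\<^sup>2)) \<in> borel_measurable torus" for n by measurable
  qed
  also have "\<dots> = liminf (\<lambda>n. ennreal (sum s (G n)))"
  proof -
    have "(\<integral>\<^sup>+x. ennreal ((cmod (tpoly a (G n) x))\<^sup>2) \<partial>torus) = ennreal (sum s (G n))" for n
      unfolding s_def integral_norm2_tpoly[OF G(1), symmetric]
      by (intro nn_integral_eq_integral integrable_torus_continuous continuous_intros continuous_tpoly AE_I2) simp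
    then show ?thesis by simp
  qed
  also have "\<dots> \<le> ennreal T"
    by (intro Liminf_le always_eventually allI ennreal_leI sum_le G) simp
  finally have "(\<integral>\<^sup>+x. ennreal ((cmod (h x))\<^sup>2) \<partial>torus) \<le> ennreal T" .
  then show ?thesis
    using that[OF hi fc] unfolding T_def s_def[abs_def] by simp
qed

lemma square_integrable_nn:
  assumes [measurable]: "h \<in> borel_measurable torus"
    and "(\<integral>\<^sup>+x. ennreal ((cmod (h x))\<^sup>2) \<partial>torus) < \<infinity>"
  shows "square_integrable h"
  unfolding square_integrable_def using assms by (auto intro!: integrableI_bounded)

text \<open>One inequality is Bessel's. For the other, the function built from the coefficients of
  \<open>h\<close> by \<open>riesz_fischer\<close> has squared norm at most their sum, and it equals
  \<open>h\<close> almost everywhere by uniqueness.\<close>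

theorem parseval:
  assumes h: "square_integrable h"
  shows "((\<lambda>k. (cmod (fcoef h k))\<^sup>2) has_sum (LINT x|torus. (cmod (h x))\<^sup>2)) UNIV"
proof -
  let ?I = "LINT x|torus. (cmod (h x))\<^sup>2"
  have sm: "(\<lambda>k. (cmod (fcoef h k))\<^sup>2) summable_on UNIV"
    by (rule nonneg_bounded_partial_sums_imp_summable_on[where C = ?I])
       (auto intro!: eventually_finite_subsets_at_top_weakI bessel_inequality[OF h])
  let ?S = "\<Sum>\<^sub>\<infinity>k. (cmod (fcoef h k))\<^sup>2"
  obtain H where H: "integrable torus H" "\<And>k. fcoef H k = fcoef h k"
    "(\<integral>\<^sup>+x. ennreal ((cmod (H x))\<^sup>2) \<partial>torus) \<le> ennreal ?S"
    using riesz_fischer[OF sm] by metis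
  have "AE x in torus. H x = h x"
    by (intro fcoef_unique H square_integrable_integrable h)
  then have "AE x in torus. ennreal ((cmod (h x))\<^sup>2) = ennreal ((cmod (H x))\<^sup>2)"
    by eventually_elim simp
  then have "(\<integral>\<^sup>+x. ennreal ((cmod (h x))\<^sup>2) \<partial>torus) \<le> ennreal ?S"
    using H(3) by (simp only: nn_integral_cong_AE)
  moreover have "(\<integral>\<^sup>+x. ennreal ((cmod (h x))\<^sup>2) \<partial>torus) = ennreal ?I"
    using h by (intro nn_integral_eq_integral) (auto simp: square_integrable_def)
  ultimately have "?I \<le> ?S"
    by (simp add: ennreal_le_iff infsum_nonneg)
  moreover have "?S \<le> ?I"
    by (rule infsum_le_finite_sums[OF sm]) (rule bessel_inequality[OF h])
  ultimately show ?thesis using has_sum_infsum[OF sm] by simp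
qed

text \<open>The factors 1 and - 1 are spelled out so that every square has the form
  \<open>z + c * y\<close> and the four terms are instances of one computation.\<close>

lemma complex_polarization:
  "z * cnj y = (1 / 4) * (of_real ((cmod (z + 1 * y))\<^sup>2) + (- 1) * of_real ((cmod (z + (- 1) * y))\<^sup>2)
     + \<i> * of_real ((cmod (z + \<i> * y))\<^sup>2) + (- \<i>) * of_real ((cmod (z + (- \<i>) * y))\<^sup>2))"
  unfolding complex_norm_square by (simp add: algebra_simps)

lemma fcoef_add_scale:
  assumes "integrable torus f" "integrable torus g"
  shows "fcoef (\<lambda>x. f x + c * g x) k = fcoef f k + c * fcoef g k"
proof -
  have "fcoef (\<lambda>x. f x + c * g x) k = (LINT x|torus. f x * fchar k x + c * (g x * fchar k x))"
    by (simp add: fcoef_def algebra_simps)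
  then show ?thesis
    using integrable_torus_mult[OF assms(1) continuous_fchar] integrable_torus_mult[OF assms(2) continuous_fchar]
    by (simp add: fcoef_def)
qed

theorem parseval_inner:
  assumes f: "square_integrable f" and g: "square_integrable g"
  shows "((\<lambda>k. fcoef f k * cnj (fcoef g k)) has_sum (LINT x|torus. f x * cnj (g x))) UNIV"
proof -
  define N where "N c h = (LINT x|torus. (cmod (f x + c * h x))\<^sup>2)" for c and h :: "real ^ 'a \<Rightarrow> complex"
  have *: "((\<lambda>k. complex_of_real ((cmod (fcoef f k + c * fcoef g k))\<^sup>2)) has_sum of_real (N c g)) UNIV" for c
    using parseval[OF square_integrable_add[OF f g, of c]] square_integrable_integrable[OF f]
      square_integrable_integrable[OF g]
    unfolding N_def has_sum_of_real_iff by (simp only: fcoef_add_scale)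
  have int: "integrable torus (\<lambda>x. (cmod (f x + c * g x))\<^sup>2)" for c
    using square_integrable_add[OF f g, of c] by (simp add: square_integrable_def)
  have int': "integrable torus (\<lambda>x. complex_of_real ((cmod (f x + c * g x))\<^sup>2))" for c
    using int by (rule integrable_of_real)
  have NC: "(LINT x|torus. complex_of_real ((cmod (f x + c * g x))\<^sup>2)) = of_real (N c g)" for c
    unfolding N_def by (rule integral_complex_of_real)
  have eq: "(LINT x|torus. f x * cnj (g x)) = (1 / 4) * (of_real (N 1 g) + (- 1) * of_real (N (- 1) g)
      + \<i> * of_real (N \<i> g) + (- \<i>) * of_real (N (- \<i>) g))"
    unfolding complex_polarization[of "f _" "g _"]
    by (simp only: integral_mult_right_zero Bochner_Integration.integral_add NC int'
         Bochner_Integration.integrable_add integrable_mult_right)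
  show ?thesis
    unfolding eq complex_polarization[of "fcoef f _" "fcoef g _"]
    by (intro has_sum_cmult_right has_sum_add *)
qed

section \<open>Infinite sums of extended nonnegative reals\<close>

lemma ennreal_infsum:
  fixes f :: "'a \<Rightarrow> real"
  assumes "f summable_on A" "\<And>x. x \<in> A \<Longrightarrow> 0 \<le> f x"
  shows "(\<Sum>\<^sub>\<infinity>x\<in>A. ennreal (f x)) = ennreal (\<Sum>\<^sub>\<infinity>x\<in>A. f x)"
proof -
  have "(\<Sum>\<^sub>\<infinity>x\<in>A. ennreal (f x)) = (SUP F\<in>{F. finite F \<and> F \<subseteq> A}. \<Sum>x\<in>F. ennreal (f x))"
    by (rule nonneg_infsum_complete) simp
  also have "\<dots> = (SUP F\<in>{F. finite F \<and> F \<subseteq> A}. ennreal (sum f F))"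
    by (intro SUP_cong refl sum_ennreal) (use assms(2) in auto)
  also have "\<dots> = ennreal (\<Sum>\<^sub>\<infinity>x\<in>A. f x)"
    using infsum_nonneg_is_SUPREMUM_ennreal[OF assms] by simp
  finally show ?thesis .
qed

lemma ennreal_summable_on:
  fixes f :: "'a \<Rightarrow> ennreal"
  shows "f summable_on A"
  by (rule nonneg_summable_on_complete) simp

lemma sum_le_infsum_ennreal:
  fixes f :: "'a \<Rightarrow> ennreal"
  assumes "finite F" "F \<subseteq> A"
  shows "sum f F \<le> infsum f A"
  unfolding nonneg_infsum_complete[OF zero_le, of f A] using assms by (intro SUP_upper) simp

lemma infsum_le_ennreal:
  fixes f :: "'a \<Rightarrow> ennreal"
  assumes "\<And>F. finite F \<Longrightarrow> F \<subseteq> A \<Longrightarrow> sum f F \<le> B"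
  shows "infsum f A \<le> B"
  unfolding nonneg_infsum_complete[OF zero_le, of f A] using assms by (intro SUP_least) simp

lemma summable_on_ennreal_finite:
  fixes f :: "'a \<Rightarrow> real"
  assumes "(\<Sum>\<^sub>\<infinity>x\<in>A. ennreal (f x)) < \<infinity>" "\<And>x. x \<in> A \<Longrightarrow> 0 \<le> f x"
  shows "f summable_on A"
proof -
  obtain B where B: "0 \<le> B" "(\<Sum>\<^sub>\<infinity>x\<in>A. ennreal (f x)) = ennreal B"
    using assms(1) by (cases "\<Sum>\<^sub>\<infinity>x\<in>A. ennreal (f x)") auto
  show ?thesis
  proof (rule nonneg_bounded_partial_sums_imp_summable_on)
    show "\<forall>\<^sub>F F in finite_subsets_at_top A. sum f F \<le> B"
    proof (rule eventually_finite_subsets_at_top_weakI)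
      fix F assume F: "finite F" "F \<subseteq> A"
      then have "ennreal (sum f F) = (\<Sum>x\<in>F. ennreal (f x))"
        by (intro sum_ennreal[symmetric]) (use assms(2) in auto)
      also have "\<dots> \<le> ennreal B" unfolding B(2)[symmetric] using F by (rule sum_le_infsum_ennreal)
      finally show "sum f F \<le> B" using B(1) by (simp add: ennreal_le_iff)
    qed
  qed (rule assms(2))
qed

text \<open>Every family in \<open>ennreal\<close> is summable, so a finite outer sum passes inside
  the infinite one and is then bounded by the full sum. Equality follows by exchanging the roles of
  the indices.\<close>

lemma infsum_swap_ennreal_le:
  fixes f :: "'a \<Rightarrow> 'b \<Rightarrow> ennreal"
  shows "(\<Sum>\<^sub>\<infinity>x\<in>A. \<Sum>\<^sub>\<infinity>y\<in>B. f x y) \<le> (\<Sum>\<^sub>\<infinity>y\<in>B. \<Sum>\<^sub>\<infinity>x\<in>A. f x y)"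
proof (rule infsum_le_ennreal)
  fix F assume F: "finite F" "F \<subseteq> A"
  have "(\<Sum>x\<in>F. \<Sum>\<^sub>\<infinity>y\<in>B. f x y) = (\<Sum>\<^sub>\<infinity>y\<in>B. \<Sum>x\<in>F. f x y)"
    using F(1)
  proof (induction F)
    case (insert x F)
    then show ?case using infsum_add[OF ennreal_summable_on ennreal_summable_on,
          of "f x" "\<lambda>y. \<Sum>x\<in>F. f x y" B] by simp
  qed simp
  also have "\<dots> \<le> (\<Sum>\<^sub>\<infinity>y\<in>B. \<Sum>\<^sub>\<infinity>x\<in>A. f x y)"
    using F by (intro infsum_mono sum_le_infsum_ennreal ennreal_summable_on) auto
  finally show "(\<Sum>x\<in>F. \<Sum>\<^sub>\<infinity>y\<in>B. f x y) \<le> (\<Sum>\<^sub>\<infinity>y\<in>B. \<Sum>\<^sub>\<infinity>x\<in>A. f x y)" .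
qed

lemma infsum_swap_ennreal:
  fixes f :: "'a \<Rightarrow> 'b \<Rightarrow> ennreal"
  shows "(\<Sum>\<^sub>\<infinity>x\<in>A. \<Sum>\<^sub>\<infinity>y\<in>B. f x y) = (\<Sum>\<^sub>\<infinity>y\<in>B. \<Sum>\<^sub>\<infinity>x\<in>A. f x y)"
  by (intro antisym infsum_swap_ennreal_le)

lemma infsum_cmult_ennreal:
  fixes f :: "'a \<Rightarrow> ennreal"
  assumes "0 \<le> c"
  shows "(\<Sum>\<^sub>\<infinity>x\<in>A. ennreal c * f x) = ennreal c * infsum f A"
proof -
  have "(\<Sum>\<^sub>\<infinity>x\<in>A. ennreal c * f x) = (SUP F\<in>{F. finite F \<and> F \<subseteq> A}. ennreal c * sum f F)"
    by (subst nonneg_infsum_complete) (auto simp: sum_distrib_left)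
  also have "\<dots> = ennreal c * (SUP F\<in>{F. finite F \<and> F \<subseteq> A}. sum f F)"
    by (rule SUP_mult_left_ennreal[symmetric])
  also have "\<dots> = ennreal c * infsum f A" by (subst nonneg_infsum_complete) auto
  finally show ?thesis .
qed

section \<open>Lebesgue and Sobolev norms in terms of coefficients\<close>

lemma represents_square:
  assumes "represents h u"
  shows "(\<integral>\<^sup>+x. ennreal ((cmod (h x))\<^sup>2) \<partial>torus) = (\<Sum>\<^sub>\<infinity>k. ennreal ((cmod (fourier_coeff u k))\<^sup>2))"
proof -
  have h: "integrable torus h" using assms by (simp add: represents_def)
  have [measurable]: "h \<in> borel_measurable torus" using h by auto
  have fc: "fourier_coeff u = fcoef h" using represents_fourier_coeff[OF assms] by auto
  have fin: "(\<integral>\<^sup>+x. ennreal ((cmod (h x))\<^sup>2) \<partial>torus) = (\<Sum>\<^sub>\<infinity>k. ennreal ((cmod (fcoef h k))\<^sup>2))"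
    if "square_integrable h"
  proof -
    have "(\<integral>\<^sup>+x. ennreal ((cmod (h x))\<^sup>2) \<partial>torus) = ennreal (LINT x|torus. (cmod (h x))\<^sup>2)"
      using that by (intro nn_integral_eq_integral) (auto simp: square_integrable_def)
    also have "\<dots> = ennreal (\<Sum>\<^sub>\<infinity>k. (cmod (fcoef h k))\<^sup>2)"
      using infsumI[OF parseval[OF that]] by simp
    also have "\<dots> = (\<Sum>\<^sub>\<infinity>k. ennreal ((cmod (fcoef h k))\<^sup>2))"
      using parseval[OF that] by (intro ennreal_infsum[symmetric]) (auto simp: has_sum_iff)
    finally show ?thesis .
  qed
  show ?thesis
  \<comment> \<open>Square integrability is not assumed. If the coefficients are square summable, it
    is inherited from a function with these coefficients; otherwise Parseval's identity excludes it,
    and both sides are infinite.\<close>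
  proof (cases "(\<Sum>\<^sub>\<infinity>k. ennreal ((cmod (fcoef h k))\<^sup>2)) < \<infinity>")
    case True
    then have sm: "(\<lambda>k. (cmod (fcoef h k))\<^sup>2) summable_on UNIV"
      by (rule summable_on_ennreal_finite) simp
    obtain H where H: "integrable torus H" "\<And>k. fcoef H k = fcoef h k"
      "(\<integral>\<^sup>+x. ennreal ((cmod (H x))\<^sup>2) \<partial>torus) \<le> ennreal (\<Sum>\<^sub>\<infinity>k. (cmod (fcoef h k))\<^sup>2)"
      using riesz_fischer[OF sm] by metis
    have "AE x in torus. H x = h x"
      by (intro fcoef_unique H h)
    then have "AE x in torus. ennreal ((cmod (H x))\<^sup>2) = ennreal ((cmod (h x))\<^sup>2)"
      by eventually_elim simp
    then have "(\<integral>\<^sup>+x. ennreal ((cmod (h x))\<^sup>2) \<partial>torus) = (\<integral>\<^sup>+x. ennreal ((cmod (H x))\<^sup>2) \<partial>torus)"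
      by (rule nn_integral_cong_AE[symmetric])
    also have "\<dots> < \<infinity>" using H(3) by (simp add: order.strict_trans1)
    finally show ?thesis unfolding fc by (intro fin square_integrable_nn) simp_all
  next
    case False
    then have "\<not> square_integrable h"
      using fin by (metis nn_integral_eq_integral square_integrable_def ennreal_less_top
          infinity_ennreal_def AE_I2 zero_le_power2)
    then have "\<not> (\<integral>\<^sup>+x. ennreal ((cmod (h x))\<^sup>2) \<partial>torus) < \<infinity>"
      using square_integrable_nn[of h] by auto
    with False show ?thesis unfolding fc by (simp add: less_top[symmetric])
  qed
qed

lemma represents_exists:
  assumes "u \<in> distributions" "(\<Sum>\<^sub>\<infinity>k. ennreal ((cmod (fourier_coeff u k))\<^sup>2)) < \<infinity>"
  shows "\<exists>h. represents h u"
proof -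
  have "(\<lambda>k. (cmod (fourier_coeff u k))\<^sup>2) summable_on UNIV"
    using assms(2) by (rule summable_on_ennreal_finite) simp
  then obtain H where "integrable torus H" "\<And>k. fcoef H k = fourier_coeff u k"
    using riesz_fischer by metis
  then show ?thesis using representsI assms(1) by blast
qed

text \<open>Square summable coefficients always come from a function. A distribution without
  representative therefore has the value \<infinity> on both sides.\<close>

lemma Lp_norm_2:
  assumes "u \<in> distributions"
  shows "Lp_norm 2 u = ennreal_powr (\<Sum>\<^sub>\<infinity>k. ennreal ((cmod (fourier_coeff u k))\<^sup>2)) (1 / 2)"
proof (cases "\<exists>h. represents h u")
  case True
  then have "represents (representative u) u"
    unfolding representative_def by (rule someI_ex)
  from represents_square[OF this] True show ?thesis
    by (simp add: Lp_norm_def Lp_norm_fun_def)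
next
  case False
  then have "(\<Sum>\<^sub>\<infinity>k. ennreal ((cmod (fourier_coeff u k))\<^sup>2)) = \<infinity>"
    using represents_exists[OF assms] by (auto simp: less_top[symmetric])
  with False show ?thesis by (simp add: Lp_norm_def ennreal_powr_def)
qed

text \<open>The squared Sobolev norm on the Fourier side; the root is taken only when a bound on
  norms is stated.\<close>

definition Hs_sq :: "real \<Rightarrow> ((real ^ 'n \<Rightarrow> complex) \<Rightarrow> complex) \<Rightarrow> ennreal"
  where "Hs_sq s u = (\<Sum>\<^sub>\<infinity>k. ennreal ((jap k powr s * cmod (fourier_coeff u k))\<^sup>2))"

lemma Hs_norm_eq:
  assumes "u \<in> distributions"
  shows "Hs_norm s u = ennreal_powr (Hs_sq s u) (1 / 2)"
  by (simp add: Hs_norm_def Lps_norm_def Lp_norm_2 bessel_pot[OF assms] Hs_sq_def norm_mult)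

lemma ennreal_powr_half_power2: "(ennreal_powr x (1 / 2))\<^sup>2 = x"
proof (cases x)
  case (real r)
  then have "(ennreal_powr x (1 / 2))\<^sup>2 = (ennreal (sqrt r))\<^sup>2"
    by (simp add: ennreal_powr_def powr_half_sqrt)
  then show ?thesis using real by (simp add: ennreal_power)
qed (simp add: ennreal_powr_def)

lemma ennreal_powr_half_finite: "ennreal_powr x (1 / 2) < \<infinity> \<longleftrightarrow> x < \<infinity>"
  by (auto simp: ennreal_powr_def less_top[symmetric])

text \<open>Turns an inequality between squared norms with factor \<open>c\<^sup>2\<close> into one
  between norms with factor \<open>1 / c\<close>. Positivity of \<open>c\<close> is what forces
  \<open>x\<close> to be finite when \<open>y\<close> is.\<close>

lemma ennreal_powr_half_le:
  assumes c: "0 < c" and le: "ennreal (c\<^sup>2) * x \<le> y"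
  shows "ennreal_powr x (1 / 2) \<le> ennreal (1 / c) * ennreal_powr y (1 / 2)"
proof (cases y)
  case (real r)
  have "x \<noteq> \<infinity>"
  proof
    assume "x = \<infinity>"
    then have "ennreal (c\<^sup>2) * x = \<infinity>" using c by (simp add: ennreal_mult_top)
    then have "\<infinity> \<le> ennreal r" using le real by simp
    then show False by (simp add: top_unique)
  qed
  then obtain q where q: "0 \<le> q" "x = ennreal q" by (cases x) auto
  have "c\<^sup>2 * q \<le> r"
    using le real q c by (simp add: ennreal_mult[symmetric] ennreal_le_iff)
  then have "sqrt (c\<^sup>2 * q) \<le> sqrt r" by simp
  then have "c * sqrt q \<le> sqrt r" using c by (simp add: real_sqrt_mult)
  then have "sqrt q \<le> (1 / c) * sqrt r" using c by (simp add: field_simps)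
  then show ?thesis
    using real q c by (simp add: ennreal_powr_def powr_half_sqrt ennreal_mult[symmetric] ennreal_leI)
next
  case top
  then show ?thesis using c by (simp add: ennreal_powr_def ennreal_mult_top)
qed

lemma Hs_iff: "u \<in> Hs s \<longleftrightarrow> u \<in> distributions \<and> Hs_sq s u < \<infinity>"
  unfolding Hs_def using Hs_norm_eq[of u s] ennreal_powr_half_finite[of "Hs_sq s u"] by auto

text \<open>The arbitrary choice in \<open>representative\<close> does no harm: the coefficients are
  those of the distribution, whichever function is taken.\<close>

lemma representative_bessel_pot:
  assumes "u \<in> Hs s"
  shows "square_integrable (representative (bessel_pot s u))"
    and "fcoef (representative (bessel_pot s u)) k = of_real (jap k powr s) * fourier_coeff u k"
proof -
  have u: "u \<in> distributions" and fin: "Hs_sq s u < \<infinity>" using assms by (auto simp: Hs_iff)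
  let ?v = "bessel_pot s u"
  have sq: "(\<Sum>\<^sub>\<infinity>k. ennreal ((cmod (fourier_coeff ?v k))\<^sup>2)) = Hs_sq s u"
    by (simp add: bessel_pot[OF u] Hs_sq_def norm_mult)
  have "\<exists>h. represents h ?v"
    using fin sq by (intro represents_exists bessel_pot u) simp
  then have r: "represents (representative ?v) ?v"
    unfolding representative_def by (rule someI_ex)
  show "fcoef (representative ?v) k = of_real (jap k powr s) * fourier_coeff u k"
    using represents_fourier_coeff[OF r] by (simp add: bessel_pot[OF u])
  show "square_integrable (representative ?v)"
    using represents_square[OF r] sq fin r
    by (intro square_integrable_nn) (auto simp: represents_def)
qed

lemma has_sum_Hs_inner:
  assumes "u \<in> Hs s" "v \<in> Hs s"
  shows "((\<lambda>k. of_real ((jap k powr s)\<^sup>2) * (fourier_coeff u k * cnj (fourier_coeff v k)))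
    has_sum Hs_inner s u v) UNIV"
  using parseval_inner[OF representative_bessel_pot(1)[OF assms(1)] representative_bessel_pot(1)[OF assms(2)]]
  by (simp add: Hs_inner_def representative_bessel_pot(2)[OF assms(1)]
      representative_bessel_pot(2)[OF assms(2)] power2_eq_square mult_ac)

section \<open>Fourier coefficients of the Radon transform\<close>

text \<open>Both vectors are integral, so along the segment the exponential either is constant or
  runs through whole periods, and its antiderivative has equal values at the two ends.\<close>

lemma integral_fchar_segment:
  "(LINT t|lborel. indicator {0..1} t *\<^sub>R fchar k (t *\<^sub>R real_vec v))
    = (if real_vec k \<bullet> real_vec v = 0 then 1 else 0)"
proof -
  define m where "m = real_vec k \<bullet> real_vec v"
  define c where "c = - 2 * of_real pi * \<i> * of_real m"
  have eq: "fchar k (t *\<^sub>R real_vec v) = exp (c * of_real t)" for t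
    by (simp add: fchar_def c_def m_def mult_ac)
  show ?thesis
  proof (cases "m = 0")
    case True
    then show ?thesis unfolding eq by (simp add: c_def m_def[symmetric])
  next
    case False
    then have c: "c \<noteq> 0" by (simp add: c_def)
    have "exp c = fchar k (real_vec v)" using eq[of 1] by simp
    then have ec: "exp c = 1" by (simp add: fchar_real_vec)
    have "(LINT t|lborel. indicator {0..1} t *\<^sub>R exp (c * of_real t))
        = exp (c * of_real 1) / c - exp (c * of_real 0) / c"
    proof (rule integral_FTC_atLeastAtMost)
      show "((\<lambda>t. exp (c * of_real t) / c) has_vector_derivative exp (c * of_real t)) (at t within {0..1})" for t
      proof -
        have "((\<lambda>z. exp (c * z) / c) has_field_derivative exp (c * of_real t)) (at (of_real t))"
          using c by (auto intro!: derivative_eq_intros)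
        then have "((\<lambda>t. exp (c * of_real t) / c) has_vector_derivative exp (c * of_real t)) (at t)"
          by (rule has_vector_derivative_real_field)
        then show ?thesis by (rule has_vector_derivative_at_within)
      qed
    qed (auto intro!: continuous_intros)
    then show ?thesis using ec False unfolding eq by (simp add: m_def)
  qed
qed

lemma fchar_sum: "finite I \<Longrightarrow> fchar k (\<Sum>i\<in>I. f i) = (\<Prod>i\<in>I. fchar k (f i))"
proof (induction I rule: finite_induct)
  case empty
  show ?case by (simp add: fchar_cis)
qed (simp add: fchar_add)

text \<open>The integrand factors over the parameters, so Fubini's theorem reduces the transform to
  a product of one-dimensional integrals, each equal to 0 or 1.\<close>

lemma radon_tuple_fchar:
  "radon_tuple d v (fchar k) =
    (\<lambda>x. (if \<forall>i<d. real_vec k \<bullet> real_vec (v i) = 0 then 1 else 0) * fchar k x)"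
proof
  fix x
  interpret product_sigma_finite "\<lambda>_ :: nat. lborel :: real measure" ..
  define f where "f i t = indicator {0..1} t *\<^sub>R fchar k (t *\<^sub>R real_vec (v i))" for i t
  \<comment> \<open>Membership in \<open>PiE\<close> includes extensionality, which holds for points
    of the product space; hence the restriction on \<open>t\<close>.\<close>
  have ind: "indicator (PiE {..<d} (\<lambda>_. {0..1})) t = (\<Prod>i<d. indicator {0..1} (t i) :: real)"
    if "t \<in> space (PiM {..<d} (\<lambda>_. lborel :: real measure))" for t
    using that by (auto simp: indicator_def space_PiM PiE_def intro!: prod.neutral)
  have int: "integrable lborel (f i)" for i
    unfolding f_def[abs_def]
    by (rule borel_integrable_compact) (auto intro!: continuous_intros continuous_on_compose2[OF continuous_fchar])
  have "radon_tuple d v (fchar k) x = (LINT t|PiM {..<d} (\<lambda>_. lborel). fchar k x * (\<Prod>i<d. f i (t i)))"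
    unfolding radon_tuple_def set_lebesgue_integral_def
  proof (rule Bochner_Integration.integral_cong[OF refl])
    fix t assume t: "t \<in> space (PiM {..<d} (\<lambda>_. lborel :: real measure))"
    have "fchar k (x + (\<Sum>i<d. t i *\<^sub>R real_vec (v i))) = fchar k x * (\<Prod>i<d. fchar k (t i *\<^sub>R real_vec (v i)))"
      by (simp add: fchar_add fchar_sum)
    then show "indicator (PiE {..<d} (\<lambda>_. {0..1})) t *\<^sub>R fchar k (x + (\<Sum>i<d. t i *\<^sub>R real_vec (v i)))
        = fchar k x * (\<Prod>i<d. f i (t i))"
      unfolding ind[OF t] f_def by (simp add: scaleR_conv_of_real prod.distrib)
  qed
  also have "\<dots> = fchar k x * (\<Prod>i<d. integral\<^sup>L lborel (f i))"
    by (simp add: product_integral_prod int)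
  also have "(\<Prod>i<d. integral\<^sup>L lborel (f i)) = (\<Prod>i<d. if real_vec k \<bullet> real_vec (v i) = 0 then 1 else 0)"
    unfolding f_def by (simp only: integral_fchar_segment)
  also have "\<dots> = (if \<forall>i<d. real_vec k \<bullet> real_vec (v i) = 0 then 1 else 0)"
    by (auto intro: prod.neutral)
  finally show "radon_tuple d v (fchar k) x =
      (if \<forall>i<d. real_vec k \<bullet> real_vec (v i) = 0 then 1 else 0) * fchar k x"
    by (simp add: mult.commute)
qed

text \<open>The vectors annihilated by \<open>k\<close> form a rational subspace, so generators
  suffice, and on integer vectors rational and real inner products are the same integer. The left
  side does not mention the basis: this is why its choice does not influence the coefficients of the
  transform.\<close>

lemma perp_int_basis:
  assumes "int_basis d A v"
  shows "perp k A \<longleftrightarrow> (\<forall>i<d. real_vec k \<bullet> real_vec (v i) = 0)"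
proof -
  let ?f = "\<lambda>x :: rat ^ 'a. \<Sum>i\<in>UNIV. of_int (k $ i) * x $ i"
  let ?S = "(\<lambda>i. rat_vec (v i)) ` {..<d}"
  have A: "A = vec.span ?S" using assms by (simp add: int_basis_def)
  have "perp k A \<longleftrightarrow> (\<forall>x\<in>?S. ?f x = 0)"
  proof
    assume "perp k A"
    then show "\<forall>x\<in>?S. ?f x = 0" unfolding perp_def A by (auto intro: vec.span_base)
  next
    assume 0: "\<forall>x\<in>?S. ?f x = 0"
    have "vec.subspace {x. ?f x = 0}"
      by (auto simp: vec.subspace_def distrib_left sum.distrib mult.left_commute sum_distrib_left[symmetric])
    then have "vec.span ?S \<subseteq> {x. ?f x = 0}"
      using 0 by (intro vec.span_minimal) auto
    then show "perp k A" unfolding perp_def A by auto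
  qed
  also have "\<dots> \<longleftrightarrow> (\<forall>i<d. real_vec k \<bullet> real_vec (v i) = 0)"
  proof -
    have "?f (rat_vec (v i)) = of_int (\<Sum>j\<in>UNIV. k $ j * v i $ j)" for i
      by (simp add: rat_vec_def)
    moreover have "real_vec k \<bullet> real_vec (v i) = of_int (\<Sum>j\<in>UNIV. k $ j * v i $ j)" for i
      by (simp add: inner_vec_def)
    ultimately have "real_vec k \<bullet> real_vec (v i) = 0 \<longleftrightarrow> ?f (rat_vec (v i)) = 0" for i
      by (simp only: of_int_eq_0_iff)
    then show ?thesis by auto
  qed
  finally show ?thesis .
qed

section \<open>Integer bases of rational subspaces\<close>

lemma clear_denominators:
  fixes b :: "rat ^ 'n"
  obtains N v where "N \<noteq> (0 :: int)" "rat_vec v = of_int N *s b"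
proof
  define q where "q i = snd (quotient_of (b $ i))" for i
  have q: "0 < q i" for i by (simp add: q_def quotient_of_denom_pos')
  \<comment> \<open>The product of all denominators; each numerator is multiplied by every
    denominator but its own.\<close>
  define N where "N = (\<Prod>i\<in>UNIV. q i)"
  show "N \<noteq> 0" using q by (simp add: N_def less_imp_neq[THEN not_sym])
  show "rat_vec (\<chi> i. fst (quotient_of (b $ i)) * (\<Prod>j\<in>UNIV - {i}. q j)) = of_int N *s b"
  proof (subst vec_eq_iff, rule allI)
    fix i
    have b: "b $ i = of_int (fst (quotient_of (b $ i))) / of_int (q i)"
      using quotient_of_div[of "b $ i"] by (simp add: q_def prod_eq_iff)
    have "N = q i * (\<Prod>j\<in>UNIV - {i}. q j)"
      unfolding N_def by (rule prod.remove) auto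
    then have "of_int N * b $ i = of_int (q i) * of_int (\<Prod>j\<in>UNIV - {i}. q j) *
        (of_int (fst (quotient_of (b $ i))) / of_int (q i))"
      by (subst b) simp
    also have "\<dots> = of_int (fst (quotient_of (b $ i)) * (\<Prod>j\<in>UNIV - {i}. q j))"
      using q[of i] by (simp add: field_simps)
    finally show "rat_vec (\<chi> i. fst (quotient_of (b $ i)) * (\<Prod>j\<in>UNIV - {i}. q j)) $ i = (of_int N *s b) $ i"
      by (simp add: rat_vec_def)
  qed
qed

text \<open>Makes the choice in \<open>radon_fun\<close> meaningful. A rational basis is scaled to
  integer vectors, and nonzero scaling of its members preserves the span.\<close>

lemma int_basis_exists:
  fixes A :: "(rat ^ 'n) set"
  assumes "A \<in> Gr d"
  shows "\<exists>v. int_basis d A v"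
proof -
  have sub: "vec.subspace A" and dim: "vec.dim A = d" using assms by (auto simp: Gr_def)
  obtain B where B: "B \<subseteq> A" "vec.independent B" "A \<subseteq> vec.span B" "card B = d"
    using vec.basis_exists[of A] dim by metis
  have finB: "finite B" using B(2) by (rule vec.finiteI_independent)
  obtain e where e: "bij_betw e {..<d} B"
    using finB B(4) by (metis bij_betw_from_nat_into_finite lessThan_atLeast0 ex_bij_betw_nat_finite)
  have "\<forall>b. \<exists>N v. N \<noteq> (0 :: int) \<and> rat_vec v = of_int N *s (b :: rat ^ 'n)"
    using clear_denominators by metis
  then obtain N and u :: "rat ^ 'n \<Rightarrow> int ^ 'n"
    where N: "\<And>b. N b \<noteq> (0 :: int)" "\<And>b. rat_vec (u b) = of_int (N b) *s b"
    by metis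
  define v where "v i = u (e i)" for i
  define S where "S = (\<lambda>i. rat_vec (v i)) ` {..<d}"
  have eB: "e ` {..<d} = B" using e by (simp add: bij_betw_def)
  have "S = (\<lambda>b. of_int (N b) *s b) ` B"
    unfolding S_def v_def N(2) eB[symmetric] by (simp add: image_image)
  then have "vec.span S = vec.span B"
    using vec.span_image_scale[OF finB, of "\<lambda>b. of_int (N b)"] N(1) by simp
  also have "\<dots> = A"
    using B(1,3) sub vec.span_minimal by blast
  finally have span: "vec.span S = A" .
  have finS: "finite S" and cardS: "card S \<le> d"
    using card_image_le[of "{..<d}" "\<lambda>i. rat_vec (v i)"] by (auto simp: S_def)
  \<comment> \<open>At most \<open>d\<close> vectors that span a space of dimension \<open>d\<close>
    are independent. Their number is then exactly \<open>d\<close>, which makes the indexing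
    injective.\<close>
  have ind: "vec.independent S"
  proof (rule vec.card_le_dim_spanning)
    show "S \<subseteq> A" using span vec.span_superset by blast
    show "A \<subseteq> vec.span S" by (simp add: span)
    show "card S \<le> vec.dim A" using cardS dim by simp
  qed (rule finS)
  have "card S = d"
    using vec.dim_span_eq_card_independent[OF ind] span dim by simp
  then have "inj_on (\<lambda>i. rat_vec (v i)) {..<d}"
    unfolding S_def by (intro eq_card_imp_inj_on) auto
  then have "inj_on v {..<d}" by (auto simp: inj_on_def)
  then show ?thesis using ind span unfolding int_basis_def S_def by blast
qed

lemma fourier_coeff_radon:
  assumes u: "u \<in> distributions" and A: "A \<in> Gr d"
  shows "fourier_coeff (radon d u A) k = (if perp k A then fourier_coeff u k else 0)"
proof -
  have basis: "int_basis d A (SOME v. int_basis d A v)"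
    using int_basis_exists[OF A] by (rule someI_ex)
  have "radon_fun d (fchar k) A = (\<lambda>x. (if perp k A then 1 else 0) * fchar k x)"
    unfolding radon_fun_def radon_tuple_fchar perp_int_basis[OF basis, symmetric] ..
  then have "fourier_coeff (radon d u A) k = u (\<lambda>x. (if perp k A then 1 else 0) * fchar k x)"
    by (simp only: fourier_coeff_fchar radon_def fchar_test_fun if_True)
  also have "\<dots> = (if perp k A then 1 else 0) * u (fchar k)"
    by (rule distributionsD(3)[OF u fchar_test_fun])
  finally show ?thesis by (simp add: fourier_coeff_fchar)
qed

section \<open>The adjoint of the Radon transform\<close>

lemma cauchy_schwarz_infsum:
  fixes a b :: "'a \<Rightarrow> real"
  assumes a: "(\<lambda>x. (a x)\<^sup>2) summable_on A" and b: "(\<lambda>x. (b x)\<^sup>2) summable_on A"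
  shows "(\<lambda>x. \<bar>a x * b x\<bar>) summable_on A"
    and "(\<Sum>\<^sub>\<infinity>x\<in>A. \<bar>a x * b x\<bar>)\<^sup>2 \<le> (\<Sum>\<^sub>\<infinity>x\<in>A. (a x)\<^sup>2) * (\<Sum>\<^sub>\<infinity>x\<in>A. (b x)\<^sup>2)"
proof -
  have "\<bar>s * t\<bar> \<le> s\<^sup>2 + t\<^sup>2" for s t :: real
  proof -
    have "0 \<le> (\<bar>s\<bar> - \<bar>t\<bar>)\<^sup>2" "0 \<le> \<bar>s\<bar> * \<bar>t\<bar>" by simp_all
    then have "\<bar>s\<bar> * \<bar>t\<bar> \<le> s\<^sup>2 + t\<^sup>2" unfolding power2_diff power2_abs by linarith
    then show ?thesis by (simp add: abs_mult)
  qed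
  then show sm: "(\<lambda>x. \<bar>a x * b x\<bar>) summable_on A"
    by (intro summable_on_comparison_test[OF summable_on_add[OF a b]]) auto
  let ?P = "(\<Sum>\<^sub>\<infinity>x\<in>A. (a x)\<^sup>2) * (\<Sum>\<^sub>\<infinity>x\<in>A. (b x)\<^sup>2)"
  have "(\<Sum>\<^sub>\<infinity>x\<in>A. \<bar>a x * b x\<bar>) \<le> sqrt ?P"
  proof (rule infsum_le_finite_sums[OF sm])
    fix F assume F: "finite F" "F \<subseteq> A"
    have "(\<Sum>x\<in>F. \<bar>a x * b x\<bar>)\<^sup>2 \<le> (\<Sum>x\<in>F. (a x)\<^sup>2) * (\<Sum>x\<in>F. (b x)\<^sup>2)"
      using Cauchy_Schwarz_ineq_sum[of "\<lambda>x. \<bar>a x\<bar>" "\<lambda>x. \<bar>b x\<bar>" F] by (simp add: abs_mult)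
    also have "\<dots> \<le> ?P"
      using F a b by (intro mult_mono finite_sum_le_infsum infsum_nonneg sum_nonneg) auto
    finally show "(\<Sum>x\<in>F. \<bar>a x * b x\<bar>) \<le> sqrt ?P" by (rule real_le_rsqrt)
  qed
  then have "(\<Sum>\<^sub>\<infinity>x\<in>A. \<bar>a x * b x\<bar>)\<^sup>2 \<le> (sqrt ?P)\<^sup>2"
    by (intro power_mono infsum_nonneg) auto
  also have "\<dots> = ?P" by (intro real_sqrt_pow2 mult_nonneg_nonneg infsum_nonneg) auto
  finally show "(\<Sum>\<^sub>\<infinity>x\<in>A. \<bar>a x * b x\<bar>)\<^sup>2 \<le> ?P" .
qed

lemma infsum_ennreal_restrict:
  fixes f :: "'a \<Rightarrow> ennreal"
  shows "(\<Sum>\<^sub>\<infinity>x\<in>{x \<in> A. P x}. f x) = (\<Sum>\<^sub>\<infinity>x\<in>A. if P x then f x else 0)"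
  by (rule infsum_cong_neutral) auto

text \<open>Every finite set of pairs lies in a finite rectangle, whose sum the iterated sum bounds.
  This supplies the absolute convergence needed to exchange sums of complex terms.\<close>

lemma summable_on_product_ennreal:
  fixes f :: "'a \<Rightarrow> 'b \<Rightarrow> real"
  assumes fin: "(\<Sum>\<^sub>\<infinity>x\<in>A. \<Sum>\<^sub>\<infinity>y\<in>B. ennreal (f x y)) < \<infinity>" and nonneg: "\<And>x y. 0 \<le> f x y"
  shows "(\<lambda>(x, y). f x y) summable_on A \<times> B"
proof (rule summable_on_ennreal_finite)
  have "(\<Sum>\<^sub>\<infinity>z\<in>A \<times> B. ennreal (case z of (x, y) \<Rightarrow> f x y)) \<le> (\<Sum>\<^sub>\<infinity>x\<in>A. \<Sum>\<^sub>\<infinity>y\<in>B. ennreal (f x y))"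
  proof (rule infsum_le_ennreal)
    fix F assume F: "finite F" "F \<subseteq> A \<times> B"
    have "(\<Sum>z\<in>F. ennreal (case z of (x, y) \<Rightarrow> f x y))
        \<le> (\<Sum>z\<in>fst ` F \<times> snd ` F. ennreal (case z of (x, y) \<Rightarrow> f x y))"
      using F by (intro sum_mono2) (auto intro: rev_image_eqI)
    also have "\<dots> = (\<Sum>x\<in>fst ` F. \<Sum>y\<in>snd ` F. ennreal (f x y))"
      by (simp add: sum.cartesian_product case_prod_unfold)
    also have "\<dots> \<le> (\<Sum>x\<in>fst ` F. \<Sum>\<^sub>\<infinity>y\<in>B. ennreal (f x y))"
      using F by (intro sum_mono sum_le_infsum_ennreal) auto
    also have "\<dots> \<le> (\<Sum>\<^sub>\<infinity>x\<in>A. \<Sum>\<^sub>\<infinity>y\<in>B. ennreal (f x y))"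
      using F by (intro sum_le_infsum_ennreal) auto
    finally show "(\<Sum>z\<in>F. ennreal (case z of (x, y) \<Rightarrow> f x y)) \<le> (\<Sum>\<^sub>\<infinity>x\<in>A. \<Sum>\<^sub>\<infinity>y\<in>B. ennreal (f x y))" .
  qed
  then show "(\<Sum>\<^sub>\<infinity>z\<in>A \<times> B. ennreal (case z of (x, y) \<Rightarrow> f x y)) < \<infinity>"
    using fin by (rule order.strict_trans1)
qed (auto intro: nonneg)

text \<open>The squared data norm on the Fourier side. The formula makes sense for every family, but
  it agrees with \<open>data_norm\<close> only if all the multipliers are defined.\<close>

definition data_sq ::
    "nat \<Rightarrow> real \<Rightarrow> (int ^ 'n \<Rightarrow> (rat ^ 'n) set \<Rightarrow> real)
      \<Rightarrow> ((rat ^ 'n) set \<Rightarrow> (real ^ 'n \<Rightarrow> complex) \<Rightarrow> complex) \<Rightarrow> ennreal"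
  where "data_sq d s w g =
    (\<Sum>\<^sub>\<infinity>A\<in>Gr d. \<Sum>\<^sub>\<infinity>k. ennreal ((jap k powr s * cmod (of_real (w k A) * fourier_coeff (g A) k))\<^sup>2))"

lemma Hs_sq_fourier_mult:
  assumes "in_mult_domain \<omega> u"
  shows "Hs_sq s (fourier_mult \<omega> u) =
    (\<Sum>\<^sub>\<infinity>k. ennreal ((jap k powr s * cmod (of_real (\<omega> k) * fourier_coeff u k))\<^sup>2))"
  unfolding Hs_sq_def fourier_mult(2)[OF assms] ..

lemma data_norm_eq:
  assumes "\<And>A. A \<in> Gr d \<Longrightarrow> in_mult_domain (\<lambda>k. w k A) (g A)"
  shows "data_norm d s w g = ennreal_powr (data_sq d s w g) (1 / 2)"
proof -
  have "(\<Sum>\<^sub>\<infinity>A\<in>Gr d. if in_mult_domain (\<lambda>k. w k A) (g A)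
      then (Hs_norm s (fourier_mult (\<lambda>k. w k A) (g A)))\<^sup>2 else \<infinity>) = data_sq d s w g"
    unfolding data_sq_def
    by (intro infsum_cong)
       (simp only: assms if_True Hs_norm_eq[OF fourier_mult(1)[OF assms]] ennreal_powr_half_power2
         Hs_sq_fourier_mult[OF assms])
  then show ?thesis by (simp only: data_norm_def)
qed

text \<open>A family member outside the domain of its multiplier contributes \<infinity>, and one
  such term makes the whole sum infinite.\<close>

lemma data_norm_finite_mult_domain:
  assumes "data_norm d s w g < \<infinity>" and A: "A \<in> Gr d"
  shows "in_mult_domain (\<lambda>k. w k A) (g A)"
proof (rule ccontr)
  let ?f = "\<lambda>A. if in_mult_domain (\<lambda>k. w k A) (g A)
      then (Hs_norm s (fourier_mult (\<lambda>k. w k A) (g A)))\<^sup>2 else \<infinity>"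
  assume "\<not> in_mult_domain (\<lambda>k. w k A) (g A)"
  then have "\<infinity> = (\<Sum>A\<in>{A}. ?f A)" by simp
  also have "\<dots> \<le> infsum ?f (Gr d)" using A by (intro sum_le_infsum_ennreal) auto
  finally have "\<not> infsum ?f (Gr d) < \<infinity>" by (simp add: top_unique)
  then show False
    using assms(1) unfolding data_norm_def ennreal_powr_half_finite by blast
qed

lemma data_sq_finite:
  assumes "data_norm d s w g < \<infinity>"
  shows "data_sq d s w g < \<infinity>"
proof -
  have "data_norm d s w g = ennreal_powr (data_sq d s w g) (1 / 2)"
    by (rule data_norm_eq[OF data_norm_finite_mult_domain[OF assms]])
  then show ?thesis using assms by (simp only: ennreal_powr_half_finite)
qed

lemma term_le_infsum_ennreal:
  fixes f :: "'a \<Rightarrow> ennreal"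
  assumes "x \<in> A"
  shows "f x \<le> infsum f A"
  using sum_le_infsum_ennreal[of "{x}" A f] assms by simp

text \<open>A finite sum bounds each of its terms, so the coefficients grow at most polynomially and
  belong to a distribution.\<close>

lemma in_Hs_of_coeffs:
  assumes fin: "(\<Sum>\<^sub>\<infinity>k. ennreal ((jap k powr s * cmod (a k))\<^sup>2)) < \<infinity>"
  obtains h where "h \<in> Hs s" "\<And>k. fourier_coeff h k = a k"
proof -
  obtain M where M: "0 \<le> M" "(\<Sum>\<^sub>\<infinity>k. ennreal ((jap k powr s * cmod (a k))\<^sup>2)) = ennreal M"
    using fin by (cases "\<Sum>\<^sub>\<infinity>k. ennreal ((jap k powr s * cmod (a k))\<^sup>2)") auto
  have bnd: "cmod (a k) \<le> sqrt M * jap k ^ nat \<lceil>- s\<rceil>" for k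
  proof -
    have "ennreal ((jap k powr s * cmod (a k))\<^sup>2) \<le> ennreal M"
      unfolding M(2)[symmetric] by (rule term_le_infsum_ennreal) simp
    then have "(jap k powr s * cmod (a k))\<^sup>2 \<le> M" using M(1) by (simp add: ennreal_le_iff)
    then have "jap k powr s * cmod (a k) \<le> sqrt M" by (rule real_le_rsqrt)
    then have "jap k powr (- s) * (jap k powr s * cmod (a k)) \<le> jap k powr (- s) * sqrt M"
      by (rule mult_left_mono) simp
    moreover have "jap k powr (- s) * (jap k powr s * cmod (a k)) = cmod (a k)"
      using jap_pos[of k] unfolding mult.assoc[symmetric] powr_add[symmetric] by simp
    ultimately have "cmod (a k) \<le> sqrt M * jap k powr (- s)" by (simp only: mult.commute[of "sqrt M"])
    also have "\<dots> \<le> sqrt M * jap k ^ nat \<lceil>- s\<rceil>"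
      using M(1) by (intro mult_left_mono jap_powr_le_power) simp
    finally show ?thesis .
  qed
  obtain h where h: "h \<in> distributions" "\<And>k. fourier_coeff h k = a k"
    using distribution_of_coeffs[OF bnd] by metis
  then have "h \<in> Hs s" using fin by (simp add: Hs_iff Hs_sq_def)
  then show ?thesis using that h(2) by blast
qed

definition backproj_coeff ::
    "nat \<Rightarrow> (int ^ 'n \<Rightarrow> (rat ^ 'n) set \<Rightarrow> real)
      \<Rightarrow> ((rat ^ 'n) set \<Rightarrow> (real ^ 'n \<Rightarrow> complex) \<Rightarrow> complex) \<Rightarrow> int ^ 'n \<Rightarrow> complex"
  where "backproj_coeff d w g k = (\<Sum>\<^sub>\<infinity>A\<in>Omega d k. of_real ((w k A)\<^sup>2) * fourier_coeff (g A) k)"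

lemma data_sq_swap:
  "data_sq d s w g = (\<Sum>\<^sub>\<infinity>k. \<Sum>\<^sub>\<infinity>A\<in>Gr d. ennreal ((jap k powr s * cmod (of_real (w k A) * fourier_coeff (g A) k))\<^sup>2))"
  unfolding data_sq_def by (rule infsum_swap_ennreal)

lemma Omega_subset: "Omega d k \<subseteq> Gr d"
  by (auto simp: Omega_def)

lemma infsum_mono_set_ennreal:
  fixes f :: "'a \<Rightarrow> ennreal"
  assumes "A \<subseteq> B"
  shows "infsum f A \<le> infsum f B"
  using assms by (intro infsum_le_ennreal sum_le_infsum_ennreal) auto

text \<open>The Cauchy--Schwarz step: the weight enters once through \<open>W_sum\<close> and once through the data norm.\<close>

lemma backproj_coeff_bound:
  assumes w: "(\<lambda>A. (w k A)\<^sup>2) summable_on Omega d k"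
    and fin: "data_sq d s w g < \<infinity>"
  shows "(\<lambda>A. of_real ((w k A)\<^sup>2) * fourier_coeff (g A) k) summable_on Omega d k"
    and "ennreal ((jap k powr s * cmod (backproj_coeff d w g k))\<^sup>2)
      \<le> ennreal (W_sum d w k) *
        (\<Sum>\<^sub>\<infinity>A\<in>Gr d. ennreal ((jap k powr s * cmod (of_real (w k A) * fourier_coeff (g A) k))\<^sup>2))"
proof -
  let ?J = "jap k powr s"
  let ?b = "\<lambda>A. ?J * cmod (of_real (w k A) * fourier_coeff (g A) k)"
  have J: "0 < ?J" using jap_pos[of k] by simp
  have "(\<Sum>\<^sub>\<infinity>A\<in>Omega d k. ennreal ((?b A)\<^sup>2)) \<le> (\<Sum>\<^sub>\<infinity>A\<in>Gr d. ennreal ((?b A)\<^sup>2))"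
    by (rule infsum_mono_set_ennreal[OF Omega_subset])
  note le_Gr = this
  have "(\<Sum>\<^sub>\<infinity>A\<in>Gr d. ennreal ((?b A)\<^sup>2)) \<le> data_sq d s w g"
    unfolding data_sq_swap by (rule term_le_infsum_ennreal) simp
  with fin le_Gr have "(\<Sum>\<^sub>\<infinity>A\<in>Omega d k. ennreal ((?b A)\<^sup>2)) < \<infinity>"
    by (meson order.strict_trans1)
  then have b: "(\<lambda>A. (?b A)\<^sup>2) summable_on Omega d k"
    by (rule summable_on_ennreal_finite) simp
  note cs = cauchy_schwarz_infsum[OF w b]
  have norm_eq: "\<bar>w k A * ?b A\<bar> = ?J * cmod (of_real ((w k A)\<^sup>2) * fourier_coeff (g A) k)" for A
    by (simp add: norm_mult abs_mult power2_eq_square mult_ac)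
  have "(\<lambda>A. inverse ?J * \<bar>w k A * ?b A\<bar>) summable_on Omega d k"
    by (rule summable_on_cmult_right[OF cs(1)])
  then have n: "(\<lambda>A. cmod (of_real ((w k A)\<^sup>2) * fourier_coeff (g A) k)) summable_on Omega d k"
    unfolding norm_eq using J by (simp add: mult.assoc[symmetric])
  show "(\<lambda>A. of_real ((w k A)\<^sup>2) * fourier_coeff (g A) k) summable_on Omega d k"
    using n by (rule Infinite_Sum.abs_summable_summable)
  have "?J * cmod (backproj_coeff d w g k)
      \<le> ?J * (\<Sum>\<^sub>\<infinity>A\<in>Omega d k. cmod (of_real ((w k A)\<^sup>2) * fourier_coeff (g A) k))"
    unfolding backproj_coeff_def using J by (intro mult_left_mono norm_infsum_bound n) simp
  also have "\<dots> = (\<Sum>\<^sub>\<infinity>A\<in>Omega d k. \<bar>w k A * ?b A\<bar>)"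
    unfolding norm_eq by (rule infsum_cmult_right[OF n, symmetric])
  finally have "(?J * cmod (backproj_coeff d w g k))\<^sup>2 \<le> (\<Sum>\<^sub>\<infinity>A\<in>Omega d k. \<bar>w k A * ?b A\<bar>)\<^sup>2"
    by (intro power_mono) simp_all
  also have "\<dots> \<le> W_sum d w k * (\<Sum>\<^sub>\<infinity>A\<in>Omega d k. (?b A)\<^sup>2)"
    unfolding W_sum_def by (rule cs(2))
  finally have "ennreal ((?J * cmod (backproj_coeff d w g k))\<^sup>2)
      \<le> ennreal (W_sum d w k) * ennreal (\<Sum>\<^sub>\<infinity>A\<in>Omega d k. (?b A)\<^sup>2)"
    by (subst ennreal_mult[symmetric]) (auto simp: W_sum_def intro!: infsum_nonneg ennreal_leI)
  also have "ennreal (\<Sum>\<^sub>\<infinity>A\<in>Omega d k. (?b A)\<^sup>2) = (\<Sum>\<^sub>\<infinity>A\<in>Omega d k. ennreal ((?b A)\<^sup>2))"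
    by (rule ennreal_infsum[OF b, symmetric]) simp
  also have "ennreal (W_sum d w k) * \<dots> \<le> ennreal (W_sum d w k) * (\<Sum>\<^sub>\<infinity>A\<in>Gr d. ennreal ((?b A)\<^sup>2))"
    by (intro mult_left_mono le_Gr) simp
  finally show "ennreal ((?J * cmod (backproj_coeff d w g k))\<^sup>2)
      \<le> ennreal (W_sum d w k) * (\<Sum>\<^sub>\<infinity>A\<in>Gr d. ennreal ((?b A)\<^sup>2))" .
qed

text \<open>A general multiplier covers two uses: \<open>m = 1\<close> bounds the adjoint itself,
  and \<open>m = inverse W\<close> bounds the left inverse of the transform.\<close>

lemma backproj_mult_bound:
  assumes w: "\<And>k. (\<lambda>A. (w k A)\<^sup>2) summable_on Omega d k"
    and fin: "data_sq d s w g < \<infinity>"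
    and B: "0 \<le> B" "\<And>k. (m k)\<^sup>2 * W_sum d w k \<le> B"
  shows "(\<Sum>\<^sub>\<infinity>k. ennreal ((jap k powr s * cmod (of_real (m k) * backproj_coeff d w g k))\<^sup>2))
    \<le> ennreal B * data_sq d s w g"
proof -
  let ?E = "\<lambda>k. \<Sum>\<^sub>\<infinity>A\<in>Gr d. ennreal ((jap k powr s * cmod (of_real (w k A) * fourier_coeff (g A) k))\<^sup>2)"
  have "ennreal ((jap k powr s * cmod (of_real (m k) * backproj_coeff d w g k))\<^sup>2) \<le> ennreal B * ?E k" for k
  proof -
    have "ennreal ((jap k powr s * cmod (of_real (m k) * backproj_coeff d w g k))\<^sup>2)
        = ennreal ((m k)\<^sup>2) * ennreal ((jap k powr s * cmod (backproj_coeff d w g k))\<^sup>2)"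
      by (simp add: ennreal_mult[symmetric] norm_mult power_mult_distrib mult_ac)
    also have "\<dots> \<le> ennreal ((m k)\<^sup>2) * (ennreal (W_sum d w k) * ?E k)"
      by (intro mult_left_mono backproj_coeff_bound w fin) simp
    also have "\<dots> = ennreal ((m k)\<^sup>2 * W_sum d w k) * ?E k"
      by (subst ennreal_mult) (auto simp: W_sum_def mult.assoc intro!: infsum_nonneg)
    also have "\<dots> \<le> ennreal B * ?E k"
      by (intro mult_right_mono ennreal_leI B) simp
    finally show ?thesis .
  qed
  then have "(\<Sum>\<^sub>\<infinity>k. ennreal ((jap k powr s * cmod (of_real (m k) * backproj_coeff d w g k))\<^sup>2))
      \<le> (\<Sum>\<^sub>\<infinity>k. ennreal B * ?E k)"
    by (intro infsum_mono ennreal_summable_on)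
  then show ?thesis unfolding infsum_cmult_ennreal[OF B(1)] data_sq_swap .
qed

text \<open>Where the coefficients of the transform do not vanish, \<open>A\<close> belongs to
  \<open>Omega d k\<close>, and the single term \<open>(w k A)\<^sup>2\<close> is bounded by the
  whole sum.\<close>

lemma radon_mult_domain:
  assumes w: "\<And>k. (\<lambda>A. (w k A)\<^sup>2) summable_on Omega d k" and W: "\<And>k. W_sum d w k \<le> C\<^sup>2"
    and f: "f \<in> distributions" and A: "A \<in> Gr d"
  shows "in_mult_domain (\<lambda>k. w k A) (radon d f A)"
proof -
  obtain M m where M: "0 \<le> M" "\<And>k. cmod (fourier_coeff f k) \<le> M * jap k ^ m"
    using fourier_coeff_poly_bound[OF f] by metis
  show ?thesis
  proof (rule in_mult_domain_poly_bound)
    fix k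
    show "\<bar>w k A\<bar> * cmod (fourier_coeff (radon d f A) k) \<le> (\<bar>C\<bar> * M) * jap k ^ m"
    proof (cases "perp k A")
      case True
      then have "A \<in> Omega d k" using A by (simp add: Omega_def)
      then have "(\<Sum>A\<in>{A}. (w k A)\<^sup>2) \<le> W_sum d w k"
        unfolding W_sum_def by (intro finite_sum_le_infsum w) auto
      then have "(w k A)\<^sup>2 \<le> C\<^sup>2" using W[of k] by simp
      then have "\<bar>w k A\<bar> \<le> \<bar>C\<bar>" by (simp add: abs_le_square_iff)
      then have "\<bar>w k A\<bar> * cmod (fourier_coeff f k) \<le> \<bar>C\<bar> * (M * jap k ^ m)"
        using M by (intro mult_mono) auto
      then show ?thesis using True by (simp add: fourier_coeff_radon[OF f A] mult.assoc)
    next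
      case False
      then show ?thesis
        using M(1) jap_pos[of k] by (simp add: fourier_coeff_radon[OF f A])
    qed
  qed
qed

text \<open>For fixed \<open>k\<close> only the subspaces in \<open>Omega d k\<close> contribute,
  all with the same coefficient of \<open>f\<close>. No finiteness is assumed, so that the estimate
  in (ii) is available for arbitrary distributions.\<close>

lemma data_sq_radon:
  assumes w: "\<And>k. (\<lambda>A. (w k A)\<^sup>2) summable_on Omega d k" and f: "f \<in> distributions"
  shows "data_sq d s w (radon d f)
    = (\<Sum>\<^sub>\<infinity>k. ennreal (W_sum d w k) * ennreal ((jap k powr s * cmod (fourier_coeff f k))\<^sup>2))"
  unfolding data_sq_swap
proof (rule infsum_cong)
  fix k
  let ?F = "ennreal ((jap k powr s * cmod (fourier_coeff f k))\<^sup>2)"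
  have "(\<Sum>\<^sub>\<infinity>A\<in>Gr d. ennreal ((jap k powr s * cmod (of_real (w k A) * fourier_coeff (radon d f A) k))\<^sup>2))
      = (\<Sum>\<^sub>\<infinity>A\<in>Gr d. if perp k A then ?F * ennreal ((w k A)\<^sup>2) else 0)"
    by (intro infsum_cong)
       (simp add: fourier_coeff_radon[OF f] ennreal_mult[symmetric] norm_mult power_mult_distrib mult_ac)
  also have "\<dots> = (\<Sum>\<^sub>\<infinity>A\<in>Omega d k. ?F * ennreal ((w k A)\<^sup>2))"
    unfolding Omega_def by (rule infsum_ennreal_restrict[symmetric])
  also have "\<dots> = ?F * ennreal (W_sum d w k)"
    unfolding W_sum_def by (simp only: infsum_cmult_ennreal zero_le_power2 ennreal_infsum[OF w])
  finally show "(\<Sum>\<^sub>\<infinity>A\<in>Gr d. ennreal ((jap k powr s * cmod (of_real (w k A) * fourier_coeff (radon d f A) k))\<^sup>2))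
      = ennreal (W_sum d w k) * ?F" by (simp add: mult.commute)
qed

lemma data_sq_radon_finite:
  assumes w: "\<And>k. (\<lambda>A. (w k A)\<^sup>2) summable_on Omega d k" and W: "\<And>k. W_sum d w k \<le> C\<^sup>2"
    and f: "f \<in> Hs s"
  shows "data_sq d s w (radon d f) < \<infinity>"
proof -
  have fd: "f \<in> distributions" and fin: "Hs_sq s f < \<infinity>" using f by (auto simp: Hs_iff)
  have "data_sq d s w (radon d f)
      \<le> (\<Sum>\<^sub>\<infinity>k. ennreal (C\<^sup>2) * ennreal ((jap k powr s * cmod (fourier_coeff f k))\<^sup>2))"
    unfolding data_sq_radon[OF w fd]
    by (intro infsum_mono ennreal_summable_on mult_right_mono ennreal_leI W) simp
  also have "\<dots> = ennreal (C\<^sup>2) * Hs_sq s f"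
    unfolding Hs_sq_def by (rule infsum_cmult_ennreal) simp
  also have "\<dots> < \<infinity>" using fin by (simp add: ennreal_mult_less_top)
  finally show ?thesis .
qed

lemma fourier_mult_in_Hs:
  assumes dom: "in_mult_domain (\<lambda>k. w k A) (g A)" and A: "A \<in> Gr d" and fin: "data_sq d s w g < \<infinity>"
  shows "fourier_mult (\<lambda>k. w k A) (g A) \<in> Hs s"
proof -
  have "Hs_sq s (fourier_mult (\<lambda>k. w k A) (g A)) \<le> data_sq d s w g"
    unfolding Hs_sq_fourier_mult[OF dom] data_sq_def by (rule term_le_infsum_ennreal[OF A])
  then show ?thesis
    using fin fourier_mult(1)[OF dom] by (auto simp: Hs_iff intro: order.strict_trans1)
qed

text \<open>Coefficients of \<open>radon d f\<close> select the subspaces in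
  \<open>Omega d k\<close>; what remains of the sum over \<open>A\<close>, with one weight from each
  argument, is the conjugate of \<open>backproj_coeff\<close>.\<close>

lemma data_inner_radon:
  fixes f :: "(real ^ 'n \<Rightarrow> complex) \<Rightarrow> complex"
  assumes w: "\<And>k. (\<lambda>A. (w k A)\<^sup>2) summable_on Omega d k" and W: "\<And>k. W_sum d w k \<le> C\<^sup>2"
    and f: "f \<in> Hs s" and g: "data_norm d s w g < \<infinity>"
  shows "data_inner d s w (radon d f) g
    = (\<Sum>\<^sub>\<infinity>k. of_real ((jap k powr s)\<^sup>2) * (fourier_coeff f k * cnj (backproj_coeff d w g k)))"
proof -
  have fd: "f \<in> distributions" using f by (simp add: Hs_iff)
  let ?Rf = "radon d f"
  have domR: "in_mult_domain (\<lambda>k. w k A) (?Rf A)" if "A \<in> Gr d" for A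
    using radon_mult_domain[OF w W fd that] .
  have domg: "in_mult_domain (\<lambda>k. w k A) (g A)" if "A \<in> Gr d" for A
    using data_norm_finite_mult_domain[OF g that] .
  have finR: "data_sq d s w ?Rf < \<infinity>" by (rule data_sq_radon_finite[OF w W f])
  have fing: "data_sq d s w g < \<infinity>" by (rule data_sq_finite[OF g])
  define t where "t A k = of_real ((jap k powr s)\<^sup>2) *
      ((of_real (w k A) * fourier_coeff (?Rf A) k) * cnj (of_real (w k A) * fourier_coeff (g A) k))" for A k
  have sq: "(\<lambda>(A, k). (jap k powr s * cmod (of_real (w k A) * fourier_coeff (u A) k))\<^sup>2) summable_on Gr d \<times> UNIV"
    if "data_sq d s w u < \<infinity>" for u
    using that unfolding data_sq_def by (rule summable_on_product_ennreal) simp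
  have bound: "cmod (t A k) \<le> (jap k powr s * cmod (of_real (w k A) * fourier_coeff (?Rf A) k))\<^sup>2
      + (jap k powr s * cmod (of_real (w k A) * fourier_coeff (g A) k))\<^sup>2" for A k
  proof -
    have le: "y * z \<le> y\<^sup>2 + z\<^sup>2" if "0 \<le> y" "0 \<le> z" for y z :: real
      using zero_le_power2[of "y - z"] mult_nonneg_nonneg[OF that] by (simp add: power2_diff)
    have "cmod (t A k) = (jap k powr s * cmod (of_real (w k A) * fourier_coeff (?Rf A) k)) *
        (jap k powr s * cmod (of_real (w k A) * fourier_coeff (g A) k))"
      by (simp add: t_def norm_mult power2_eq_square mult_ac)
    then show ?thesis using le by simp
  qed
  \<comment> \<open>Each term is a product of two square summable families over pairs, hence
    absolutely summable; this permits the exchange of the two sums.\<close>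
  have smt: "(\<lambda>(A, k). t A k) summable_on Gr d \<times> UNIV"
    by (rule norm_summable_on_comparison(2)[OF summable_on_add[OF sq[OF finR] sq[OF fing]]])
       (use bound in auto)
  have "data_inner d s w ?Rf g = (\<Sum>\<^sub>\<infinity>A\<in>Gr d. \<Sum>\<^sub>\<infinity>k. t A k)"
    unfolding data_inner_def
  proof (rule infsum_cong)
    fix A :: "(rat ^ 'n) set" assume A: "A \<in> Gr d"
    from infsumI[OF has_sum_Hs_inner[OF fourier_mult_in_Hs[OF domR[OF A] A finR]
        fourier_mult_in_Hs[OF domg[OF A] A fing]]]
    show "Hs_inner s (fourier_mult (\<lambda>k. w k A) (?Rf A)) (fourier_mult (\<lambda>k. w k A) (g A)) = (\<Sum>\<^sub>\<infinity>k. t A k)"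
      by (simp only: fourier_mult(2)[OF domR[OF A]] fourier_mult(2)[OF domg[OF A]] t_def)
  qed
  also have "\<dots> = (\<Sum>\<^sub>\<infinity>k. \<Sum>\<^sub>\<infinity>A\<in>Gr d. t A k)"
    by (rule infsum_swap_banach[OF smt])
  also have "\<dots> = (\<Sum>\<^sub>\<infinity>k. of_real ((jap k powr s)\<^sup>2) * (fourier_coeff f k * cnj (backproj_coeff d w g k)))"
  proof (rule infsum_cong)
    fix k
    let ?c = "of_real ((jap k powr s)\<^sup>2) * fourier_coeff f k"
    have "(\<Sum>\<^sub>\<infinity>A\<in>Gr d. t A k) = (\<Sum>\<^sub>\<infinity>A\<in>Omega d k. ?c * cnj (of_real ((w k A)\<^sup>2) * fourier_coeff (g A) k))"
      by (rule infsum_cong_neutral)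
         (auto simp: Omega_def t_def fourier_coeff_radon[OF fd] power2_eq_square mult_ac)
    also have "\<dots> = ?c * (\<Sum>\<^sub>\<infinity>A\<in>Omega d k. cnj (of_real ((w k A)\<^sup>2) * fourier_coeff (g A) k))"
      using backproj_coeff_bound(1)[OF w fing] by (intro infsum_cmult_right) (simp only: summable_on_cnj_iff)
    also have "\<dots> = ?c * cnj (backproj_coeff d w g k)"
      unfolding backproj_coeff_def by (simp only: infsum_cnj)
    finally show "(\<Sum>\<^sub>\<infinity>A\<in>Gr d. t A k)
        = of_real ((jap k powr s)\<^sup>2) * (fourier_coeff f k * cnj (backproj_coeff d w g k))"
      by (simp only: mult.assoc)
  qed
  finally show ?thesis .
qed

text \<open>Testing the adjoint identity with an element of \<open>Hs s\<close> whose only nonzero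
  coefficient is the \<open>j\<close>-th isolates the \<open>j\<close>-th coefficient of the
  candidate.\<close>

lemma adjoint_value_unique:
  fixes h h' :: "(real ^ 'n \<Rightarrow> complex) \<Rightarrow> complex"
  assumes "adjoint_value d s w g h" "adjoint_value d s w g h'"
  shows "h = h'"
proof (rule distribution_eqI)
  have h: "h \<in> Hs s" "h' \<in> Hs s" using assms by (auto simp: adjoint_value_def)
  then show "h \<in> distributions" "h' \<in> distributions" by (auto simp: Hs_iff)
  fix j
  define a where "a k = (if k = j then 1 else 0 :: complex)" for k :: "int ^ 'n"
  have "(\<Sum>\<^sub>\<infinity>k. ennreal ((jap k powr s * cmod (a k))\<^sup>2)) = (\<Sum>\<^sub>\<infinity>k\<in>{j}. ennreal ((jap k powr s)\<^sup>2))"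
    by (rule infsum_cong_neutral) (auto simp: a_def)
  then have "(\<Sum>\<^sub>\<infinity>k. ennreal ((jap k powr s * cmod (a k))\<^sup>2)) < \<infinity>" by simp
  then obtain f where f: "f \<in> Hs s" "\<And>k. fourier_coeff f k = a k"
    by (rule in_Hs_of_coeffs) (rule that)
  have val: "Hs_inner s f u = of_real ((jap j powr s)\<^sup>2) * cnj (fourier_coeff u j)" if "u \<in> Hs s" for u
  proof -
    have "Hs_inner s f u = (\<Sum>\<^sub>\<infinity>k. of_real ((jap k powr s)\<^sup>2) * (a k * cnj (fourier_coeff u k)))"
      using infsumI[OF has_sum_Hs_inner[OF f(1) that]] f(2) by simp
    also have "\<dots> = (\<Sum>\<^sub>\<infinity>k\<in>{j}. of_real ((jap k powr s)\<^sup>2) * cnj (fourier_coeff u k))"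
      by (rule infsum_cong_neutral) (auto simp: a_def)
    finally show ?thesis by simp
  qed
  have "Hs_inner s f h = Hs_inner s f h'"
    using assms f(1) by (simp add: adjoint_value_def)
  then have "cnj (fourier_coeff h j) = cnj (fourier_coeff h' j)"
    unfolding val[OF h(1)] val[OF h(2)] using jap_pos[of j] by simp
  then show "fourier_coeff h j = fourier_coeff h' j" by simp
qed

text \<open>The distribution with coefficients \<open>backproj_coeff\<close> lies in
  \<open>Hs s\<close> by the Cauchy--Schwarz bound and satisfies the adjoint identity; by uniqueness
  it is the described adjoint.\<close>

lemma radon_adjoint_data_space:
  fixes g :: "(rat ^ 'n) set \<Rightarrow> (real ^ 'n \<Rightarrow> complex) \<Rightarrow> complex"
  assumes w: "\<And>k. (\<lambda>A. (w k A)\<^sup>2) summable_on Omega d k" and W: "\<And>k. W_sum d w k \<le> C\<^sup>2"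
    and g: "g \<in> data_space d s w"
  shows "radon_adjoint d s w g \<in> Hs s"
    and "fourier_coeff (radon_adjoint d s w g) k = backproj_coeff d w g k"
proof -
  have gn: "data_norm d s w g < \<infinity>" using g by (simp add: data_space_def)
  note fin = data_sq_finite[OF gn]
  have "(\<Sum>\<^sub>\<infinity>k. ennreal ((jap k powr s * cmod (of_real 1 * backproj_coeff d w g k))\<^sup>2))
      \<le> ennreal (C\<^sup>2) * data_sq d s w g"
    by (rule backproj_mult_bound[OF w fin]) (simp_all add: W)
  also have "\<dots> < \<infinity>" using fin by (simp add: ennreal_mult_less_top)
  finally obtain h where h: "h \<in> Hs s" "\<And>k. fourier_coeff h k = backproj_coeff d w g k"
    using in_Hs_of_coeffs[of s "backproj_coeff d w g"] by auto
  have "adjoint_value d s w g h"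
    unfolding adjoint_value_def
  proof (intro conjI ballI h(1))
    fix f :: "(real ^ 'n \<Rightarrow> complex) \<Rightarrow> complex" assume f: "f \<in> Hs s"
    show "data_inner d s w (radon d f) g = Hs_inner s f h"
      unfolding data_inner_radon[OF w W f gn] h(2)[symmetric]
      by (rule infsumI[OF has_sum_Hs_inner[OF f h(1)]])
  qed
  then have "(THE h. adjoint_value d s w g h) = h"
    using adjoint_value_unique by (intro the_equality)
  then have "radon_adjoint d s w g = h" using g by (simp add: radon_adjoint_def)
  then show "radon_adjoint d s w g \<in> Hs s"
    "fourier_coeff (radon_adjoint d s w g) k = backproj_coeff d w g k"
    using h by auto
qed

text \<open>On Radon data the back projection multiplies the \<open>k\<close>-th coefficient by
  \<open>W_sum d w k\<close>, which is 1 here. As \<open>f\<close> is arbitrary,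
  \<open>radon d f\<close> may lie outside the data space, and both branches of
  \<open>radon_adjoint\<close> have to return \<open>f\<close>.\<close>

lemma radon_adjoint_radon:
  assumes w: "\<And>k. (\<lambda>A. (w k A)\<^sup>2) summable_on Omega d k" and W: "\<And>k. W_sum d w k = 1"
    and f: "f \<in> distributions"
  shows "radon_adjoint d s w (radon d f) = f"
proof -
  have coeff: "backproj_coeff d w (radon d f) k = fourier_coeff f k" for k
  proof -
    have "backproj_coeff d w (radon d f) k = (\<Sum>\<^sub>\<infinity>A\<in>Omega d k. of_real ((w k A)\<^sup>2) * fourier_coeff f k)"
      unfolding backproj_coeff_def
      by (intro infsum_cong) (auto simp: Omega_def fourier_coeff_radon[OF f])
    also have "\<dots> = of_real (W_sum d w k) * fourier_coeff f k"
      unfolding W_sum_def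
      using has_sum_cmult_left[OF has_sum_of_real[OF has_sum_infsum[OF w]], where c = "fourier_coeff f k"]
      by (rule infsumI)
    finally show ?thesis by (simp add: W)
  qed
  show ?thesis
  proof (cases "radon d f \<in> data_space d s w")
    case True
    have W1: "W_sum d w k \<le> 1\<^sup>2" for k by (simp add: W)
    show ?thesis
      using radon_adjoint_data_space[OF w W1 True] f
      by (intro distribution_eqI) (auto simp: coeff Hs_iff)
  next
    case False
    have "(THE h. backproj_value d w (radon d f) h) = f"
      unfolding backproj_value_def backproj_coeff_def[symmetric] coeff
      by (rule the_equality) (auto intro: distribution_eqI f)
    then show ?thesis using False by (simp add: radon_adjoint_def)
  qed
qed

theorem corollary1p2:
  fixes d :: nat and s c C :: real
    and w :: "int ^ 'n \<Rightarrow> (rat ^ 'n) set \<Rightarrow> real"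
  assumes "CARD('n) \<ge> 2" and "1 \<le> d" and "d \<le> CARD('n) - 1"
    and "weight d w"
    and "C > 0" and "c > 0"
    and "\<And>k. c\<^sup>2 \<le> W_sum d w k \<and> W_sum d w k \<le> C\<^sup>2"
  shows
    "((\<forall>g\<in>data_space d s w.
         fourier_mult (\<lambda>k. inverse (W_sum d w k)) (radon_adjoint d s w g) \<in> Hs s) \<and>
      (\<forall>g\<in>data_space d s w. \<forall>h\<in>data_space d s w.
         Hs_norm s (fourier_mult (\<lambda>k. inverse (W_sum d w k)) (radon_adjoint d s w g) -
                    fourier_mult (\<lambda>k. inverse (W_sum d w k)) (radon_adjoint d s w h))
           \<le> ennreal (1 / c) * data_norm d s w (g - h))) \<and>
     (\<forall>f\<in>distributions. Hs_norm s f \<le> ennreal (1 / c) * data_norm d s w (radon d f)) \<and>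
     (let w' = (\<lambda>k A. w k A / sqrt (W_sum d w k)) in
       \<forall>p::ennreal. 1 \<le> p \<longrightarrow> (\<forall>f\<in>distributions.
         radon_adjoint d s w' (radon d f) = f \<and>
         Lps_norm s p f = Lps_norm s p (radon_adjoint d s w' (radon d f))))"
proof -
  define m where "m k = inverse (W_sum d w k)" for k
  have c: "0 < c" by fact
  have Wl: "c\<^sup>2 \<le> W_sum d w k" and Wu: "W_sum d w k \<le> C\<^sup>2" for k using assms(7) by auto
  have Wpos: "0 < W_sum d w k" for k using less_le_trans[OF zero_less_power[OF c] Wl] .
  have w: "(\<lambda>A. (w k A)\<^sup>2) summable_on Omega d k" for k
    using Wpos[of k] infsum_not_exists unfolding W_sum_def by fastforce
  note adj = radon_adjoint_data_space[OF w Wu]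
  \<comment> \<open>The last bound is the source of the constant: one factor of
    \<open>(m k)\<^sup>2\<close> cancels the Cauchy--Schwarz factor
    \<open>W_sum d w k\<close>.\<close>
  have m: "0 \<le> m k" "m k \<le> 1 / c\<^sup>2" "(m k)\<^sup>2 * W_sum d w k \<le> 1 / c\<^sup>2" for k
  proof -
    show "0 \<le> m k" using Wpos[of k] by (simp add: m_def)
    show le: "m k \<le> 1 / c\<^sup>2"
      using Wl[of k] c by (simp add: m_def inverse_eq_divide frac_le)
    have "(m k)\<^sup>2 * W_sum d w k = m k"
      using Wpos[of k] by (simp add: m_def power2_eq_square mult.assoc)
    with le show "(m k)\<^sup>2 * W_sum d w k \<le> 1 / c\<^sup>2" by simp
  qed
  have dom: "in_mult_domain m (radon_adjoint d s w g)" if g: "g \<in> data_space d s w" for g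
    using adj(1)[OF g] m by (intro in_mult_domain_poly_mult[where B = "1 / c\<^sup>2" and l = 0]) (auto simp: Hs_iff)
  note fm = fourier_mult[OF dom]
  have sq: "Hs_sq s (fourier_mult m (radon_adjoint d s w g)) \<le> ennreal (1 / c\<^sup>2) * data_sq d s w g"
    if g: "g \<in> data_space d s w" for g
    unfolding Hs_sq_fourier_mult[OF dom[OF g]] adj(2)[OF g]
    using g m by (intro backproj_mult_bound w data_sq_finite) (auto simp: data_space_def)
  have inHs: "fourier_mult m (radon_adjoint d s w g) \<in> Hs s" if g: "g \<in> data_space d s w" for g
  proof -
    have "ennreal (1 / c\<^sup>2) * data_sq d s w g < \<infinity>"
      using g data_sq_finite by (auto simp: data_space_def ennreal_mult_less_top)
    then show ?thesis
      using sq[OF g] fm(1)[OF g] by (auto simp: Hs_iff intro: order.strict_trans1)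
  qed
  have nrm: "Hs_norm s (fourier_mult m (radon_adjoint d s w g)) \<le> ennreal (1 / c) * data_norm d s w g"
    if g: "g \<in> data_space d s w" for g
  proof -
    have gn: "data_norm d s w g < \<infinity>" using g by (simp add: data_space_def)
    have "ennreal (c\<^sup>2) * Hs_sq s (fourier_mult m (radon_adjoint d s w g))
        \<le> ennreal (c\<^sup>2) * (ennreal (1 / c\<^sup>2) * data_sq d s w g)"
      by (intro mult_left_mono sq g) simp
    also have "\<dots> = data_sq d s w g"
      using c by (simp add: mult.assoc[symmetric] ennreal_mult[symmetric])
    finally have "ennreal (c\<^sup>2) * Hs_sq s (fourier_mult m (radon_adjoint d s w g)) \<le> data_sq d s w g" .
    moreover have "data_norm d s w g = ennreal_powr (data_sq d s w g) (1 / 2)"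
      by (rule data_norm_eq[OF data_norm_finite_mult_domain[OF gn]])
    ultimately show ?thesis
      by (simp only: Hs_norm_eq[OF fm(1)[OF g]] ennreal_powr_half_le[OF c])
  qed
  have lip: "Hs_norm s (fourier_mult m (radon_adjoint d s w g) - fourier_mult m (radon_adjoint d s w h))
      \<le> ennreal (1 / c) * data_norm d s w (g - h)"
    if g: "g \<in> data_space d s w" and h: "h \<in> data_space d s w" for g h
  \<comment> \<open>If the norm of the difference is infinite, there is nothing to prove. Otherwise
    the difference belongs to the data space, and linearity reduces the claim to the norm
    bound.\<close>
  proof (cases "data_norm d s w (g - h) < \<infinity>")
    case True
    have gh: "g - h \<in> data_space d s w"
      using g h True by (auto simp: data_space_def intro: distributions_diff)
    have "fourier_mult m (radon_adjoint d s w g) - fourier_mult m (radon_adjoint d s w h)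
        = fourier_mult m (radon_adjoint d s w (g - h))"
    proof (rule distribution_eqI)
      fix k
      have sm: "(\<lambda>A. of_real ((w k A)\<^sup>2) * fourier_coeff (u A) k) summable_on Omega d k"
        if "u \<in> data_space d s w" for u
        using that by (intro backproj_coeff_bound(1)[OF w data_sq_finite[where s = s]]) (simp add: data_space_def)
      have "backproj_coeff d w (g - h) k = backproj_coeff d w g k - backproj_coeff d w h k"
        unfolding backproj_coeff_def
        using infsum_add[OF sm[OF g] summable_on_uminus[THEN iffD2, OF sm[OF h]]]
        by (simp add: fourier_coeff_diff right_diff_distrib infsum_uminus)
      then show "fourier_coeff (fourier_mult m (radon_adjoint d s w g) - fourier_mult m (radon_adjoint d s w h)) k
          = fourier_coeff (fourier_mult m (radon_adjoint d s w (g - h))) k"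
        by (simp add: fourier_coeff_diff fm g h gh adj right_diff_distrib)
    qed (auto intro: distributions_diff fm g h gh)
    then show ?thesis using nrm[OF gh] by simp
  next
    case False
    then have "ennreal (1 / c) * data_norm d s w (g - h) = \<infinity>"
      using c by (simp add: less_top[symmetric] ennreal_mult_top)
    then show ?thesis by simp
  qed
  have ii: "Hs_norm s f \<le> ennreal (1 / c) * data_norm d s w (radon d f)" if f: "f \<in> distributions" for f
  proof -
    have "ennreal (c\<^sup>2) * Hs_sq s f
        = (\<Sum>\<^sub>\<infinity>k. ennreal (c\<^sup>2) * ennreal ((jap k powr s * cmod (fourier_coeff f k))\<^sup>2))"
      unfolding Hs_sq_def by (rule infsum_cmult_ennreal[symmetric]) simp
    also have "\<dots> \<le> data_sq d s w (radon d f)"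
      unfolding data_sq_radon[OF w f]
      by (intro infsum_mono ennreal_summable_on mult_right_mono ennreal_leI Wl) simp
    finally have "ennreal (c\<^sup>2) * Hs_sq s f \<le> data_sq d s w (radon d f)" .
    moreover have "data_norm d s w (radon d f) = ennreal_powr (data_sq d s w (radon d f)) (1 / 2)"
      by (rule data_norm_eq[OF radon_mult_domain[OF w Wu f]])
    ultimately show ?thesis
      by (simp only: Hs_norm_eq[OF f] ennreal_powr_half_le[OF c])
  qed
  define w' where "w' = (\<lambda>k A. w k A / sqrt (W_sum d w k))"
  have w'_sq: "(w' k A)\<^sup>2 = inverse (W_sum d w k) * (w k A)\<^sup>2" for k A
    using Wpos[of k] by (simp add: w'_def power_divide field_simps)
  have w's: "(\<lambda>A. (w' k A)\<^sup>2) summable_on Omega d k" for k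
    unfolding w'_sq by (rule summable_on_cmult_right[OF w])
  have W': "W_sum d w' k = 1" for k
  proof -
    have "W_sum d w' k = inverse (W_sum d w k) * W_sum d w k"
      unfolding W_sum_def[of d w'] w'_sq infsum_cmult_right[OF w] W_sum_def[symmetric] ..
    then show ?thesis using Wpos[of k] by simp
  qed
  \<comment> \<open>Being an equality of distributions, it yields the identity of norms for every
    \<open>p\<close> by rewriting.\<close>
  have iii: "radon_adjoint d s w' (radon d f) = f" if "f \<in> distributions" for f
    using radon_adjoint_radon[OF w's W' that] .
  show ?thesis
    unfolding m_def[symmetric] Let_def w'_def[symmetric]
    using inHs lip ii iii by simp
qed

end
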